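(* Let $\Omega\subset\mathbf{R}^d$ be open and bounded, and let $m\colon\Omega\to(0,\infty)$ be (measurable and) such that $\frac1m\in L_{2,\mathrm{loc}}(\Omega)$. Define the operator, formally denoted by $(m\Delta m)$, on $L_2(\Omega)$ as follows: for $w,f\in L_2(\Omega)$, $w\in D((m\Delta m))$ and $(m\Delta m)\,w=f$ if and only if $mw\in H^1_0(\Omega)$ and $\Delta(mw)=\frac fm$ in $\mathcal{D}(\Omega)'$. Then the operator $(m\Delta m)$ is self-adjoint and $(m\Delta m)$ generates a positive semigroup $S$. Moreover, the set $$C=\{f\in L_2(\Omega,\mathbf{R}):f\le\tfrac1m\}$$ is invariant under $S$.
   Context: $\mathcal{D}(\Omega)'$ is the space of distributions on $\Omega$; note $\frac fm\in L_{1,\mathrm{loc}}(\Omega)$ for $f\in L_2(\Omega)$. A semigroup $S$ on $L_2(\Omega)$ is positive if $S_tu\ge0$ for all $t>0$ and $u\ge0$; $C$ is invariant under $S$ if $S_tC\subset C$ for all $t>0$. *)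

theory Defs
  imports "HOL-Analysis.Analysis"
begin

section \<open>The spaces L2\<close>

text \<open>
  Elements of L2 are represented by functions, and equality in L2 is equality almost everywhere.
  With the measure \<^term>\<open>lebesgue_on \<Omega>\<close> the values outside \<open>\<Omega>\<close> are irrelevant. All sets and
  relations on L2 defined below contain, with a function, every function that is almost everywhere
  equal to it, so that equality of such sets is equality of the corresponding sets of classes.
\<close>

definition L2 :: "'a measure \<Rightarrow> ('a \<Rightarrow> 'b::real_normed_vector) set" where
  "L2 M = {f. f \<in> borel_measurable M \<and> integrable M (\<lambda>x. (norm (f x))\<^sup>2)}"

definition L2_norm :: "'a measure \<Rightarrow> ('a \<Rightarrow> 'b::real_normed_vector) \<Rightarrow> real" where
  "L2_norm M f = sqrt (LINT x|M. (norm (f x))\<^sup>2)"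

definition L2_inner :: "'a measure \<Rightarrow> ('a \<Rightarrow> complex) \<Rightarrow> ('a \<Rightarrow> complex) \<Rightarrow> complex" where
  "L2_inner M f g = (LINT x|M. f x * cnj (g x))"

definition L2_eq :: "'a measure \<Rightarrow> ('a \<Rightarrow> 'b) \<Rightarrow> ('a \<Rightarrow> 'b) \<Rightarrow> bool" where
  "L2_eq M f g \<longleftrightarrow> (AE x in M. f x = g x)"

definition L2_loc :: "'a::euclidean_space set \<Rightarrow> ('a \<Rightarrow> 'b::real_normed_vector) set" where
  "L2_loc \<Omega> = {f. \<forall>K. compact K \<and> K \<subseteq> \<Omega> \<longrightarrow> f \<in> L2 (lebesgue_on K)}"


section \<open>Test functions and distributions\<close>

definition partial :: "'a::euclidean_space \<Rightarrow> ('a \<Rightarrow> complex) \<Rightarrow> 'a \<Rightarrow> complex" where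
  "partial b f x = frechet_derivative f (at x) b"

fun C_k :: "nat \<Rightarrow> ('a::euclidean_space \<Rightarrow> complex) \<Rightarrow> bool" where
  "C_k 0 f \<longleftrightarrow> continuous_on UNIV f"
| "C_k (Suc k) f \<longleftrightarrow> (\<forall>x. f differentiable (at x)) \<and> (\<forall>b\<in>Basis. C_k k (partial b f))"

definition test_functions :: "'a::euclidean_space set \<Rightarrow> ('a \<Rightarrow> complex) set" where
  "test_functions \<Omega> =
    {\<phi>. (\<forall>k. C_k k \<phi>) \<and> compact (closure {x. \<phi> x \<noteq> 0}) \<and> closure {x. \<phi> x \<noteq> 0} \<subseteq> \<Omega>}"

text \<open>
  A distribution on \<open>\<Omega>\<close> enters only through its values on test functions, and every functional to
  which \<open>distr_eq\<close> is applied below is built from a locally integrable function, so it is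
  automatically linear and continuous; these properties are therefore not recorded in the type.
\<close>

type_synonym 'a functional = "('a \<Rightarrow> complex) \<Rightarrow> complex"

definition distr_eq :: "'a::euclidean_space set \<Rightarrow> 'a functional \<Rightarrow> 'a functional \<Rightarrow> bool" where
  "distr_eq \<Omega> T U \<longleftrightarrow> (\<forall>\<phi>\<in>test_functions \<Omega>. T \<phi> = U \<phi>)"

definition regular_distr :: "'a::euclidean_space set \<Rightarrow> ('a \<Rightarrow> complex) \<Rightarrow> 'a functional" where
  "regular_distr \<Omega> g \<phi> = (LINT x|lebesgue_on \<Omega>. g x * \<phi> x)"

definition distr_partial :: "'a::euclidean_space \<Rightarrow> 'a functional \<Rightarrow> 'a functional" where
  "distr_partial b T \<phi> = - T (partial b \<phi>)"

definition distr_laplacian :: "'a::euclidean_space functional \<Rightarrow> 'a functional" where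
  "distr_laplacian T \<phi> = (\<Sum>b\<in>Basis. distr_partial b (distr_partial b T) \<phi>)"


section \<open>Sobolev spaces\<close>

definition has_weak_partial ::
    "'a::euclidean_space set \<Rightarrow> 'a \<Rightarrow> ('a \<Rightarrow> complex) \<Rightarrow> ('a \<Rightarrow> complex) \<Rightarrow> bool" where
  "has_weak_partial \<Omega> b u g \<longleftrightarrow> g \<in> L2 (lebesgue_on \<Omega>) \<and>
     distr_eq \<Omega> (distr_partial b (regular_distr \<Omega> u)) (regular_distr \<Omega> g)"

definition H1 :: "'a::euclidean_space set \<Rightarrow> ('a \<Rightarrow> complex) set" where
  "H1 \<Omega> = {u \<in> L2 (lebesgue_on \<Omega>). \<forall>b\<in>Basis. \<exists>g. has_weak_partial \<Omega> b u g}"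

text \<open>The choice is immaterial: weak partial derivatives are unique almost everywhere.\<close>

definition weak_partial :: "'a::euclidean_space set \<Rightarrow> 'a \<Rightarrow> ('a \<Rightarrow> complex) \<Rightarrow> 'a \<Rightarrow> complex" where
  "weak_partial \<Omega> b u = (SOME g. has_weak_partial \<Omega> b u g)"

definition H1_norm :: "'a::euclidean_space set \<Rightarrow> ('a \<Rightarrow> complex) \<Rightarrow> real" where
  "H1_norm \<Omega> u = sqrt ((L2_norm (lebesgue_on \<Omega>) u)\<^sup>2
     + (\<Sum>b\<in>Basis. (L2_norm (lebesgue_on \<Omega>) (weak_partial \<Omega> b u))\<^sup>2))"

text \<open>The closure of the test functions in \<^term>\<open>H1 \<Omega>\<close>.\<close>

definition H1_0 :: "'a::euclidean_space set \<Rightarrow> ('a \<Rightarrow> complex) set" where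
  "H1_0 \<Omega> = {u \<in> H1 \<Omega>. \<exists>\<phi>::nat \<Rightarrow> 'a \<Rightarrow> complex. (\<forall>n. \<phi> n \<in> test_functions \<Omega>) \<and>
     (\<lambda>n. H1_norm \<Omega> (\<lambda>x. \<phi> n x - u x)) \<longlonglongrightarrow> 0}"


section \<open>Unbounded operators on L2\<close>

text \<open>An operator is identified with its graph.\<close>

type_synonym 'a graph = "(('a \<Rightarrow> complex) \<times> ('a \<Rightarrow> complex)) set"

definition linear_operator :: "'a measure \<Rightarrow> 'a graph \<Rightarrow> bool" where
  "linear_operator M A \<longleftrightarrow>
     A \<subseteq> L2 M \<times> L2 M \<and>
     (\<lambda>x. 0, \<lambda>x. 0) \<in> A \<and>
     (\<forall>(u, f)\<in>A. \<forall>(v, g)\<in>A. (\<lambda>x. u x + v x, \<lambda>x. f x + g x) \<in> A) \<and>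
     (\<forall>c. \<forall>(u, f)\<in>A. (\<lambda>x. c * u x, \<lambda>x. c * f x) \<in> A) \<and>
     (\<forall>(u, f)\<in>A. \<forall>v\<in>L2 M. \<forall>g\<in>L2 M. L2_eq M u v \<and> L2_eq M f g \<longrightarrow> (v, g) \<in> A) \<and>
     (\<forall>(u, f)\<in>A. \<forall>(v, g)\<in>A. L2_eq M u v \<longrightarrow> L2_eq M f g)"

definition densely_defined :: "'a measure \<Rightarrow> 'a graph \<Rightarrow> bool" where
  "densely_defined M A \<longleftrightarrow>
     (\<forall>u\<in>L2 M. \<forall>e>0. \<exists>w\<in>Domain A. L2_norm M (\<lambda>x. w x - u x) < e)"

definition adjoint_graph :: "'a measure \<Rightarrow> 'a graph \<Rightarrow> 'a graph" where
  "adjoint_graph M A =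
     {(v, g). v \<in> L2 M \<and> g \<in> L2 M \<and> (\<forall>(u, f)\<in>A. L2_inner M f v = L2_inner M u g)}"

definition self_adjoint :: "'a measure \<Rightarrow> 'a graph \<Rightarrow> bool" where
  "self_adjoint M A \<longleftrightarrow> linear_operator M A \<and> densely_defined M A \<and> adjoint_graph M A = A"


section \<open>Strongly continuous semigroups on L2\<close>

definition bounded_operator ::
    "'a measure \<Rightarrow> (('a \<Rightarrow> complex) \<Rightarrow> ('a \<Rightarrow> complex)) \<Rightarrow> bool" where
  "bounded_operator M T \<longleftrightarrow>
     (\<forall>u\<in>L2 M. T u \<in> L2 M) \<and>
     (\<forall>u\<in>L2 M. \<forall>v\<in>L2 M. L2_eq M u v \<longrightarrow> L2_eq M (T u) (T v)) \<and>
     (\<forall>u\<in>L2 M. \<forall>v\<in>L2 M. L2_eq M (T (\<lambda>x. u x + v x)) (\<lambda>x. T u x + T v x)) \<and>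
     (\<forall>c. \<forall>u\<in>L2 M. L2_eq M (T (\<lambda>x. c * u x)) (\<lambda>x. c * T u x)) \<and>
     (\<exists>K. \<forall>u\<in>L2 M. L2_norm M (T u) \<le> K * L2_norm M u)"

text \<open>Only the values of a semigroup at times \<open>t \<ge> 0\<close> are relevant.\<close>

type_synonym 'a semigroup = "real \<Rightarrow> ('a \<Rightarrow> complex) \<Rightarrow> ('a \<Rightarrow> complex)"

definition C0_semigroup :: "'a measure \<Rightarrow> 'a semigroup \<Rightarrow> bool" where
  "C0_semigroup M S \<longleftrightarrow>
     (\<forall>t\<ge>0. bounded_operator M (S t)) \<and>
     (\<forall>u\<in>L2 M. L2_eq M (S 0 u) u) \<and>
     (\<forall>s\<ge>0. \<forall>t\<ge>0. \<forall>u\<in>L2 M. L2_eq M (S (s + t) u) (S s (S t u))) \<and>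
     (\<forall>u\<in>L2 M. ((\<lambda>t. L2_norm M (\<lambda>x. S t u x - u x)) \<longlongrightarrow> 0) (at_right 0))"

definition semigroup_generator :: "'a measure \<Rightarrow> 'a semigroup \<Rightarrow> 'a graph" where
  "semigroup_generator M S = {(u, f). u \<in> L2 M \<and> f \<in> L2 M \<and>
     ((\<lambda>t. L2_norm M (\<lambda>x. (S t u x - u x) / complex_of_real t - f x)) \<longlongrightarrow> 0) (at_right 0)}"

definition generates :: "'a measure \<Rightarrow> 'a graph \<Rightarrow> 'a semigroup \<Rightarrow> bool" where
  "generates M A S \<longleftrightarrow> C0_semigroup M S \<and> semigroup_generator M S = A"

text \<open>As usual, \<open>u \<ge> 0\<close> for a complex-valued \<open>u\<close> includes that \<open>u\<close> is real-valued.\<close>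

definition L2_nonneg :: "'a measure \<Rightarrow> ('a \<Rightarrow> complex) \<Rightarrow> bool" where
  "L2_nonneg M u \<longleftrightarrow> (AE x in M. u x \<in> \<real> \<and> 0 \<le> Re (u x))"

definition positive_semigroup :: "'a measure \<Rightarrow> 'a semigroup \<Rightarrow> bool" where
  "positive_semigroup M S \<longleftrightarrow> (\<forall>t>0. \<forall>u\<in>L2 M. L2_nonneg M u \<longrightarrow> L2_nonneg M (S t u))"

definition invariant_under :: "'a semigroup \<Rightarrow> ('a \<Rightarrow> complex) set \<Rightarrow> bool" where
  "invariant_under S C \<longleftrightarrow> (\<forall>t>0. S t ` C \<subseteq> C)"


section \<open>The operator and the convex set\<close>

definition m_Delta_m :: "'a::euclidean_space set \<Rightarrow> ('a \<Rightarrow> real) \<Rightarrow> 'a graph" where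
  "m_Delta_m \<Omega> m = {(w, f). w \<in> L2 (lebesgue_on \<Omega>) \<and> f \<in> L2 (lebesgue_on \<Omega>) \<and>
     (\<lambda>x. complex_of_real (m x) * w x) \<in> H1_0 \<Omega> \<and>
     distr_eq \<Omega> (distr_laplacian (regular_distr \<Omega> (\<lambda>x. complex_of_real (m x) * w x)))
                (regular_distr \<Omega> (\<lambda>x. f x / complex_of_real (m x)))}"

definition C_set :: "'a::euclidean_space set \<Rightarrow> ('a \<Rightarrow> real) \<Rightarrow> ('a \<Rightarrow> complex) set" where
  "C_set \<Omega> m = {f \<in> L2 (lebesgue_on \<Omega>). AE x in lebesgue_on \<Omega>. f x \<in> \<real> \<and> Re (f x) \<le> 1 / m x}"

end

theory Submission
  imports Defs
begin

text \<open>
  Let \<open>T\<close> be the closed operator \<open>w \<mapsto> \<nabla>(m w)\<close> whose graph \<open>G\<close> is the closure of the pairs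
  \<open>(\<phi>/m, \<nabla>\<phi>)\<close> with \<open>\<phi>\<close> a test function; by the Poincare inequality \<open>m w\<close> is controlled by the
  gradient. The operator \<open>- T\<^sup>* T\<close> is self-adjoint and dissipative, so
  its Yosida approximations generate contractions that converge to a semigroup (Hille-Yosida).

  It coincides with \<open>(m \<Delta> m)\<close> because every \<open>w\<close> in \<open>L2\<close> with \<open>m w\<close> in \<open>H1_0\<close> lies in the
  domain of \<open>G\<close>: if test functions \<open>\<phi>\<^sub>n\<close> converge to \<open>u = m w\<close>, then
  \<open>2 |\<phi>\<^sub>n|^2 \<phi>\<^sub>j / (|\<phi>\<^sub>n|^2 + |\<phi>\<^sub>j|^2 + \<epsilon>\<^sub>n)\<close>, divided by \<open>m\<close>, converges to \<open>w\<close> in \<open>L2\<close> by dominated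
  convergence (first in \<open>j\<close>, where the support of \<open>\<phi>\<^sub>n\<close> is compact, then in \<open>n\<close>), with bounded gradients.

  The resolvent minimises \<open>|w - f|^2 + h |\<nabla>(m w)|^2\<close>, and replacing \<open>w\<close> by \<open>min w (1/m)\<close> does not
  increase this functional when \<open>f \<le> 1/m\<close>. Hence the resolvents, and with them the semigroup, leave
  the set \<open>C\<close> invariant. Positivity follows from the invariance of \<open>C\<close> by scaling.
\<close>

section \<open>Hilbert spaces\<close>

text \<open>The weight \<open>1 / m\<close> is only locally square integrable, so it may be
  arbitrarily singular near the boundary of \<Omega>. If test functions converge to
  \<open>m w\<close> in \<open>H1\<close>, their quotients by \<open>m\<close> need not converge to
  \<open>w\<close> in \<open>L2\<close>, and direct approximation does not place \<open>w\<close> in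
  the domain of \<open>G\<close>. The blended functions are controlled from two sides: by the
  compactly supported \<open>\<phi>\<^sub>n\<close>, whose quotient by \<open>m\<close> is in
  \<open>L2\<close>, and by twice their other argument, which becomes \<open>2 |w|\<close> after
  division by \<open>m\<close> in the limit. Bounded gradients suffice because a closed subspace of
  a Hilbert space is weakly closed; this is expressed by decreasing sequences of closed convex sets.

  The Hilbert space is a type, hence made of functions on the whole space rather than on \<Omega>;
  the operator is extended so that it acts as zero outside \<Omega>. The Hilbert space is treated as
  a real one, and complex linearity is recovered from the fact that every construction commutes with
  multiplication by \<i>.\<close>

lemma closed_convex_min_norm:
  fixes S :: "'h::{real_inner,complete_space} set"
  assumes "closed S" "convex S" "S \<noteq> {}"
  obtains p where "p \<in> S" "\<And>s. s \<in> S \<Longrightarrow> norm p \<le> norm s"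
proof -
  define d where "d = Inf (norm ` S)"
  have bdd: "bdd_below (norm ` S)" by (rule bdd_belowI[of _ 0]) auto
  have dle: "d \<le> norm s" if "s \<in> S" for s
    unfolding d_def by (rule cInf_lower) (use that bdd in auto)
  have d0: "0 \<le> d" unfolding d_def by (rule cInf_greatest) (use assms in auto)
  have ex: "\<exists>s\<in>S. norm s < d + 1 / real (Suc n)" for n
  proof -
    have "Inf (norm ` S) < d + 1 / real (Suc n)" by (simp add: d_def)
    then show ?thesis using cInf_lessD[of "norm ` S"] assms by auto
  qed
  then obtain s where s: "\<And>n. s n \<in> S" "\<And>n. norm (s n) < d + 1 / real (Suc n)" by metis
  \<comment> \<open>Parallelogram law: the midpoint of \<open>s i\<close> and \<open>s j\<close>
    stays in \<open>S\<close>, so its norm is at least \<open>d\<close>, which forces a minimising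
    sequence to be Cauchy.\<close>
  have mid: "(dist (s i) (s j))\<^sup>2 \<le> 2 * (norm (s i))\<^sup>2 + 2 * (norm (s j))\<^sup>2 - 4 * d\<^sup>2" for i j
  proof -
    have "(1/2) *\<^sub>R s i + (1/2) *\<^sub>R s j \<in> S"
      using assms(2) s(1) by (auto simp: convex_def)
    then have "d \<le> norm ((1/2) *\<^sub>R (s i + s j))" using dle by (simp add: scaleR_add_right)
    then have "2 * d \<le> norm (s i + s j)" by simp
    then have "(2 * d)\<^sup>2 \<le> (norm (s i + s j))\<^sup>2" using d0 by (intro power_mono) auto
    then show ?thesis
      by (simp add: dist_norm power2_norm_eq_inner inner_add inner_diff inner_commute algebra_simps)
  qed
  have lim: "(\<lambda>n. norm (s n)) \<longlonglongrightarrow> d"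
  proof (rule tendsto_sandwich[where f="\<lambda>_. d" and h="\<lambda>n. d + 1 / real (Suc n)"])
    show "(\<lambda>n. d + 1 / real (Suc n)) \<longlonglongrightarrow> d"
      using tendsto_add[OF tendsto_const LIMSEQ_Suc[OF lim_1_over_n], of d] by simp
    show "\<forall>\<^sub>F n in sequentially. d \<le> norm (s n)" using dle s(1) by simp
    show "\<forall>\<^sub>F n in sequentially. norm (s n) \<le> d + 1 / real (Suc n)"
      using less_imp_le[OF s(2)] by simp
  qed simp
  have "Cauchy s"
  proof (rule metric_CauchyI)
    fix e :: real assume e: "e > 0"
    have "(\<lambda>n. (norm (s n))\<^sup>2) \<longlonglongrightarrow> d\<^sup>2" by (intro tendsto_intros lim)
    then have "\<forall>\<^sub>F n in sequentially. (norm (s n))\<^sup>2 < d\<^sup>2 + e\<^sup>2 / 4"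
      by (rule order_tendstoD) (use e in simp)
    then obtain N where N: "\<And>n. n \<ge> N \<Longrightarrow> (norm (s n))\<^sup>2 < d\<^sup>2 + e\<^sup>2 / 4"
      by (auto simp: eventually_sequentially)
    have "dist (s i) (s j) < e" if "i \<ge> N" "j \<ge> N" for i j
    proof -
      have "(dist (s i) (s j))\<^sup>2 < e\<^sup>2" using mid[of i j] N[OF that(1)] N[OF that(2)] by linarith
      then show ?thesis using e by (simp add: power_less_imp_less_base)
    qed
    then show "\<exists>M. \<forall>m\<ge>M. \<forall>n\<ge>M. dist (s m) (s n) < e" by blast
  qed
  then obtain p where p: "s \<longlonglongrightarrow> p" using Cauchy_convergent convergent_def by blast
  have "p \<in> S" using closed_sequentially[OF assms(1)] s(1) p by blast
  moreover have "norm p = d" using LIMSEQ_unique[OF tendsto_norm[OF p] lim] .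
  ultimately show ?thesis using that dle by metis
qed

text \<open>Plays the role of weak compactness of bounded closed convex sets. The points of least
  norm in the sets \<open>S n\<close> have increasing bounded norms, and the parallelogram law turns
  convergence of the norms into the Cauchy property of the points.\<close>

lemma nested_closed_convex_Inter:
  fixes S :: "nat \<Rightarrow> 'h::{real_inner,complete_space} set"
  assumes cl: "\<And>n. closed (S n)" and cv: "\<And>n. convex (S n)" and ne: "\<And>n. S n \<noteq> {}"
    and dec: "\<And>n. S (Suc n) \<subseteq> S n" and bd: "bounded (S 0)"
  obtains p where "\<And>n. p \<in> S n"
proof -
  have "\<exists>p. p \<in> S n \<and> (\<forall>s\<in>S n. norm p \<le> norm s)" for n
    using closed_convex_min_norm[OF cl cv ne] by metis
  then obtain p where p: "\<And>n. p n \<in> S n" "\<And>n s. s \<in> S n \<Longrightarrow> norm (p n) \<le> norm s" by metis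
  have anti: "S n \<subseteq> S k" if "k \<le> n" for k n using lift_Suc_antimono_le[of S, OF dec that] .
  obtain B where B: "\<And>x. x \<in> S 0 \<Longrightarrow> norm x \<le> B" using bd bounded_iff by blast
  have le: "norm (p k) \<le> norm (p n)" if "k \<le> n" for k n using p anti[OF that] by blast
  have mid: "(dist (p n) (p k))\<^sup>2 \<le> 2 * (norm (p n))\<^sup>2 - 2 * (norm (p k))\<^sup>2" if "k \<le> n" for k n
  proof -
    have "(1/2) *\<^sub>R p n + (1/2) *\<^sub>R p k \<in> S k"
      using cv[of k] p(1) anti[OF that] by (fastforce simp: convex_def)
    then have "norm (p k) \<le> norm ((1/2) *\<^sub>R (p n + p k))" using p(2) by (simp add: scaleR_add_right)
    then have "2 * norm (p k) \<le> norm (p n + p k)" by simp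
    then have "(2 * norm (p k))\<^sup>2 \<le> (norm (p n + p k))\<^sup>2" by (intro power_mono) auto
    then show ?thesis
      by (simp add: dist_norm power2_norm_eq_inner inner_add inner_diff inner_commute algebra_simps)
  qed
  have "incseq (\<lambda>n. (norm (p n))\<^sup>2)" by (auto simp: incseq_def intro!: power_mono le)
  moreover have "(norm (p n))\<^sup>2 \<le> B\<^sup>2" for n
    using B[of "p n"] anti[of 0 n] p(1)[of n] by (intro power_mono) auto
  ultimately have "convergent (\<lambda>n. (norm (p n))\<^sup>2)" 
    by (metis incseq_convergent convergent_def)
  then have C: "Cauchy (\<lambda>n. (norm (p n))\<^sup>2)" by (rule convergent_Cauchy)
  have "Cauchy p"
  proof (rule metric_CauchyI)
    fix e :: real assume e: "e > 0"
    obtain N where N: "\<And>m n. m \<ge> N \<Longrightarrow> n \<ge> N \<Longrightarrow> dist ((norm (p m))\<^sup>2) ((norm (p n))\<^sup>2) < e\<^sup>2 / 2"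
      using metric_CauchyD[OF C, of "e\<^sup>2 / 2"] e by auto
    have *: "dist (p i) (p j) < e" if "i \<ge> N" "j \<ge> N" "j \<le> i" for i j
    proof -
      have "(dist (p i) (p j))\<^sup>2 < e\<^sup>2" using mid[OF that(3)] N[OF that(1,2)] unfolding dist_real_def by linarith
      then show ?thesis using e by (simp add: power_less_imp_less_base)
    qed
    have "dist (p i) (p j) < e" if "i \<ge> N" "j \<ge> N" for i j
      using *[OF that] *[OF that(2,1)] by (cases "j \<le> i") (auto simp: dist_commute)
    then show "\<exists>M. \<forall>m\<ge>M. \<forall>n\<ge>M. dist (p m) (p n) < e" by blast
  qed
  then obtain q where q: "p \<longlonglongrightarrow> q" using Cauchy_convergent convergent_def by blast
  have "q \<in> S n" for n
  proof (rule closed_sequentially[OF cl])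
    show "(\<lambda>i. p (i + n)) \<longlonglongrightarrow> q" using q by (rule LIMSEQ_ignore_initial_segment)
    show "\<And>i. p (i + n) \<in> S n" using p(1) anti by (meson le_add2 subsetD)
  qed
  then show ?thesis using that by blast
qed

lemma closed_subspace_projection:
  fixes S :: "'h::{real_inner,complete_space} set"
  assumes "closed S" "subspace S"
  obtains p where "p \<in> S" "\<And>s. s \<in> S \<Longrightarrow> (x - p) \<bullet> s = 0"
proof -
  let ?S = "(\<lambda>s. s - x) ` S"
  have "closed ?S" using closed_translation_subtract[OF assms(1)] .
  moreover have "convex ?S" using convex_translation_subtract subspace_imp_convex[OF assms(2)] by blast
  moreover have "?S \<noteq> {}" using subspace_0[OF assms(2)] by blast
  ultimately obtain q where q: "q \<in> ?S" "\<And>s. s \<in> ?S \<Longrightarrow> norm q \<le> norm s"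
    using closed_convex_min_norm by blast
  then obtain p where p: "p \<in> S" "q = p - x" by blast
  have "(x - p) \<bullet> s = 0" if s: "s \<in> S" for s
  proof (rule ccontr)
    assume n: "(x - p) \<bullet> s \<noteq> 0"
    then have s0: "s \<bullet> s > 0" by (metis inner_gt_zero_iff inner_zero_right)
    \<comment> \<open>The minimiser of the quadratic polynomial
      \<open>norm (p + c *\<^sub>R s - x)\<close> squared in \<open>c\<close>.\<close>
    define c where "c = (x - p) \<bullet> s / (s \<bullet> s)"
    have "p + c *\<^sub>R s \<in> S" using assms(2) p(1) s by (simp add: subspace_add subspace_scale)
    then have "norm (p - x) \<le> norm (p + c *\<^sub>R s - x)" using q(2) p(2) by blast
    then have "(p - x) \<bullet> (p - x) \<le> (p + c *\<^sub>R s - x) \<bullet> (p + c *\<^sub>R s - x)"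
      by (simp add: norm_eq_sqrt_inner)
    also have "\<dots> = (p - x) \<bullet> (p - x) - 2 * c * ((x - p) \<bullet> s) + c\<^sup>2 * (s \<bullet> s)"
      by (simp add: inner_add inner_diff inner_commute algebra_simps power2_eq_square)
    also have "c\<^sup>2 * (s \<bullet> s) = c * ((x - p) \<bullet> s)" using s0 by (simp add: c_def power2_eq_square)
    finally have "c * ((x - p) \<bullet> s) \<le> 0" by simp
    moreover have "c * ((x - p) \<bullet> s) > 0" using s0 n unfolding c_def
      by (metis divide_pos_pos linorder_neqE_linordered_idom mult_neg_neg mult_pos_pos not_real_square_gt_zero times_divide_eq_left)
    ultimately show False by simp
  qed
  then show ?thesis using that p by blast
qed

lemma subspace_closure:
  fixes S :: "'h::real_normed_vector set"
  assumes "subspace S"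
  shows "subspace (closure S)"
  unfolding subspace_def
proof (intro conjI ballI allI)
  show "0 \<in> closure S" using subspace_0[OF assms] closure_subset by blast
  fix x y assume x: "x \<in> closure S" 
  then obtain f where f: "\<And>n. f n \<in> S" "f \<longlonglongrightarrow> x" unfolding closure_sequential by blast
  { assume "y \<in> closure S"
    then obtain g where g: "\<And>n. g n \<in> S" "g \<longlonglongrightarrow> y" unfolding closure_sequential by blast
    have "\<forall>n. f n + g n \<in> S" using f g assms by (simp add: subspace_add)
    then show "x + y \<in> closure S" unfolding closure_sequential 
      using tendsto_add[OF f(2) g(2)] by (intro exI[of _ "\<lambda>n. f n + g n"]) auto }
  fix c :: real
  have "\<forall>n. c *\<^sub>R f n \<in> S" using f assms by (simp add: subspace_scale)
  then show "c *\<^sub>R x \<in> closure S" unfolding closure_sequential 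
    using tendsto_scaleR[OF tendsto_const f(2), of c] by (intro exI[of _ "\<lambda>n. c *\<^sub>R f n"]) auto
qed

lemma dense_subspaceI:
  fixes S :: "'h::{real_inner,complete_space} set"
  assumes "subspace S" and orth: "\<And>x. (\<And>s. s \<in> S \<Longrightarrow> x \<bullet> s = 0) \<Longrightarrow> x = 0"
  shows "closure S = UNIV"
proof -
  have "x \<in> closure S" for x
  proof -
    obtain p where p: "p \<in> closure S" "\<And>s. s \<in> closure S \<Longrightarrow> (x - p) \<bullet> s = 0"
      using closed_subspace_projection[of "closure S" x] assms(1) subspace_closure by blast
    have "x - p = 0" using orth p(2) closure_subset by blast
    then show ?thesis using p(1) by simp
  qed
  then show ?thesis by blast
qed

section \<open>The Banach algebra of bounded operators\<close>

text \<open>A copy of the bounded operators on one space whose multiplication is composition, so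
  that the exponential series of Banach algebras and its rules apply to operators.\<close>

typedef (overloaded) ('a::real_normed_vector) endo = "UNIV :: ('a \<Rightarrow>\<^sub>L 'a) set" ..

setup_lifting type_definition_endo

instantiation endo :: (real_normed_vector) "{zero,plus,minus,uminus,scaleR,norm}"
begin
lift_definition zero_endo :: "'a endo" is 0 .
lift_definition plus_endo :: "'a endo \<Rightarrow> 'a endo \<Rightarrow> 'a endo" is "(+)" .
lift_definition minus_endo :: "'a endo \<Rightarrow> 'a endo \<Rightarrow> 'a endo" is "(-)" .
lift_definition uminus_endo :: "'a endo \<Rightarrow> 'a endo" is uminus .
lift_definition scaleR_endo :: "real \<Rightarrow> 'a endo \<Rightarrow> 'a endo" is scaleR .
lift_definition norm_endo :: "'a endo \<Rightarrow> real" is norm .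
instance ..
end

instantiation endo :: (real_normed_vector) real_normed_vector
begin
definition dist_endo :: "'a endo \<Rightarrow> 'a endo \<Rightarrow> real" where "dist_endo x y = norm (x - y)"
definition sgn_endo :: "'a endo \<Rightarrow> 'a endo" where "sgn_endo x = inverse (norm x) *\<^sub>R x"
definition uniformity_endo :: "('a endo \<times> 'a endo) filter"
  where "uniformity_endo = (INF e\<in>{0<..}. principal {(x, y). dist x y < e})"
definition open_endo :: "'a endo set \<Rightarrow> bool"
  where "open_endo U = (\<forall>x\<in>U. \<forall>\<^sub>F (x', y) in uniformity. x' = x \<longrightarrow> y \<in> U)"
instance
proof
  fix a b c :: "'a endo" and r s :: real
  show "a + b + c = a + (b + c)" by transfer (rule add.assoc)
  show "a + b = b + a" by transfer (rule add.commute)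
  show "0 + a = a" by transfer simp
  show "- a + a = 0" by transfer simp
  show "a - b = a + - b" by transfer simp
  show "r *\<^sub>R (a + b) = r *\<^sub>R a + r *\<^sub>R b" by transfer (rule scaleR_add_right)
  show "(r + s) *\<^sub>R a = r *\<^sub>R a + s *\<^sub>R a" by transfer (rule scaleR_add_left)
  show "r *\<^sub>R s *\<^sub>R a = (r * s) *\<^sub>R a" by transfer simp
  show "1 *\<^sub>R a = a" by transfer simp
  show "dist a b = norm (a - b)" by (rule dist_endo_def)
  show "sgn a = a /\<^sub>R norm a" by (simp add: sgn_endo_def)
  show "uniformity = (INF e\<in>{0<..}. principal {(x, y :: 'a endo). dist x y < e})"
    by (rule uniformity_endo_def)
  show "open U = (\<forall>x\<in>U. \<forall>\<^sub>F (x', y) in uniformity. x' = x \<longrightarrow> y \<in> U)" for U :: "'a endo set"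
    by (rule open_endo_def)
  show "(norm a = 0) = (a = 0)" by transfer simp
  show "norm (a + b) \<le> norm a + norm b" by transfer (rule norm_triangle_ineq)
  show "norm (r *\<^sub>R a) = \<bar>r\<bar> * norm a" by transfer simp
qed
end

instance endo :: (banach) banach
proof
  fix X :: "nat \<Rightarrow> 'a endo" assume "Cauchy X"
  then have "Cauchy (\<lambda>n. Rep_endo (X n))"
    unfolding Cauchy_def dist_norm minus_endo.rep_eq[symmetric] norm_endo.rep_eq[symmetric] .
  then obtain L where "(\<lambda>n. Rep_endo (X n)) \<longlonglongrightarrow> L" using Cauchy_convergent convergent_def by blast
  then have "X \<longlonglongrightarrow> Abs_endo L"
    unfolding lim_sequentially dist_norm minus_endo.rep_eq norm_endo.rep_eq
    by (simp add: Abs_endo_inverse)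
  then show "convergent X" by (rule convergentI)
qed

text \<open>A unital normed algebra requires \<open>norm 1 = 1\<close>, which fails on the zero
  space; \<open>perfect_space\<close> excludes that case.\<close>

instantiation endo :: ("{real_normed_vector, perfect_space}") real_normed_algebra_1
begin
lift_definition times_endo :: "'a endo \<Rightarrow> 'a endo \<Rightarrow> 'a endo" is "(o\<^sub>L)" .
lift_definition one_endo :: "'a endo" is id_blinfun .
instance
proof
  fix a b c :: "'a endo" and r :: real
  show "a * b * c = a * (b * c)" by transfer (rule blinfun_eqI, simp)
  show "(a + b) * c = a * c + b * c" 
    by transfer (rule bounded_bilinear.add_left[OF bounded_bilinear_blinfun_compose])
  show "a * (b + c) = a * b + a * c" 
    by transfer (rule bounded_bilinear.add_right[OF bounded_bilinear_blinfun_compose])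
  show "(r *\<^sub>R a) * b = r *\<^sub>R (a * b)"
    by transfer (rule bounded_bilinear.scaleR_left[OF bounded_bilinear_blinfun_compose])
  show "a * (r *\<^sub>R b) = r *\<^sub>R (a * b)"
    by transfer (rule bounded_bilinear.scaleR_right[OF bounded_bilinear_blinfun_compose])
  show "1 * a = a" by transfer (rule blinfun_eqI, simp)
  show "a * 1 = a" by transfer (rule blinfun_eqI, simp)
  show "norm (a * b) \<le> norm a * norm b" by transfer (rule norm_blinfun_compose)
  show "norm (1::'a endo) = 1" by transfer simp
  show "(0::'a endo) \<noteq> 1"
  proof
    assume "(0::'a endo) = 1"
    then have "norm (0::'a endo) = norm (1::'a endo)" by simp
    moreover have "norm (1::'a endo) = 1" by transfer simp
    moreover have "norm (0::'a endo) = 0" by transfer simp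
    ultimately show False by simp
  qed
qed
end

lift_definition app :: "'a::real_normed_vector endo \<Rightarrow> 'a \<Rightarrow> 'a" is blinfun_apply .

lemma app_times [simp]: "app (a * b) x = app a (app b x)"
  by transfer simp

lemma app_one [simp]: "app 1 x = x"
  by transfer simp

lemma norm_app_le: "norm (app a x) \<le> norm a * norm x"
  by transfer (rule norm_blinfun)

lemma bounded_bilinear_app: "bounded_bilinear app"
proof
  show "\<exists>K. \<forall>a b. norm (app a b) \<le> norm a * norm b * K"
    by (intro exI[of _ 1]) (simp add: norm_app_le)
qed (transfer, simp add: blinfun.bilinear_simps)+

interpretation app: bounded_bilinear app by (rule bounded_bilinear_app)

lemma exists_endo:
  assumes "bounded_linear f"
  obtains a where "app a = f"
proof
  show "app (Abs_endo (Blinfun f)) = f"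
    using assms by (simp add: app_def Abs_endo_inverse bounded_linear_Blinfun_apply)
qed

lemma norm_endo_le:
  assumes "\<And>x. norm (app a x) \<le> c * norm x" "0 \<le> c"
  shows "norm a \<le> c"
  using assms by transfer (rule norm_blinfun_bound)

lemma app_eqI: "(\<And>x. app a x = app b x) \<Longrightarrow> a = b"
  by transfer (rule blinfun_eqI)

section \<open>Semigroups generated by dissipative operators\<close>

text \<open>Approximating \<open>x\<close> by \<open>y\<close> in \<open>D\<close> costs at most
  \<open>c * norm (x - y)\<close>, uniformly in the index. This reduces strong convergence of
  resolvents, approximating semigroups and the semigroup itself to vectors in the domain.\<close>

lemma tendsto_zero_dense:
  fixes T :: "'i \<Rightarrow> 'h::real_normed_vector \<Rightarrow> 'k::real_normed_vector"
  assumes lip: "\<forall>\<^sub>F i in F. \<forall>x y. norm (T i x - T i y) \<le> c * norm (x - y)"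
    and dense: "closure D = UNIV"
    and lim: "\<And>x. x \<in> D \<Longrightarrow> ((\<lambda>i. T i x) \<longlongrightarrow> 0) F"
  shows "((\<lambda>i. T i x) \<longlongrightarrow> 0) F"
proof (rule tendstoI)
  fix e :: real assume e: "e > 0"
  \<comment> \<open>The summand 1 keeps the denominator positive whatever the value of
    \<open>c\<close>.\<close>
  define d where "d = e / (2 * (\<bar>c\<bar> + 1))"
  have d: "d > 0" using e by (simp add: d_def)
  have "x \<in> closure D" using dense by simp
  then obtain y where y: "y \<in> D" "dist y x < d" using d closure_approachable by blast
  have "\<forall>\<^sub>F i in F. dist (T i y) 0 < e / 2" using tendstoD[OF lim[OF y(1)], of "e / 2"] e by simp
  with lip show "\<forall>\<^sub>F i in F. dist (T i x) 0 < e"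
  proof eventually_elim
    case (elim i)
    have "norm (T i x - T i y) \<le> c * norm (x - y)" using elim(1) by blast
    also have "\<dots> \<le> (\<bar>c\<bar> + 1) * d"
      using y(2) by (intro mult_mono) (auto simp: dist_norm norm_minus_commute)
    also have "\<dots> = e / 2" by (simp add: d_def field_simps)
    finally have "norm (T i x - T i y) \<le> e / 2" .
    then show ?case using elim(2) norm_triangle_sub[of "T i x" "T i y"] by simp
  qed
qed

lemma norm_increment_le:
  fixes f :: "real \<Rightarrow> 'a::real_normed_vector"
  assumes "0 \<le> t"
    and der: "\<And>s. (f has_vector_derivative f' s) (at s)"
    and bd: "\<And>s. 0 \<le> s \<Longrightarrow> s \<le> t \<Longrightarrow> norm (f' s) \<le> K"
  shows "norm (f t - f 0) \<le> K * t"
proof (cases "t = 0")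
  case False
  have "norm (f t - f 0) \<le> K * t - K * 0"
  proof (rule differentiable_bound_general[where f'=f' and \<phi>'="\<lambda>_. K"])
    show "0 < t" using False assms(1) by simp
    show "continuous_on {0..t} f" using der
      by (meson continuous_at_imp_continuous_on has_vector_derivative_continuous)
    show "((\<lambda>s. K * s) has_vector_derivative K) (at x)" for x
      unfolding has_real_derivative_iff_has_vector_derivative[symmetric]
      by (auto intro!: derivative_eq_intros)
  qed (auto intro!: der bd continuous_intros)
  then show ?thesis by simp
qed simp

lemma commute_exp:
  fixes x y :: "'a::{real_normed_algebra_1,banach}"
  assumes "x * y = y * x"
  shows "exp x * y = y * exp x"
proof -
  have s: "(\<lambda>n. x ^ n /\<^sub>R fact n) sums exp x" 
    unfolding exp_def by (intro summable_sums summable_exp_generic)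
  have "(\<lambda>n. (x ^ n /\<^sub>R fact n) * y) sums (exp x * y)" by (rule sums_mult2[OF s])
  moreover have "(\<lambda>n. (x ^ n /\<^sub>R fact n) * y) = (\<lambda>n. y * (x ^ n /\<^sub>R fact n))"
    by (simp add: power_commuting_commutes[OF assms])
  ultimately show ?thesis using sums_unique2[OF _ sums_mult[OF s, of y]] by simp
qed

text \<open>The hypotheses of the Lumer-Phillips theorem in a real Hilbert space. \<open>A\<close>
  is a linear relation; that it is the graph of an operator will follow from its being the generator
  of a semigroup.\<close>

locale m_dissipative =
  fixes A :: "('h::{real_inner,banach,perfect_space} \<times> 'h) set"
  assumes sub: "subspace A"
    and dissipative: "(w, z) \<in> A \<Longrightarrow> z \<bullet> w \<le> 0"
    and surj: "h > 0 \<Longrightarrow> \<exists>w z. (w, z) \<in> A \<and> w - h *\<^sub>R z = f"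
    and dense: "closure (Domain A) = UNIV"
begin

lemma A_add: "(w, z) \<in> A \<Longrightarrow> (w', z') \<in> A \<Longrightarrow> (w + w', z + z') \<in> A"
  using subspace_add[OF sub, of "(w, z)" "(w', z')"] by simp

lemma A_scale: "(w, z) \<in> A \<Longrightarrow> (c *\<^sub>R w, c *\<^sub>R z) \<in> A"
  using subspace_scale[OF sub, of "(w, z)" c] by simp

lemma A_diff: "(w, z) \<in> A \<Longrightarrow> (w', z') \<in> A \<Longrightarrow> (w - w', z - z') \<in> A"
  using subspace_diff[OF sub, of "(w, z)" "(w', z')"] by simp

lemma norm_le_resolvent:
  assumes "(w, z) \<in> A" "h > 0"
  shows "norm w \<le> norm (w - h *\<^sub>R z)"
proof -
  have "(norm (w - h *\<^sub>R z))\<^sup>2 = (norm w)\<^sup>2 - 2 * h * (z \<bullet> w) + h\<^sup>2 * (norm z)\<^sup>2"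
    unfolding power2_norm_eq_inner
    by (simp add: inner_diff_left inner_diff_right inner_commute power2_eq_square algebra_simps)
  moreover have "h * (z \<bullet> w) \<le> 0" using dissipative[OF assms(1)] assms(2) by (simp add: mult_le_0_iff)
  moreover have "0 \<le> h\<^sup>2 * (norm z)\<^sup>2" by simp
  ultimately have "(norm w)\<^sup>2 \<le> (norm (w - h *\<^sub>R z))\<^sup>2" by linarith
  then show ?thesis by (rule power2_le_imp_le) simp
qed

section \<open>Resolvents of an m-dissipative operator\<close>

text \<open>The resolvent, that is the inverse of \<open>I - h A\<close>. The choice is forced,
  because dissipativity makes \<open>I - h A\<close> injective (\<open>J_eq\<close>).\<close>

definition J :: "real \<Rightarrow> 'h \<Rightarrow> 'h" where
  "J h f = (SOME w. \<exists>z. (w, z) \<in> A \<and> w - h *\<^sub>R z = f)"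

lemma J_in: 
  assumes "h > 0"
  shows "(J h f, (J h f - f) /\<^sub>R h) \<in> A"
proof -
  have "\<exists>z. (J h f, z) \<in> A \<and> J h f - h *\<^sub>R z = f"
    unfolding J_def by (rule someI_ex[OF surj[OF assms]])
  then obtain z where "(J h f, z) \<in> A" "J h f - h *\<^sub>R z = f" by blast
  moreover from this(2) have "z = (J h f - f) /\<^sub>R h" using assms
    by (metis add_diff_cancel_left' diff_add_cancel order_less_irrefl scaleR_scaleR left_inverse scaleR_one)
  ultimately show ?thesis by simp
qed

lemma J_eq:
  assumes "(w, z) \<in> A" "h > 0" "w - h *\<^sub>R z = f"
  shows "J h f = w"
proof -
  have "(J h f - w, (J h f - f) /\<^sub>R h - z) \<in> A" using A_diff[OF J_in[OF assms(2)] assms(1)] .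
  from norm_le_resolvent[OF this assms(2)]
  have "norm (J h f - w) \<le> norm (J h f - w - h *\<^sub>R ((J h f - f) /\<^sub>R h - z))" .
  also have "J h f - w - h *\<^sub>R ((J h f - f) /\<^sub>R h - z) = 0" 
    using assms by (auto simp: scaleR_diff_right algebra_simps)
  finally show ?thesis by simp
qed

lemma J_bounded_linear: 
  assumes h: "h > 0"
  shows "bounded_linear (J h)"
proof (rule bounded_linear_intro)
  fix x y and r :: real
  note i = J_in[OF h]
  show "J h (x + y) = J h x + J h y"
    by (rule J_eq[OF A_add[OF i[of x] i[of y]] h]) (use h in \<open>simp add: algebra_simps\<close>)
  show "J h (r *\<^sub>R x) = r *\<^sub>R J h x"
    by (rule J_eq[OF A_scale[OF i[of x]] h]) (use h in \<open>simp add: algebra_simps mult.left_commute[of h r]\<close>)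
  show "norm (J h x) \<le> norm x * 1"
    using norm_le_resolvent[OF i[of x] h] h by (simp add: algebra_simps)
qed

lemma norm_J_le: "h > 0 \<Longrightarrow> norm (J h x) \<le> norm x"
  using norm_le_resolvent[OF J_in[of h x], of h] by (simp add: algebra_simps)

lemma J_commute:
  assumes h: "h > 0" and R: "bounded_linear R" and RA: "\<And>w z. (w, z) \<in> A \<Longrightarrow> (R w, R z) \<in> A"
  shows "J h (R f) = R (J h f)"
proof -
  interpret R: bounded_linear R by fact
  show ?thesis
    by (rule J_eq[OF RA[OF J_in[OF h, of f]] h]) (use h in \<open>simp add: R.scaleR R.diff\<close>)
qed

lemma J_eq_add:
  assumes "(w, z) \<in> A" "h > 0"
  shows "J h w = w + h *\<^sub>R J h z"
proof -
  interpret J: bounded_linear "J h" using J_bounded_linear[OF assms(2)] .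
  have "w = J h (w - h *\<^sub>R z)" using J_eq[OF assms refl] by simp
  then show ?thesis by (simp add: J.diff J.scaleR algebra_simps)
qed

lemma J_invariant:
  assumes "(w, z) \<in> A" "h > 0"
  shows "(J h w, J h z) \<in> A"
  using J_in[OF assms(2), of w] J_eq_add[OF assms] assms(2) by simp

lemma J_swap: 
  assumes "h > 0" "k > 0"
  shows "J h (J k f) = J k (J h f)"
  using J_commute[OF assms(1) J_bounded_linear[OF assms(2)]] J_invariant assms(2) by blast

text \<open>For \<open>(x, z) \<in> A\<close> the difference \<open>J h x - x\<close> equals
  \<open>h *\<^sub>R J h z\<close>, which is at most \<open>h * norm z\<close>; the rest is density
  and the contraction property.\<close>

lemma J_tendsto:
  assumes "\<And>n. h n > 0" "h \<longlonglongrightarrow> 0"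
  shows "(\<lambda>n. J (h n) f) \<longlonglongrightarrow> f"
proof -
  have "(\<lambda>n. J (h n) f - f) \<longlonglongrightarrow> 0"
  proof (rule tendsto_zero_dense[where c=2, OF _ dense])
    show "\<forall>\<^sub>F n in sequentially. \<forall>x y. norm (J (h n) x - x - (J (h n) y - y)) \<le> 2 * norm (x - y)"
    proof (intro always_eventually allI)
      fix n x y
      interpret J: bounded_linear "J (h n)" using J_bounded_linear assms(1) .
      have "J (h n) x - x - (J (h n) y - y) = J (h n) (x - y) - (x - y)" by (simp add: J.diff)
      moreover have "norm (J (h n) (x - y) - (x - y)) \<le> 2 * norm (x - y)"
        using norm_triangle_ineq4[of "J (h n) (x - y)" "x - y"] norm_J_le[OF assms(1)[of n], of "x - y"] by simp
      ultimately show "norm (J (h n) x - x - (J (h n) y - y)) \<le> 2 * norm (x - y)" by (simp only:)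
    qed
    fix x assume "x \<in> Domain A"
    then obtain z where z: "(x, z) \<in> A" by blast
    have "(\<lambda>n. h n * norm z) \<longlonglongrightarrow> 0" by (rule tendsto_mult_left_zero[OF assms(2)])
    moreover have "norm (J (h n) x - x) \<le> h n * norm z" for n
    proof -
      have "J (h n) x - x = h n *\<^sub>R J (h n) z" using J_eq_add[OF z assms(1)[of n]] by simp
      then show ?thesis using norm_J_le[OF assms(1)[of n], of z] assms(1)[of n] by simp
    qed
    then have "\<forall>\<^sub>F n in sequentially. norm (J (h n) x - x) \<le> h n * norm z" by (simp only: eventually_True)
    ultimately show "(\<lambda>n. J (h n) x - x) \<longlonglongrightarrow> 0"
      by (rule Lim_null_comparison[rotated])
  qed
  then show ?thesis by (rule LIM_zero_cancel)
qed

section \<open>Yosida approximations\<close>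

definition P :: "real \<Rightarrow> 'h endo" where "P h = (SOME a. app a = J h)"

lemma app_P: "h > 0 \<Longrightarrow> app (P h) = J h"
  unfolding P_def by (rule someI_ex) (metis exists_endo J_bounded_linear)

lemma norm_P: "h > 0 \<Longrightarrow> norm (P h) \<le> 1"
  by (rule norm_endo_le) (simp_all add: app_P norm_J_le)

lemma P_swap: "h > 0 \<Longrightarrow> k > 0 \<Longrightarrow> P h * P k = P k * P h"
  by (rule app_eqI) (simp add: app_P J_swap)

text \<open>The bounded Yosida approximation: on the domain \<open>B h\<close> is \<open>A\<close>
  followed by the resolvent (\<open>app_B_domain\<close>), so it tends to \<open>A\<close> there as
  \<open>h\<close> tends to 0.\<close>

definition B :: "real \<Rightarrow> 'h endo" where "B h = (P h - 1) /\<^sub>R h"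

definition U :: "real \<Rightarrow> real \<Rightarrow> 'h endo" where "U h t = exp (t *\<^sub>R B h)"

lemma B_swap: "h > 0 \<Longrightarrow> k > 0 \<Longrightarrow> B h * B k = B k * B h"
  using P_swap[of h k] by (simp add: B_def algebra_simps)

lemma app_B: "h > 0 \<Longrightarrow> app (B h) f = (J h f - f) /\<^sub>R h"
  by (simp add: B_def app.scaleR_left app.diff_left app_P)

lemma app_B_domain: "(w, z) \<in> A \<Longrightarrow> h > 0 \<Longrightarrow> app (B h) w = J h z"
  by (simp add: app_B J_eq_add)

text \<open>The multiple of the identity commutes with everything and splits off as a scalar factor.
  What remains is a power series in \<open>P h\<close> with nonnegative coefficients, which yields
  both contractivity and invariance of convex sets.\<close>

lemma U_eq: "h > 0 \<Longrightarrow> U h t = exp (- (t / h)) *\<^sub>R exp ((t / h) *\<^sub>R P h)"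
proof -
  assume h: "h > 0"
  have "t *\<^sub>R B h = (t / h) *\<^sub>R P h + of_real (- (t / h))"
    using h by (simp add: B_def of_real_def scaleR_diff_right divide_inverse mult.commute)
  moreover have "(t / h) *\<^sub>R P h * of_real (- (t / h)) = of_real (- (t / h)) * ((t / h) *\<^sub>R P h)"
    by (simp add: of_real_def)
  ultimately have "U h t = exp ((t / h) *\<^sub>R P h) * exp (of_real (- (t / h)))"
    unfolding U_def by (metis exp_add_commuting)
  then show ?thesis by (simp only: exp_of_real) (simp add: of_real_def)
qed

lemma norm_U:
  assumes h: "h > 0" and t: "t \<ge> 0"
  shows "norm (U h t) \<le> 1"
proof -
  have "norm (exp ((t / h) *\<^sub>R P h)) \<le> exp (norm ((t / h) *\<^sub>R P h))" by (rule norm_exp)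
  also have "\<dots> \<le> exp (t / h)" 
    using mult_left_mono[OF norm_P[OF h], of "t / h"] h t by simp
  finally show ?thesis using h by (simp add: U_eq exp_minus field_simps)
qed

lemma norm_app_U: "h > 0 \<Longrightarrow> t \<ge> 0 \<Longrightarrow> norm (app (U h t) x) \<le> norm x"
  using norm_app_le[of "U h t" x] norm_U[of h t] mult_right_mono[of "norm (U h t)" 1 "norm x"] by simp

lemma U_zero: "U h 0 = 1"
  by (simp add: U_def)

lemma U_add: "U h (s + t) = U h s * U h t"
  by (simp add: U_def scaleR_add_left exp_add_commuting)

lemma U_deriv: "((\<lambda>s. app (U h s) f) has_vector_derivative app (U h s) (app (B h) f)) (at s)"
proof -
  have "(U h has_vector_derivative U h s * B h) (at s)"
    unfolding U_def by (rule exp_scaleR_has_vector_derivative_right)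
  from app.has_vector_derivative[OF this has_vector_derivative_const[of f]] 
  show ?thesis by (simp add: app.zero_right)
qed

text \<open>The curve \<open>U h s (U k (t - s) f)\<close> joins \<open>U k t f\<close> to
  \<open>U h t f\<close>. Since all operators involved commute, its derivative is a contraction
  applied to \<open>B h f - B k f\<close>.\<close>

lemma U_diff_le:
  assumes h: "h > 0" and k: "k > 0" and t: "t \<ge> 0"
  shows "norm (app (U h t) f - app (U k t) f) \<le> norm (app (B h) f - app (B k) f) * t"
proof -
  define \<phi> where "\<phi> s = app (U h s) (app (U k (t - s)) f)" for s
  define \<phi>' where "\<phi>' s = app (U h s) (app (U k (t - s)) (app (B h) f - app (B k) f))" for s
  have com: "app (B h) (app (U k s) x) = app (U k s) (app (B h) x)" for s x
  proof -
    have "U k s * B h = B h * U k s" unfolding U_def by (rule commute_exp) (simp add: B_swap h k)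
    then show ?thesis by (metis app_times)
  qed
  have der: "(\<phi> has_vector_derivative \<phi>' s) (at s)" for s
  proof -
    have 1: "(U h has_vector_derivative U h s * B h) (at s)"
      unfolding U_def by (rule exp_scaleR_has_vector_derivative_right)
    have "((\<lambda>s. app (U k (t - s)) f) has_vector_derivative (- 1) *\<^sub>R app (U k (t - s)) (app (B k) f)) (at s)"
      by (rule vector_diff_chain_at[of "\<lambda>s. t - s", unfolded o_def, OF _ U_deriv])
        (auto intro!: derivative_eq_intros simp: has_real_derivative_iff_has_vector_derivative[symmetric])
    from app.has_vector_derivative[OF 1 this]
    show ?thesis unfolding \<phi>_def \<phi>'_def 
      by (simp add: com app.diff_right app.minus_right add.commute)
  qed
  have "norm (\<phi> t - \<phi> 0) \<le> norm (app (B h) f - app (B k) f) * t"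
  proof (rule norm_increment_le[OF t der])
    fix s assume "0 \<le> s" "s \<le> t"
    then show "norm (\<phi>' s) \<le> norm (app (B h) f - app (B k) f)"
      unfolding \<phi>'_def using norm_app_U h k by (meson diff_ge_0_iff_ge order_trans)
  qed
  then show ?thesis by (simp add: \<phi>_def U_zero)
qed

lemma U_minus_id_le:
  assumes h: "h > 0" and t: "t \<ge> 0"
  shows "norm (app (U h t) f - f) \<le> norm (app (B h) f) * t"
proof -
  have "norm (app (U h t) f - app (U h 0) f) \<le> norm (app (B h) f) * t"
    by (rule norm_increment_le[OF t U_deriv]) (simp add: norm_app_U h)
  then show ?thesis by (simp add: U_zero)
qed

text \<open>First order Taylor estimate with a remainder that is uniform in \<open>h\<close> once
  \<open>K\<close> is; this uniformity allows the limit along \<open>\<eta>\<close> in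
  \<open>S_derivative\<close>.\<close>

lemma U_expansion:
  assumes h: "h > 0" and t: "t \<ge> 0" and K: "\<And>s. 0 \<le> s \<Longrightarrow> s \<le> t \<Longrightarrow> norm (app (U h s) (app (B h) f) - app (B h) f) \<le> K"
  shows "norm (app (U h t) f - f - t *\<^sub>R app (B h) f) \<le> K * t"
proof -
  have "norm ((app (U h t) f - t *\<^sub>R app (B h) f) - (app (U h 0) f - 0 *\<^sub>R app (B h) f)) \<le> K * t"
  proof (rule norm_increment_le[OF t _ K])
    show "((\<lambda>s. app (U h s) f - s *\<^sub>R app (B h) f) has_vector_derivative
      app (U h s) (app (B h) f) - app (B h) f) (at s)" for s
      by (auto intro!: derivative_eq_intros U_deriv)
  qed
  then show ?thesis by (simp add: U_zero algebra_simps)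
qed

section \<open>The limit semigroup and its generator\<close>

definition \<eta> :: "nat \<Rightarrow> real" where "\<eta> n = 1 / real (Suc n)"

lemma \<eta>_pos: "\<eta> n > 0" by (simp add: \<eta>_def)

lemma \<eta>_lim: "\<eta> \<longlonglongrightarrow> 0"
  unfolding \<eta>_def using LIMSEQ_Suc[OF lim_1_over_n] by simp

definition S :: "real \<Rightarrow> 'h \<Rightarrow> 'h" where "S t f = lim (\<lambda>n. app (U (\<eta> n) t) f)"

lemma app_B_lim: "(w, z) \<in> A \<Longrightarrow> (\<lambda>n. app (B (\<eta> n)) w) \<longlonglongrightarrow> z"
  by (simp add: app_B_domain \<eta>_pos J_tendsto \<eta>_lim)

text \<open>For \<open>x\<close> in the domain the vectors \<open>B (\<eta> n) x\<close> converge,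
  so \<open>U_diff_le\<close> makes the sequence Cauchy; contractivity and density extend this to
  all vectors.\<close>

lemma S_lim:
  assumes t: "t \<ge> 0"
  shows "(\<lambda>n. app (U (\<eta> n) t) f) \<longlonglongrightarrow> S t f"
proof -
  \<comment> \<open>The Cauchy property is read as convergence to 0 along pairs of indices, so that
    the density lemma applies before any limit is available.\<close>
  let ?T = "\<lambda>(i, j) x. app (U (\<eta> i) t) x - app (U (\<eta> j) t) x"
  have "((\<lambda>i. ?T i f) \<longlongrightarrow> 0) (sequentially \<times>\<^sub>F sequentially)"
  proof (rule tendsto_zero_dense[where c=2, OF _ dense], intro always_eventually allI)
    fix p :: "nat \<times> nat" and x y
    obtain i j where p: "p = (i, j)" by fastforce
    have "?T p x - ?T p y = app (U (\<eta> i) t) (x - y) - app (U (\<eta> j) t) (x - y)"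
      by (simp add: p app.diff_right)
    also have "norm \<dots> \<le> norm (app (U (\<eta> i) t) (x - y)) + norm (app (U (\<eta> j) t) (x - y))" 
      by (rule norm_triangle_ineq4)
    also have "\<dots> \<le> norm (x - y) + norm (x - y)" by (intro add_mono norm_app_U \<eta>_pos t)
    finally show "norm (?T p x - ?T p y) \<le> 2 * norm (x - y)" by simp
  next
    fix x assume "x \<in> Domain A"
    then obtain z where z: "(x, z) \<in> A" by blast
    show "((\<lambda>i. ?T i x) \<longlongrightarrow> 0) (sequentially \<times>\<^sub>F sequentially)"
    proof (rule tendstoI)
      fix e :: real assume e: "e > 0"
      have "Cauchy (\<lambda>n. app (B (\<eta> n)) x)" using app_B_lim[OF z] LIMSEQ_imp_Cauchy by blast
      moreover have "e / (t + 1) > 0" using e t by simp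
      ultimately obtain N where N: "\<And>m n. m \<ge> N \<Longrightarrow> n \<ge> N \<Longrightarrow> dist (app (B (\<eta> m)) x) (app (B (\<eta> n)) x) < e / (t + 1)"
        using metric_CauchyD by metis
      show "\<forall>\<^sub>F i in sequentially \<times>\<^sub>F sequentially. dist (?T i x) 0 < e"
        unfolding eventually_prod_sequentially
      proof (intro exI[of _ N] allI impI)
        fix m n assume mn: "m \<ge> N" "n \<ge> N"
        have "norm (app (U (\<eta> n) t) x - app (U (\<eta> m) t) x) \<le> norm (app (B (\<eta> n)) x - app (B (\<eta> m)) x) * t"
          by (rule U_diff_le[OF \<eta>_pos \<eta>_pos t])
        also have "\<dots> \<le> e / (t + 1) * t" 
          using N[OF mn(2,1)] t by (intro mult_right_mono) (auto simp: dist_norm)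
        also have "\<dots> < e" using e t by (simp add: field_simps)
        finally show "dist (?T (n, m) x) 0 < e" by simp
      qed
    qed
  qed
  then have lim: "\<And>e. e > 0 \<Longrightarrow> \<forall>\<^sub>F i in sequentially \<times>\<^sub>F sequentially. dist (?T i f) 0 < e"
    by (simp add: tendsto_iff)
  have "Cauchy (\<lambda>n. app (U (\<eta> n) t) f)"
  proof (rule metric_CauchyI)
    fix e :: real assume "e > 0"
    from lim[OF this] obtain N where "\<And>m n. m \<ge> N \<Longrightarrow> n \<ge> N \<Longrightarrow> dist (?T (n, m) f) 0 < e"
      unfolding eventually_prod_sequentially by blast
    then show "\<exists>M. \<forall>m\<ge>M. \<forall>n\<ge>M. dist (app (U (\<eta> m) t) f) (app (U (\<eta> n) t) f) < e"
      by (intro exI[of _ N]) (simp add: dist_norm)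
  qed
  then show ?thesis unfolding S_def using Cauchy_convergent convergent_LIMSEQ_iff by blast
qed

lemma norm_S_le: "t \<ge> 0 \<Longrightarrow> norm (S t f) \<le> norm f"
  by (rule LIMSEQ_le_const2[OF tendsto_norm[OF S_lim]]) (auto simp: norm_app_U \<eta>_pos)

lemma S_linear: 
  assumes t: "t \<ge> 0"
  shows "bounded_linear (S t)"
proof (rule bounded_linear_intro)
  fix x y and r :: real
  have "(\<lambda>n. app (U (\<eta> n) t) (x + y)) \<longlonglongrightarrow> S t x + S t y"
    unfolding app.add_right by (rule tendsto_add[OF S_lim[OF t] S_lim[OF t]])
  then show "S t (x + y) = S t x + S t y" by (rule LIMSEQ_unique[OF S_lim[OF t]])
  have "(\<lambda>n. app (U (\<eta> n) t) (r *\<^sub>R x)) \<longlonglongrightarrow> r *\<^sub>R S t x"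
    unfolding app.scaleR_right by (rule tendsto_scaleR[OF tendsto_const S_lim[OF t]])
  then show "S t (r *\<^sub>R x) = r *\<^sub>R S t x" by (rule LIMSEQ_unique[OF S_lim[OF t]])
  show "norm (S t x) \<le> norm x * 1" using norm_S_le[OF t] by simp
qed

lemma S_zero: "S 0 f = f"
  by (rule LIMSEQ_unique[OF S_lim]) (simp_all add: U_zero)

lemma S_add:
  assumes s: "s \<ge> 0" and t: "t \<ge> 0"
  shows "S (s + t) f = S s (S t f)"
proof (rule LIMSEQ_unique)
  show "(\<lambda>n. app (U (\<eta> n) (s + t)) f) \<longlonglongrightarrow> S (s + t) f" by (rule S_lim) (use s t in simp)
  \<comment> \<open>The outer operator varies with \<open>n\<close> as well, but being a contraction
    it does not enlarge the error made by replacing \<open>U (\<eta> n) t f\<close> with its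
    limit.\<close>
  have "(\<lambda>n. app (U (\<eta> n) s) (app (U (\<eta> n) t) f) - app (U (\<eta> n) s) (S t f)) \<longlonglongrightarrow> 0"
  proof (rule Lim_null_comparison)
    show "(\<lambda>n. norm (app (U (\<eta> n) t) f - S t f)) \<longlonglongrightarrow> 0"
      using LIM_zero[OF S_lim[OF t, of f]] by (rule tendsto_norm_zero)
  qed (simp add: app.diff_right[symmetric] norm_app_U \<eta>_pos s)
  from tendsto_add[OF this S_lim[OF s, of "S t f"]]
  show "(\<lambda>n. app (U (\<eta> n) (s + t)) f) \<longlonglongrightarrow> S s (S t f)" by (simp add: U_add)
qed

lemma S_minus_id_le:
  assumes "(w, z) \<in> A" "t \<ge> 0"
  shows "norm (S t w - w) \<le> norm z * t"
proof (rule LIMSEQ_le)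
  show "(\<lambda>n. norm (app (U (\<eta> n) t) w - w)) \<longlonglongrightarrow> norm (S t w - w)"
    by (intro tendsto_intros S_lim assms)
  show "(\<lambda>n. norm (app (B (\<eta> n)) w) * t) \<longlonglongrightarrow> norm z * t"
    by (intro tendsto_intros app_B_lim assms)
  show "\<exists>N. \<forall>n\<ge>N. norm (app (U (\<eta> n) t) w - w) \<le> norm (app (B (\<eta> n)) w) * t"
    using U_minus_id_le[OF \<eta>_pos assms(2)] by simp
qed

lemma S_continuous: "((\<lambda>t. S t f - f) \<longlongrightarrow> 0) (at_right 0)"
proof (rule tendsto_zero_dense[where c=2, OF _ dense])
  show "\<forall>\<^sub>F t in at_right 0. \<forall>x y. norm (S t x - x - (S t y - y)) \<le> 2 * norm (x - y)"
    using eventually_at_right_less[of 0]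
  proof eventually_elim
    case (elim t)
    interpret S: bounded_linear "S t" by (rule S_linear[OF less_imp_le[OF elim]])
    show ?case
    proof (intro allI)
      fix x y
      have "S t x - x - (S t y - y) = S t (x - y) - (x - y)" by (simp add: S.diff)
      moreover have "norm (S t (x - y) - (x - y)) \<le> 2 * norm (x - y)"
        using norm_triangle_ineq4[of "S t (x - y)" "x - y"] norm_S_le[of t "x - y"] elim by simp
      ultimately show "norm (S t x - x - (S t y - y)) \<le> 2 * norm (x - y)" by (simp only:)
    qed
  qed
next
  fix x assume "x \<in> Domain A"
  then obtain z where z: "(x, z) \<in> A" by blast
  have "((\<lambda>t. norm z * t) \<longlongrightarrow> norm z * 0) (at_right 0)" by (intro tendsto_intros)
  moreover have "\<forall>\<^sub>F t in at_right 0. norm (S t x - x) \<le> norm z * t"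
    using eventually_at_right_less[of 0] by eventually_elim (rule S_minus_id_le[OF z less_imp_le])
  ultimately show "((\<lambda>t. S t x - x) \<longlongrightarrow> 0) (at_right 0)"
    using Lim_null_comparison[where g="\<lambda>t. norm z * t"] by simp
qed

text \<open>The remainder involves \<open>U s z - z\<close>, and \<open>z\<close> need not lie in
  the domain. It is therefore replaced by a nearby \<open>v\<close> in the domain, for which this
  difference is at most \<open>norm y * t\<close>; moving from \<open>z\<close> to \<open>v\<close>
  costs \<open>2 * norm (z - v)\<close>.\<close>

lemma S_derivative:
  assumes wz: "(w, z) \<in> A"
  shows "((\<lambda>t. (S t w - w) /\<^sub>R t) \<longlongrightarrow> z) (at_right 0)"
proof -
  have main: "norm (S t w - w - t *\<^sub>R z) \<le> (2 * norm (z - v) + norm y * t) * t"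
    if vy: "(v, y) \<in> A" and t: "t \<ge> 0" for v y t
  proof (rule LIMSEQ_le)
    show "(\<lambda>n. norm (app (U (\<eta> n) t) w - w - t *\<^sub>R app (B (\<eta> n)) w)) \<longlonglongrightarrow> norm (S t w - w - t *\<^sub>R z)"
      by (intro tendsto_intros S_lim t app_B_lim wz)
    show "(\<lambda>n. (2 * norm (app (B (\<eta> n)) w - v) + norm (app (B (\<eta> n)) v) * t) * t)
       \<longlonglongrightarrow> (2 * norm (z - v) + norm y * t) * t"
      by (intro tendsto_intros app_B_lim wz vy)
    have "norm (app (U (\<eta> n) t) w - w - t *\<^sub>R app (B (\<eta> n)) w)
      \<le> (2 * norm (app (B (\<eta> n)) w - v) + norm (app (B (\<eta> n)) v) * t) * t" for n
    proof (rule U_expansion[OF \<eta>_pos t])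
      fix s assume s: "0 \<le> s" "s \<le> t"
      let ?U = "app (U (\<eta> n) s)" and ?x = "app (B (\<eta> n)) w"
      have "?U ?x - ?x = ?U (?x - v) - (?x - v) + (?U v - v)" by (simp add: app.diff_right)
      also have "norm \<dots> \<le> norm (?U (?x - v) - (?x - v)) + norm (?U v - v)" by (rule norm_triangle_ineq)
      also have "norm (?U (?x - v) - (?x - v)) \<le> 2 * norm (?x - v)"
        using norm_triangle_ineq4[of "?U (?x - v)" "?x - v"] norm_app_U[OF \<eta>_pos s(1), of n "?x - v"] by simp
      also have "norm (?U v - v) \<le> norm (app (B (\<eta> n)) v) * t"
        using U_minus_id_le[OF \<eta>_pos s(1), of n v] mult_left_mono[OF s(2), of "norm (app (B (\<eta> n)) v)"] by simp
      finally show "norm (?U ?x - ?x) \<le> 2 * norm (?x - v) + norm (app (B (\<eta> n)) v) * t" by simp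
    qed
    then show "\<exists>N. \<forall>n\<ge>N. norm (app (U (\<eta> n) t) w - w - t *\<^sub>R app (B (\<eta> n)) w)
      \<le> (2 * norm (app (B (\<eta> n)) w - v) + norm (app (B (\<eta> n)) v) * t) * t" by blast
  qed
  show ?thesis
  proof (rule tendstoI)
    fix e :: real assume e: "e > 0"
    have "z \<in> closure (Domain A)" using dense by simp
    then obtain v where "v \<in> Domain A" "dist v z < e / 4"
      using closure_approachable e by (metis zero_less_divide_iff zero_less_numeral)
    then obtain y where vy: "(v, y) \<in> A" and v: "norm (z - v) < e / 4"
      by (auto simp: dist_norm norm_minus_commute)
    have "((\<lambda>t. norm y * t) \<longlongrightarrow> norm y * 0) (at_right 0)" by (intro tendsto_intros)
    then have "\<forall>\<^sub>F t in at_right 0. norm y * t < e / 2" by (rule order_tendstoD) (use e in simp)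
    with eventually_at_right_less[of 0]
    show "\<forall>\<^sub>F t in at_right 0. dist ((S t w - w) /\<^sub>R t) z < e"
    proof eventually_elim
      case (elim t)
      have "(S t w - w) /\<^sub>R t - z = (S t w - w - t *\<^sub>R z) /\<^sub>R t"
        using elim(1) by (simp add: scaleR_diff_right)
      also have "norm \<dots> = norm (S t w - w - t *\<^sub>R z) / t" using elim(1) by (simp add: divide_inverse_commute)
      also have "\<dots> \<le> 2 * norm (z - v) + norm y * t"
        using main[OF vy, of t] elim(1) by (simp add: pos_divide_le_eq)
      also have "\<dots> < e" using v elim by simp
      finally show ?case by (simp add: dist_norm)
    qed
  qed
qed

text \<open>An m-dissipative operator has no proper dissipative extension. Solving
  \<open>w - z = f - g\<close> inside \<open>A\<close>, contractivity of \<open>S t\<close> gives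
  \<open>(g - z) \<bullet> (f - w) \<le> 0\<close>, while \<open>g - z = f - w\<close>; hence
  \<open>f = w\<close>.\<close>

lemma generator_eq: "((\<lambda>t. (S t f - f) /\<^sub>R t) \<longlongrightarrow> g) (at_right 0) \<longleftrightarrow> (f, g) \<in> A"
proof
  assume lim: "((\<lambda>t. (S t f - f) /\<^sub>R t) \<longlongrightarrow> g) (at_right 0)"
  obtain w z where wz: "(w, z) \<in> A" and eq: "w - 1 *\<^sub>R z = f - g" using surj[of 1 "f - g"] by auto
  have "((\<lambda>t. (S t f - f) /\<^sub>R t - (S t w - w) /\<^sub>R t) \<longlongrightarrow> g - z) (at_right 0)"
    by (intro tendsto_diff lim S_derivative wz)
  then have "((\<lambda>t. ((S t f - f) /\<^sub>R t - (S t w - w) /\<^sub>R t) \<bullet> (f - w)) \<longlongrightarrow> (g - z) \<bullet> (f - w)) (at_right 0)"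
    by (intro tendsto_inner tendsto_const)
  moreover have "\<forall>\<^sub>F t in at_right 0. ((S t f - f) /\<^sub>R t - (S t w - w) /\<^sub>R t) \<bullet> (f - w) \<le> 0"
    using eventually_at_right_less[of 0]
  proof eventually_elim
    case (elim t)
    interpret S: bounded_linear "S t" by (rule S_linear[OF less_imp_le[OF elim]])
    have "(S t f - f) /\<^sub>R t - (S t w - w) /\<^sub>R t = (S t (f - w) - (f - w)) /\<^sub>R t"
      by (simp add: S.diff scaleR_diff_right)
    moreover have "S t (f - w) \<bullet> (f - w) \<le> norm (f - w) * norm (f - w)"
      by (rule order_trans[OF norm_cauchy_schwarz mult_right_mono[OF norm_S_le[OF less_imp_le[OF elim]]]]) simp
    then have "(S t (f - w) - (f - w)) \<bullet> (f - w) \<le> 0"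
      by (simp add: inner_diff_left power2_norm_eq_inner[symmetric] power2_eq_square)
    ultimately show ?case using elim by (simp add: divide_inverse mult_le_0_iff)
  qed
  ultimately have "(g - z) \<bullet> (f - w) \<le> 0" by (rule tendsto_upperbound) simp
  moreover have "g - z = f - w" using eq by (simp add: algebra_simps)
  ultimately have "f = w" using inner_gt_zero_iff[of "f - w"] by fastforce
  then show "(f, g) \<in> A" using wz \<open>g - z = f - w\<close> by simp
qed (rule S_derivative)

text \<open>With \<open>c = t / \<eta> n\<close>, the vector \<open>U (\<eta> n) t f\<close> is the
  average of the iterated resolvents \<open>P ^ k f\<close> with Poisson weights
  \<open>exp (- c) * c ^ k / fact k\<close>. Normalised partial sums are finite convex combinations
  of points of \<open>C\<close>.\<close>

lemma S_invariant_closed_convex: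
  assumes C: "closed C" "convex C" and inv: "\<And>h x. h > 0 \<Longrightarrow> x \<in> C \<Longrightarrow> J h x \<in> C"
    and t: "t \<ge> 0" and f: "f \<in> C"
  shows "S t f \<in> C"
proof (rule closed_sequentially[OF C(1) _ S_lim[OF t]])
  fix n
  let ?h = "\<eta> n"
  define c where "c = t / ?h"
  define a where "a k = c ^ k / fact k" for k
  have c: "c \<ge> 0" using t \<eta>_pos[of n] by (simp add: c_def)
  have a: "a k \<ge> 0" for k using c by (simp add: a_def)
  define x where "x k = app (P ?h ^ k) f" for k
  have x: "x k \<in> C" for k
  proof (induction k)
    case (Suc k)
    then show ?case using inv[OF \<eta>_pos] by (simp add: x_def app_P \<eta>_pos)
  qed (simp add: x_def f)
  have "(\<lambda>k. (c *\<^sub>R P ?h) ^ k /\<^sub>R fact k) sums exp (c *\<^sub>R P ?h)"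
    unfolding exp_def by (intro summable_sums summable_exp_generic)
  from bounded_linear.sums[OF app.bounded_linear_left this, of f]
  have "(\<lambda>k. a k *\<^sub>R x k) sums app (exp (c *\<^sub>R P ?h)) f"
    by (simp add: a_def x_def app.scaleR_left scaleR_power divide_inverse mult.commute)
  then have L1: "(\<lambda>N. \<Sum>k<N. a k *\<^sub>R x k) \<longlonglongrightarrow> app (exp (c *\<^sub>R P ?h)) f" by (simp add: sums_def)
  have "a sums exp c" 
    using exp_converges[of c] by (simp add: a_def[abs_def] divide_inverse mult.commute)
  then have L2: "(\<lambda>N. \<Sum>k<N. a k) \<longlonglongrightarrow> exp c" by (simp add: sums_def)
  have "(\<lambda>N. inverse (\<Sum>k<N. a k) *\<^sub>R (\<Sum>k<N. a k *\<^sub>R x k)) \<longlonglongrightarrow> inverse (exp c) *\<^sub>R app (exp (c *\<^sub>R P ?h)) f"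
    by (intro tendsto_intros L1 L2) simp
  \<comment> \<open>The shift removes the empty partial sum, whose total weight 0 could not be
    normalised.\<close>
  from LIMSEQ_Suc[OF this]
  have L: "(\<lambda>N. inverse (\<Sum>k<Suc N. a k) *\<^sub>R (\<Sum>k<Suc N. a k *\<^sub>R x k)) \<longlonglongrightarrow> app (U ?h t) f"
    by (simp add: U_eq \<eta>_pos c_def app.scaleR_left exp_minus)
  show "app (U ?h t) f \<in> C"
  proof (rule closed_sequentially[OF C(1) _ L])
    fix N
    have pos: "(\<Sum>k<Suc N. a k) > 0"
      by (rule sum_pos2[of _ 0]) (use a in \<open>auto simp: a_def\<close>)
    have "(\<Sum>k<Suc N. (a k / (\<Sum>k<Suc N. a k)) *\<^sub>R x k) \<in> C"
    proof (rule convex_sum[OF _ C(2)])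
      show "(\<Sum>k<Suc N. a k / (\<Sum>k<Suc N. a k)) = 1"
        using pos by (subst sum_divide_distrib[symmetric]) simp
    qed (use a x pos in \<open>auto intro: divide_nonneg_pos\<close>)
    then show "inverse (\<Sum>k<Suc N. a k) *\<^sub>R (\<Sum>k<Suc N. a k *\<^sub>R x k) \<in> C"
      by (subst scaleR_sum_right) (simp add: divide_inverse mult.commute)
  qed
qed

text \<open>Applied below to multiplication by complex constants, which makes the semigroup complex
  linear, and to restriction to \<Omega>.\<close>

lemma S_commute:
  assumes R: "bounded_linear R" and RA: "\<And>w z. (w, z) \<in> A \<Longrightarrow> (R w, R z) \<in> A" and t: "t \<ge> 0"
  shows "S t (R f) = R (S t f)"
proof -
  obtain r where r: "app r = R" using exists_endo[OF R] by blast
  have U: "app (U (\<eta> n) t) (R f) = R (app (U (\<eta> n) t) f)" for n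
  proof -
    have "P (\<eta> n) * r = r * P (\<eta> n)"
      by (rule app_eqI) (simp add: app_P \<eta>_pos r J_commute[OF \<eta>_pos R RA])
    then have "U (\<eta> n) t * r = r * U (\<eta> n) t"
      unfolding U_def by (intro commute_exp) (simp add: B_def algebra_simps)
    then show ?thesis by (metis app_times r)
  qed
  show ?thesis
  proof (rule LIMSEQ_unique[OF S_lim[OF t]])
    show "(\<lambda>n. app (U (\<eta> n) t) (R f)) \<longlonglongrightarrow> R (S t f)"
      unfolding U by (rule bounded_linear.tendsto[OF R S_lim[OF t]])
  qed
qed

text \<open>A symmetric operator with \<open>I - A\<close> surjective has no proper extension inside
  its adjoint: \<open>v - w\<close> annihilates the range of \<open>I - A\<close>, in particular
  itself.\<close>

lemma adjoint_in:
  assumes sym: "\<And>w z w' z'. (w, z) \<in> A \<Longrightarrow> (w', z') \<in> A \<Longrightarrow> z \<bullet> w' = w \<bullet> z'"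
    and adj: "\<And>w z. (w, z) \<in> A \<Longrightarrow> z \<bullet> v = w \<bullet> g"
  shows "(v, g) \<in> A"
proof -
  obtain w z where wz: "(w, z) \<in> A" and eq: "w - 1 *\<^sub>R z = v - g" using surj[of 1 "v - g"] by auto
  obtain w' z' where wz': "(w', z') \<in> A" and eq': "w' - 1 *\<^sub>R z' = v - w" using surj[of 1 "v - w"] by auto
  have "(v - w) \<bullet> (v - w) = (w' - z') \<bullet> v - (w' - z') \<bullet> w"
    using eq' by (simp add: inner_diff_right[symmetric])
  also have "(w' - z') \<bullet> v = w' \<bullet> (v - g)" using adj[OF wz'] by (simp add: inner_diff)
  also have "(w' - z') \<bullet> w = w' \<bullet> (w - z)" using sym[OF wz' wz] by (simp add: inner_diff)
  also have "w - z = v - g" using eq by simp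
  finally have "v = w" by simp
  then show ?thesis using wz eq by simp
qed

end

section \<open>Self-adjoint operators defined by closed subspaces\<close>

lemma inner_dense_zero:
  fixes x :: "'h::real_inner"
  assumes "closure D = UNIV" "\<And>v. v \<in> D \<Longrightarrow> x \<bullet> v = 0"
  shows "x = 0"
proof -
  have "x \<in> closure D" using assms(1) by simp
  then obtain f where f: "\<And>n. f n \<in> D" "f \<longlonglongrightarrow> x" unfolding closure_sequential by blast
  have "(\<lambda>n. x \<bullet> f n) \<longlonglongrightarrow> x \<bullet> x" by (intro tendsto_inner tendsto_const f)
  then show ?thesis using assms(2)[OF f(1)] by (simp add: LIMSEQ_const_iff)
qed

text \<open>Weak closedness of a closed subspace: strong convergence of the first components and
  boundedness of the second ones give a limit pair, and the norm bound survives. The sets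
  \<open>K n\<close> consist of the pairs whose first component is within
  \<open>\<epsilon> n\<close> of \<open>a\<close> and whose second component has norm at most
  \<open>l + \<epsilon> n\<close>.\<close>

lemma closed_subspace_bounded_limit:
  fixes G :: "('h::{real_inner,complete_space} \<times> 'k::{real_inner,complete_space}) set"
  assumes G: "closed G" "subspace G" and x: "\<And>n. (x n, b n) \<in> G" "x \<longlonglongrightarrow> a"
    and b: "\<And>n. norm (b n) \<le> c n" "c \<longlonglongrightarrow> l"
  obtains d where "(a, d) \<in> G" "norm d \<le> l"
proof -
  define \<epsilon> where "\<epsilon> n = 1 / real (Suc n)" for n
  define K where "K n = G \<inter> (cball a (\<epsilon> n) \<times> cball 0 (l + \<epsilon> n))" for n
  have \<epsilon>: "\<epsilon> n > 0" for n by (simp add: \<epsilon>_def)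
  obtain p where p: "\<And>n. p \<in> K n"
  proof (rule nested_closed_convex_Inter)
    show "closed (K n)" for n unfolding K_def by (intro closed_Int G closed_Times closed_cball)
    show "convex (K n)" for n 
      unfolding K_def by (intro convex_Int subspace_imp_convex G convex_Times convex_cball)
    show "K (Suc n) \<subseteq> K n" for n
    proof -
      have "\<epsilon> (Suc n) \<le> \<epsilon> n" by (simp add: \<epsilon>_def field_simps)
      then show ?thesis unfolding K_def by auto
    qed
    show "bounded (K 0)" unfolding K_def
      by (rule bounded_subset[OF bounded_Times[OF bounded_cball bounded_cball]]) blast
    show "K n \<noteq> {}" for n
    proof -
      have "\<forall>\<^sub>F k in sequentially. dist (x k) a < \<epsilon> n" using x(2) \<epsilon> by (rule tendstoD)
      moreover have "\<forall>\<^sub>F k in sequentially. c k < l + \<epsilon> n" by (rule order_tendstoD(2)[OF b(2)]) (simp add: \<epsilon>)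
      ultimately have "\<forall>\<^sub>F k in sequentially. (x k, b k) \<in> K n"
      proof eventually_elim
        case (elim k)
        then show ?case using x(1)[of k] b(1)[of k] by (simp add: K_def dist_commute)
      qed
      then show ?thesis by (auto simp: eventually_sequentially)
    qed
  qed (rule that)
  obtain a' d where [simp]: "p = (a', d)" by fastforce
  have \<epsilon>0: "\<epsilon> \<longlonglongrightarrow> 0" unfolding \<epsilon>_def using LIMSEQ_Suc[OF lim_1_over_n] by simp
  have "dist a a' \<le> 0" by (rule LIMSEQ_le_const[OF \<epsilon>0]) (use p in \<open>auto simp: K_def\<close>)
  moreover have "norm d \<le> l + 0" 
    by (rule LIMSEQ_le_const[OF tendsto_add[OF tendsto_const \<epsilon>0]]) (use p in \<open>auto simp: K_def\<close>)
  ultimately show ?thesis using that[of d] p[of 0] by (simp add: K_def)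
qed

text \<open>If \<open>G\<close> is the graph of \<open>T\<close>, the condition reads
  \<open>z \<bullet> v = - (T w \<bullet> T v)\<close> for all \<open>v\<close> in the domain.
  Writing it with the graph avoids constructing an adjoint, and closedness of \<open>G\<close>
  supplies the completeness used for solvability.\<close>

definition form_op :: "('h::real_inner \<times> 'k::real_inner) set \<Rightarrow> ('h \<times> 'h) set" where
  "form_op G = {(w, z). \<exists>g. (w, g) \<in> G \<and> (\<forall>v k. (v, k) \<in> G \<longrightarrow> z \<bullet> v + g \<bullet> k = 0)}"

text \<open>The equation states that \<open>(w, sqrt h *\<^sub>R g)\<close> is the orthogonal
  projection of \<open>(f, 0)\<close> onto \<open>G\<close> with its second component rescaled by
  \<open>sqrt h\<close>.\<close>

lemma form_resolvent_exists:
  fixes G :: "('h::{real_inner,complete_space} \<times> 'k::{real_inner,complete_space}) set"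
  assumes G: "closed G" "subspace G" and h: "h > 0"
  obtains w g where "(w, g) \<in> G" "\<And>v k. (v, k) \<in> G \<Longrightarrow> (w - f) \<bullet> v + h * (g \<bullet> k) = 0"
proof -
  let ?s = "\<lambda>(a, b). (a, b /\<^sub>R sqrt h) :: 'h \<times> 'k"
  let ?G = "?s -` G"
  have lin: "linear ?s" by (rule linearI) (auto simp: scaleR_add_right)
  have "closed ?G" 
    by (intro closed_vimage G(1)) (auto simp: case_prod_unfold intro!: continuous_intros)
  moreover have "subspace ?G" using linear_subspace_vimage[OF lin G(2)] .
  ultimately obtain p where p: "p \<in> ?G" "\<And>s. s \<in> ?G \<Longrightarrow> ((f, 0) - p) \<bullet> s = 0"
    using closed_subspace_projection[of ?G "(f, 0)"] by blast
  obtain w b where pw: "p = (w, b)" by fastforce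
  define g where "g = b /\<^sub>R sqrt h"
  have b: "b = sqrt h *\<^sub>R g" using h by (simp add: g_def)
  show ?thesis
  proof
    show "(w, g) \<in> G" using p(1) by (simp add: pw g_def)
    fix v k assume "(v, k) \<in> G"
    then have "(v, sqrt h *\<^sub>R k) \<in> ?G" using h by simp
    from p(2)[OF this] show "(w - f) \<bullet> v + h * (g \<bullet> k) = 0"
      using h by (simp add: pw b inner_diff_left algebra_simps)
  qed
qed

lemma form_op_resolvent:
  fixes G :: "('h::{real_inner,complete_space} \<times> 'k::{real_inner,complete_space}) set"
  assumes G: "closed G" "subspace G" and h: "h > 0"
  shows "\<exists>w z. (w, z) \<in> form_op G \<and> w - h *\<^sub>R z = f"
proof -
  obtain w g where wg: "(w, g) \<in> G" "\<And>v k. (v, k) \<in> G \<Longrightarrow> (w - f) \<bullet> v + h * (g \<bullet> k) = 0"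
    using form_resolvent_exists[OF assms, of f] by blast
  have "(w, (w - f) /\<^sub>R h) \<in> form_op G"
    unfolding form_op_def
  proof (intro CollectI case_prodI exI conjI allI impI)
    show "(w, g) \<in> G" by (rule wg(1))
    fix v k assume "(v, k) \<in> G"
    have "h * (((w - f) /\<^sub>R h) \<bullet> v + g \<bullet> k) = (w - f) \<bullet> v + h * (g \<bullet> k)"
      using h by (simp add: distrib_left)
    also have "\<dots> = 0" by (rule wg(2)[OF \<open>(v, k) \<in> G\<close>])
    finally show "((w - f) /\<^sub>R h) \<bullet> v + g \<bullet> k = 0" using h by simp
  qed
  moreover have "w - h *\<^sub>R ((w - f) /\<^sub>R h) = f" using h by simp
  ultimately show ?thesis by blast
qed

lemma form_op_symmetric:
  assumes "(w, z) \<in> form_op G" "(w', z') \<in> form_op G"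
  shows "z \<bullet> w' = w \<bullet> z'"
proof -
  obtain g where g: "(w, g) \<in> G" "\<And>v k. (v, k) \<in> G \<Longrightarrow> z \<bullet> v + g \<bullet> k = 0"
    using assms(1) unfolding form_op_def by blast
  obtain g' where g': "(w', g') \<in> G" "\<And>v k. (v, k) \<in> G \<Longrightarrow> z' \<bullet> v + g' \<bullet> k = 0"
    using assms(2) unfolding form_op_def by blast
  show ?thesis using g(2)[OF g'(1)] g'(2)[OF g(1)] by (simp add: inner_commute)
qed

lemma m_dissipative_form_op:
  fixes G :: "('h::{real_inner,banach,perfect_space} \<times> 'k::{real_inner,complete_space}) set"
  assumes G: "closed G" "subspace G" and dense: "closure (Domain G) = UNIV"
  shows "m_dissipative (form_op G)"
proof
  show sub: "subspace (form_op G)"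
    unfolding subspace_def
  proof (intro conjI ballI allI)
    show "0 \<in> form_op G" using subspace_0[OF G(2)] by (auto simp: form_op_def zero_prod_def intro!: exI[of _ 0])
    fix p q assume "p \<in> form_op G" 
    then obtain w z g where p: "p = (w, z)" "(w, g) \<in> G" "\<And>v k. (v, k) \<in> G \<Longrightarrow> z \<bullet> v + g \<bullet> k = 0"
      unfolding form_op_def by blast
    { assume "q \<in> form_op G" 
      then obtain w' z' g' where q: "q = (w', z')" "(w', g') \<in> G" "\<And>v k. (v, k) \<in> G \<Longrightarrow> z' \<bullet> v + g' \<bullet> k = 0"
        unfolding form_op_def by blast
      have "(w + w', g + g') \<in> G" using subspace_add[OF G(2) p(2) q(2)] by simp
      moreover have "(z + z') \<bullet> v + (g + g') \<bullet> k = 0" if "(v, k) \<in> G" for v k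
        using p(3)[OF that] q(3)[OF that] by (simp add: inner_add_left)
      ultimately show "p + q \<in> form_op G" unfolding form_op_def p(1) q(1) by auto }
    fix c
    have "(c *\<^sub>R w, c *\<^sub>R g) \<in> G" using subspace_scale[OF G(2) p(2), of c] by simp
    moreover have "(c *\<^sub>R z) \<bullet> v + (c *\<^sub>R g) \<bullet> k = 0" if "(v, k) \<in> G" for v k
      using p(3)[OF that] by (simp add: distrib_left[symmetric])
    ultimately show "c *\<^sub>R p \<in> form_op G" unfolding form_op_def p(1) by auto
  qed
  show "z \<bullet> w \<le> 0" if wz: "(w, z) \<in> form_op G" for w z
  proof -
    obtain g where g: "(w, g) \<in> G" "\<And>v k. (v, k) \<in> G \<Longrightarrow> z \<bullet> v + g \<bullet> k = 0"
      using wz unfolding form_op_def by blast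
    show ?thesis using g(2)[OF g(1)] inner_ge_zero[of g] by linarith
  qed
  show "\<exists>w z. (w, z) \<in> form_op G \<and> w - h *\<^sub>R z = f" if "h > 0" for h f
    by (rule form_op_resolvent[OF G that])
  show "closure (Domain (form_op G)) = UNIV"
  proof (rule dense_subspaceI)
    have "Domain (form_op G) = fst ` form_op G" by (rule Domain_fst)
    then show "subspace (Domain (form_op G))" using linear_subspace_image[OF linear_fst sub] by simp
    \<comment> \<open>Write \<open>x = w - z\<close> with \<open>(w, z)\<close> in the operator.
      Testing orthogonality against \<open>w\<close> itself gives
      \<open>w \<bullet> w + g \<bullet> g = 0\<close>, so \<open>x = - z\<close> with vanishing
      gradient part, and the weak equation says that \<open>z\<close> is orthogonal to the dense
      domain of \<open>G\<close>.\<close>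
    fix x assume orth: "\<And>s. s \<in> Domain (form_op G) \<Longrightarrow> x \<bullet> s = 0"
    obtain w z where wz: "(w, z) \<in> form_op G" and eq: "w - 1 *\<^sub>R z = x" using form_op_resolvent[OF G, of 1 x] by auto
    obtain g where g: "(w, g) \<in> G" "\<And>v k. (v, k) \<in> G \<Longrightarrow> z \<bullet> v + g \<bullet> k = 0"
      using wz unfolding form_op_def by blast
    have "x \<bullet> w = 0" by (rule orth) (use wz in blast)
    then have "w \<bullet> w = z \<bullet> w" using eq by (auto simp: inner_diff_left)
    then have "w \<bullet> w + g \<bullet> g = 0" using g(2)[OF g(1)] by simp
    then have "w = 0" "g = 0" using inner_ge_zero[of w] inner_ge_zero[of g]
      by (metis add_nonneg_eq_0_iff inner_eq_zero_iff)+
    then have "x \<bullet> v = 0" if "v \<in> Domain G" for v using g(2) that eq by auto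
    then show "x = 0" by (rule inner_dense_zero[OF dense])
  qed
qed

text \<open>The resolvent minimises \<open>norm (w - f)^2 + h * norm g^2\<close> over \<open>G\<close>.\<close>

lemma form_resolvent_minimal:
  assumes G: "subspace G" and wz: "(w, z) \<in> form_op G" and h: "h > 0" and wf: "w - h *\<^sub>R z = f"
  obtains g where "(w, g) \<in> G" 
    "\<And>w' g'. (w', g') \<in> G \<Longrightarrow> norm (w' - f) \<le> norm (w - f) \<Longrightarrow> norm g' \<le> norm g \<Longrightarrow> w' = w"
proof -
  obtain g where g: "(w, g) \<in> G" "\<And>v k. (v, k) \<in> G \<Longrightarrow> z \<bullet> v + g \<bullet> k = 0"
    using wz unfolding form_op_def by blast
  have "w' = w" if w': "(w', g') \<in> G" and le: "norm (w' - f) \<le> norm (w - f)" "norm g' \<le> norm g" for w' g'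
  proof -
    have "(w' - w, g' - g) \<in> G" using subspace_diff[OF G w' g(1)] by simp
    from g(2)[OF this] have "h * (z \<bullet> (w' - w)) + h * (g \<bullet> (g' - g)) = 0" 
      by (simp add: distrib_left[symmetric])
    moreover have "w - f = h *\<^sub>R z" using wf by auto
    ultimately have eq: "(w - f) \<bullet> (w' - w) + h * (g \<bullet> (g' - g)) = 0" by simp
    \<comment> \<open>Both squares are expanded around the resolvent. The first order terms cancel
      by \<open>eq\<close>, and what remains of the two norm bounds is that
      \<open>norm (w' - w)\<close> vanishes.\<close>
    have "(norm (w' - f))\<^sup>2 = (norm (w - f))\<^sup>2 + 2 * ((w - f) \<bullet> (w' - w)) + (norm (w' - w))\<^sup>2"
      unfolding power2_norm_eq_inner by (simp add: inner_diff_left inner_diff_right inner_commute)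
    moreover have "(norm g')\<^sup>2 = (norm g)\<^sup>2 + 2 * (g \<bullet> (g' - g)) + (norm (g' - g))\<^sup>2"
      unfolding power2_norm_eq_inner by (simp add: inner_diff_left inner_diff_right inner_commute)
    then have "h * (norm g')\<^sup>2 = h * ((norm g)\<^sup>2 + 2 * (g \<bullet> (g' - g)) + (norm (g' - g))\<^sup>2)"
      by simp
    then have "h * (norm g')\<^sup>2 = h * (norm g)\<^sup>2 + 2 * (h * (g \<bullet> (g' - g))) + h * (norm (g' - g))\<^sup>2"
      by (simp only: distrib_left mult.left_commute[of 2 h])
    moreover have "(norm (w' - f))\<^sup>2 \<le> (norm (w - f))\<^sup>2" using le(1) by (intro power_mono) auto
    moreover have "h * (norm g')\<^sup>2 \<le> h * (norm g)\<^sup>2" using le(2) h by (intro mult_left_mono power_mono) auto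
    moreover have "0 \<le> h * (norm (g' - g))\<^sup>2" using h by simp
    ultimately have "(norm (w' - w))\<^sup>2 \<le> 0" using eq by linarith
    then show ?thesis by simp
  qed
  then show ?thesis using that g(1) by blast
qed

section \<open>Smooth functions\<close>

lemma partial_eq: "(f has_derivative f') (at x) \<Longrightarrow> partial b f x = f' b"
  unfolding partial_def by (metis frechet_derivative_at)

lemma has_derivative_partial:
  "f differentiable (at x) \<Longrightarrow> (f has_derivative (\<lambda>h. partial h f x)) (at x)"
  unfolding partial_def by (simp add: frechet_derivative_works[symmetric])

lemma C_k_imp_continuous_on: "C_k k f \<Longrightarrow> continuous_on UNIV f"
  by (cases k) (auto intro: continuous_at_imp_continuous_on differentiable_imp_continuous_within)

lemma C_k_SucD: "C_k (Suc k) f \<Longrightarrow> C_k k f"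
  by (induction k arbitrary: f) 
    (auto intro: continuous_at_imp_continuous_on differentiable_imp_continuous_within)

text \<open>Turns each differentiation rule into an induction step on \<open>k\<close>: it suffices
  to exhibit the derivative and to see its directional values as functions of class
  \<open>C_k k\<close>.\<close>

lemma C_k_SucI:
  assumes "\<And>x. (f has_derivative f' x) (at x)" "\<And>b. b \<in> Basis \<Longrightarrow> C_k k (\<lambda>x. f' x b)"
  shows "C_k (Suc k) f"
proof -
  have "partial b f = (\<lambda>x. f' x b)" for b using partial_eq[OF assms(1)] by blast
  then show ?thesis using assms by (auto simp: differentiable_def)
qed

lemma C_k_SucE:
  assumes "C_k (Suc k) f"
  shows "(f has_derivative (\<lambda>h. partial h f x)) (at x)" "b \<in> Basis \<Longrightarrow> C_k k (\<lambda>x. partial b f x)"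
  using assms by (auto intro: has_derivative_partial)

lemma C_k_const: "C_k k (\<lambda>x. c)"
proof (induction k arbitrary: c)
  case (Suc k)
  show ?case by (rule C_k_SucI[where f'="\<lambda>_ _. 0"]) (auto intro: Suc)
qed simp

lemma C_k_add: "C_k k f \<Longrightarrow> C_k k g \<Longrightarrow> C_k k (\<lambda>x. f x + g x)"
proof (induction k arbitrary: f g)
  case (Suc k)
  show ?case
    by (rule C_k_SucI[OF has_derivative_add[OF C_k_SucE(1)[OF Suc.prems(1)] C_k_SucE(1)[OF Suc.prems(2)]]])
      (intro Suc.IH C_k_SucE(2)[OF Suc.prems(1)] C_k_SucE(2)[OF Suc.prems(2)])
qed (auto intro: continuous_intros)

lemma C_k_mult: "C_k k f \<Longrightarrow> C_k k g \<Longrightarrow> C_k k (\<lambda>x. f x * g x)"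
proof (induction k arbitrary: f g)
  case (Suc k)
  show ?case
    by (rule C_k_SucI[OF has_derivative_mult[OF C_k_SucE(1)[OF Suc.prems(1)] C_k_SucE(1)[OF Suc.prems(2)]]])
      (intro Suc.IH C_k_add C_k_SucE(2)[OF Suc.prems(1)] C_k_SucE(2)[OF Suc.prems(2)] C_k_SucD[OF Suc.prems(1)]
        C_k_SucD[OF Suc.prems(2)])
qed (auto intro: continuous_intros)

lemma C_k_cmult: "C_k k f \<Longrightarrow> C_k k (\<lambda>x. c * f x)"
  by (intro C_k_mult C_k_const)

lemma C_k_diff: "C_k k f \<Longrightarrow> C_k k g \<Longrightarrow> C_k k (\<lambda>x. f x - g x)"
  using C_k_add[OF _ C_k_cmult[of k g "- 1"]] by simp

lemma C_k_cnj: "C_k k f \<Longrightarrow> C_k k (\<lambda>x. cnj (f x))"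
proof (induction k arbitrary: f)
  case (Suc k)
  show ?case
    by (rule C_k_SucI[OF has_derivative_cnj[OF C_k_SucE(1)[OF Suc.prems(1)]]])
      (intro Suc.IH C_k_SucE(2)[OF Suc.prems(1)])
qed (auto intro: continuous_intros)

lemma C_k_inverse: 
  assumes "\<And>x. f x \<noteq> 0"
  shows "C_k k f \<Longrightarrow> C_k k (\<lambda>x. inverse (f x))"
proof (induction k)
  case 0
  then show ?case using assms by (auto intro!: continuous_intros)
next
  case (Suc k)
  have "C_k k (\<lambda>x. inverse (f x))" using Suc.IH C_k_SucD[OF Suc.prems] .
  then have "C_k k (\<lambda>x. (- 1) * (inverse (f x) * partial b f x * inverse (f x)))" if "b \<in> Basis" for b
    by (intro C_k_cmult C_k_mult C_k_SucE(2)[OF Suc.prems] that)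
  then show ?case
    by (intro C_k_SucI[OF Deriv.has_derivative_inverse[OF assms C_k_SucE(1)[OF Suc.prems]]]) simp
qed

lemma C_k_prod:
  assumes "finite I" "\<And>i. i \<in> I \<Longrightarrow> C_k k (f i)"
  shows "C_k k (\<lambda>x. \<Prod>i\<in>I. f i x)"
  using assms by (induction I) (auto intro: C_k_const C_k_mult)

lemma C_k_sqrt:
  fixes r :: "'a::euclidean_space \<Rightarrow> real"
  assumes pos: "\<And>x. r x > 0"
  shows "C_k k (\<lambda>x. complex_of_real (r x)) \<Longrightarrow> C_k k (\<lambda>x. complex_of_real (sqrt (r x)))"
proof (induction k)
  case 0
  then have "continuous_on UNIV (\<lambda>x. Re (complex_of_real (r x)))" by (intro continuous_intros) simp
  then show ?case by (auto intro!: continuous_intros)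
next
  case (Suc k)
  note d = C_k_SucE(1)[OF Suc.prems]
  let ?r' = "\<lambda>h x. partial h (\<lambda>x. complex_of_real (r x)) x"
  have dr: "(r has_derivative (\<lambda>h. Re (?r' h x))) (at x)" for x
    using bounded_linear.has_derivative[OF bounded_linear_Re d[of x]] by simp
  \<comment> \<open>The derivative of a real function in complex guise is real; this lets the
    derivative of the square root be written as a product of complex functions already known to be
    of class \<open>C_k k\<close>.\<close>
  have re: "?r' h x = complex_of_real (Re (?r' h x))" for h x
    using partial_eq[OF has_derivative_of_real[OF dr[of x], where 'a=complex], of h] by simp
  have "((\<lambda>x. sqrt (r x)) has_derivative (\<lambda>h. Re (?r' h x) * (inverse (sqrt (r x)) / 2))) (at x)" for x
    by (rule has_derivative_real_sqrt[OF pos dr, of x])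
  from has_derivative_of_real[OF this, where 'a=complex]
  have *: "((\<lambda>x. complex_of_real (sqrt (r x))) has_derivative 
    (\<lambda>h. ?r' h x * ((1/2) * inverse (complex_of_real (sqrt (r x)))))) (at x)" for x
    by (subst re) (simp add: field_simps)
  have "complex_of_real (sqrt (r x)) \<noteq> 0" for x using pos[of x] by simp
  then show ?case
    by (intro C_k_SucI[OF *] C_k_mult C_k_const C_k_SucE(2)[OF Suc.prems] C_k_inverse Suc.IH C_k_SucD[OF Suc.prems])
qed

lemma C_k_inner: "C_k k (\<lambda>x. complex_of_real (x \<bullet> u))"
proof (cases k)
  case (Suc j)
  show ?thesis unfolding Suc
    by (rule C_k_SucI[where f'="\<lambda>x h. complex_of_real (h \<bullet> u)"])
      (auto intro!: C_k_const derivative_eq_intros)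
qed (auto intro!: continuous_intros)

text \<open>The powers of \<open>1 / t\<close> make this family closed under differentiation.\<close>

definition flat_exp :: "real \<Rightarrow> nat \<Rightarrow> real \<Rightarrow> real" where
  "flat_exp c j t = (if t > 0 then inverse t ^ j * exp (- (c * inverse t)) else 0)"

text \<open>Exponentials beat powers: substitute \<open>c / t\<close>, which tends to infinity from
  the right; from the left the function vanishes identically.\<close>

lemma flat_exp_tendsto_0:
  assumes c: "c > 0"
  shows "(flat_exp c j \<longlongrightarrow> 0) (at 0)"
proof -
  have "filterlim (\<lambda>t. c * inverse t) at_top (at_right 0)"
    by (intro filterlim_tendsto_pos_mult_at_top[OF tendsto_const c] filterlim_inverse_at_top_right)
  from filterlim_compose[OF tendsto_power_div_exp_0 this, of j]
  have "((\<lambda>t. inverse c ^ j * ((c * inverse t) ^ j / exp (c * inverse t))) \<longlongrightarrow> inverse c ^ j * 0) (at_right 0)"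
    by (intro tendsto_intros)
  moreover have "\<forall>\<^sub>F t in at_right 0. inverse c ^ j * ((c * inverse t) ^ j / exp (c * inverse t)) = flat_exp c j t"
    using eventually_at_right_less[of 0]
  proof eventually_elim
    case (elim t)
    have "inverse c ^ j * (c * inverse t) ^ j = inverse t ^ j"
      using c by (simp add: power_mult_distrib[symmetric] mult.assoc[symmetric])
    then show ?case using elim by (simp add: flat_exp_def exp_minus divide_inverse mult.assoc[symmetric])
  qed
  ultimately have "(flat_exp c j \<longlongrightarrow> inverse c ^ j * 0) (at_right 0)"
    by (rule Lim_transform_eventually)
  then have "(flat_exp c j \<longlongrightarrow> 0) (at_right 0)" by simp
  moreover have "(flat_exp c j \<longlongrightarrow> 0) (at_left 0)"
    by (rule tendsto_eventually) (auto simp: flat_exp_def eventually_at_filter)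
  ultimately show ?thesis by (simp add: filterlim_at_split)
qed

lemma flat_exp_deriv:
  assumes c: "c > 0"
  shows "(flat_exp c j has_real_derivative (- real j * flat_exp c (Suc j) t + c * flat_exp c (Suc (Suc j)) t)) (at t)"
proof -
  consider "t > 0" | "t < 0" | "t = 0" by linarith
  then show ?thesis
  proof cases
    case 1
    \<comment> \<open>The truncated exponent for \<open>j = 0\<close> is harmless because of the
      factor \<open>real j\<close>.\<close>
    have p: "real j * inverse t ^ (j - Suc 0) * (inverse t * inverse t) = real j * inverse t ^ Suc j"
      by (cases j) simp_all
    have "((\<lambda>t. inverse t ^ j * exp (- (c * inverse t))) has_real_derivative
        - (real j * inverse t ^ (j - Suc 0) * (inverse t * inverse t)) * exp (- (c * inverse t)) 
        + inverse t ^ j * (exp (- (c * inverse t)) * (c * (inverse t * inverse t)))) (at t)"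
      using 1 by (auto intro!: derivative_eq_intros)
    also have "- (real j * inverse t ^ (j - Suc 0) * (inverse t * inverse t)) * exp (- (c * inverse t)) 
        + inverse t ^ j * (exp (- (c * inverse t)) * (c * (inverse t * inverse t)))
        = - real j * flat_exp c (Suc j) t + c * flat_exp c (Suc (Suc j)) t"
      unfolding p using 1 by (simp add: flat_exp_def)
    finally have "((\<lambda>t. inverse t ^ j * exp (- (c * inverse t))) has_real_derivative
        (- real j * flat_exp c (Suc j) t + c * flat_exp c (Suc (Suc j)) t)) (at t)" .
    then show ?thesis
      by (rule has_field_derivative_transform_within_open[of _ _ _ "{0<..}"]) (use 1 in \<open>auto simp: flat_exp_def\<close>)
  next
    case 2
    have "((\<lambda>t. 0) has_real_derivative 0) (at t)" by simp
    then have "(flat_exp c j has_real_derivative 0) (at t)"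
      by (rule has_field_derivative_transform_within_open[of _ _ _ "{..<0}"]) (use 2 in \<open>auto simp: flat_exp_def\<close>)
    then show ?thesis using 2 by (simp add: flat_exp_def)
  next
    case 3
    \<comment> \<open>Away from 0 the difference quotient at 0 is \<open>flat_exp c (Suc j)\<close>,
      whose limit is already known.\<close>
    have "((\<lambda>y. (flat_exp c j y - flat_exp c j 0) / (y - 0)) \<longlongrightarrow> 0) (at 0)"
    proof (rule Lim_transform_eventually[OF flat_exp_tendsto_0[OF c, of "Suc j"]])
      show "\<forall>\<^sub>F y in at 0. flat_exp c (Suc j) y = (flat_exp c j y - flat_exp c j 0) / (y - 0)"
        by (auto simp: flat_exp_def divide_inverse eventually_at_filter)
    qed
    then have "(flat_exp c j has_real_derivative 0) (at 0)" unfolding has_field_derivative_iff .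
    then show ?thesis using 3 by (simp add: flat_exp_def)
  qed
qed

lemma C_k_flat_exp:
  assumes c: "c > 0"
  shows "C_k k (\<lambda>x. complex_of_real (flat_exp c j (x \<bullet> u + d)))"
proof (induction k arbitrary: j)
  case 0
  have "continuous_on UNIV (flat_exp c j)"
    using flat_exp_deriv[OF c] by (meson DERIV_isCont continuous_at_imp_continuous_on)
  then have "continuous_on UNIV (\<lambda>x. flat_exp c j (x \<bullet> u + d))"
    by (rule continuous_on_compose2) (auto intro!: continuous_intros)
  then show ?case by (auto intro!: continuous_intros)
next
  case (Suc k)
  let ?f = "\<lambda>j x. complex_of_real (flat_exp c j (x \<bullet> u + d))"
  have "((\<lambda>x. x \<bullet> u + d) has_derivative (\<lambda>h. h \<bullet> u)) (at x)" for x
    by (auto intro!: derivative_eq_intros)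
  from DERIV_compose_FDERIV[OF flat_exp_deriv[OF c] this]
  have "((\<lambda>x. flat_exp c j (x \<bullet> u + d)) has_derivative (\<lambda>h. (h \<bullet> u) * 
    (- real j * flat_exp c (Suc j) (x \<bullet> u + d) + c * flat_exp c (Suc (Suc j)) (x \<bullet> u + d)))) (at x)" for x .
  from has_derivative_of_real[OF this, where 'a=complex]
  have *: "(?f j has_derivative (\<lambda>h. complex_of_real (h \<bullet> u) * 
    (complex_of_real (- real j) * ?f (Suc j) x + complex_of_real c * ?f (Suc (Suc j)) x))) (at x)" for x by simp
  show ?case by (rule C_k_SucI[OF *]) (intro C_k_cmult C_k_add Suc)
qed

section \<open>Test functions\<close>

definition smooth :: "('a::euclidean_space \<Rightarrow> complex) \<Rightarrow> bool" where "smooth f \<longleftrightarrow> (\<forall>k. C_k k f)"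

lemma smooth_const: "smooth (\<lambda>x. c)" by (simp add: smooth_def C_k_const)
lemma smooth_add: "smooth f \<Longrightarrow> smooth g \<Longrightarrow> smooth (\<lambda>x. f x + g x)" by (simp add: smooth_def C_k_add)
lemma smooth_diff: "smooth f \<Longrightarrow> smooth g \<Longrightarrow> smooth (\<lambda>x. f x - g x)" by (simp add: smooth_def C_k_diff)
lemma smooth_mult: "smooth f \<Longrightarrow> smooth g \<Longrightarrow> smooth (\<lambda>x. f x * g x)" by (simp add: smooth_def C_k_mult)
lemma smooth_cnj: "smooth f \<Longrightarrow> smooth (\<lambda>x. cnj (f x))" by (simp add: smooth_def C_k_cnj)
lemma smooth_inverse: "smooth f \<Longrightarrow> (\<And>x. f x \<noteq> 0) \<Longrightarrow> smooth (\<lambda>x. inverse (f x))"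
  by (simp add: smooth_def C_k_inverse)
lemma smooth_inner: "smooth (\<lambda>x. complex_of_real (x \<bullet> u))" by (simp add: smooth_def C_k_inner)

lemma smooth_partial: "smooth f \<Longrightarrow> b \<in> Basis \<Longrightarrow> smooth (partial b f)"
  unfolding smooth_def using C_k_SucE(2) by blast

lemma smooth_deriv: "smooth f \<Longrightarrow> (f has_derivative (\<lambda>h. partial h f x)) (at x)"
  unfolding smooth_def using C_k_SucE(1) by blast

lemma smooth_continuous: "smooth f \<Longrightarrow> continuous_on S f"
  unfolding smooth_def using C_k_imp_continuous_on continuous_on_subset by blast

lemma smooth_measurable: 
  assumes "smooth f"
  shows "f \<in> borel_measurable lborel" "f \<in> borel_measurable lebesgue"
proof -
  have *: "f \<in> borel_measurable borel" by (rule borel_measurable_continuous_onI[OF smooth_continuous[OF assms]])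
  then show "f \<in> borel_measurable lborel" by simp
  then show "f \<in> borel_measurable lebesgue" by (rule measurable_completion)
qed

lemma test_functions_smooth: "\<phi> \<in> test_functions \<Omega> \<Longrightarrow> smooth \<phi>"
  by (simp add: test_functions_def smooth_def)

lemma test_functions_support:
  assumes "\<phi> \<in> test_functions \<Omega>"
  obtains K where "compact K" "K \<subseteq> \<Omega>" "\<And>x. x \<notin> K \<Longrightarrow> \<phi> x = 0"
proof
  show "compact (closure {x. \<phi> x \<noteq> 0})" "closure {x. \<phi> x \<noteq> 0} \<subseteq> \<Omega>" 
    using assms by (auto simp: test_functions_def)
  show "x \<notin> closure {x. \<phi> x \<noteq> 0} \<Longrightarrow> \<phi> x = 0" for x using closure_subset[of "{x. \<phi> x \<noteq> 0}"] by blast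
qed

lemma test_functionsI:
  assumes "smooth \<phi>" "compact K" "K \<subseteq> \<Omega>" "\<And>x. x \<notin> K \<Longrightarrow> \<phi> x = 0"
  shows "\<phi> \<in> test_functions \<Omega>"
proof -
  have "closure {x. \<phi> x \<noteq> 0} \<subseteq> K" 
    by (rule closure_minimal) (use assms compact_imp_closed in auto)
  moreover have "bounded {x. \<phi> x \<noteq> 0}"
    by (rule bounded_subset[OF compact_imp_bounded[OF assms(2)]]) (use assms(4) in blast)
  ultimately show ?thesis using assms(1,3) by (auto simp: test_functions_def smooth_def)
qed

text \<open>Serves all smooth expressions that vanish wherever a given test function does: products,
  conjugates, truncations and blends.\<close>

lemma test_functions_restrict:
  assumes \<phi>: "\<phi> \<in> test_functions \<Omega>" and "smooth \<psi>" and "\<And>x. \<phi> x = 0 \<Longrightarrow> \<psi> x = 0"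
  shows "\<psi> \<in> test_functions \<Omega>"
proof -
  obtain K where "compact K" "K \<subseteq> \<Omega>" "\<And>x. x \<notin> K \<Longrightarrow> \<phi> x = 0" using test_functions_support[OF \<phi>] by blast
  then show ?thesis by (intro test_functionsI[OF assms(2), of K] assms(3))
qed

lemma test_zero: "(\<lambda>x. 0) \<in> test_functions \<Omega>"
  by (rule test_functionsI[of _ "{}"]) (auto simp: smooth_const)

lemma test_add:
  assumes \<phi>: "\<phi> \<in> test_functions \<Omega>" and \<psi>: "\<psi> \<in> test_functions \<Omega>"
  shows "(\<lambda>x. \<phi> x + \<psi> x) \<in> test_functions \<Omega>"
proof -
  obtain K L where "compact K" "K \<subseteq> \<Omega>" "\<And>x. x \<notin> K \<Longrightarrow> \<phi> x = 0" "compact L" "L \<subseteq> \<Omega>" "\<And>x. x \<notin> L \<Longrightarrow> \<psi> x = 0"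
    using test_functions_support[OF \<phi>] test_functions_support[OF \<psi>] by metis
  then show ?thesis
    by (intro test_functionsI[of _ "K \<union> L"] smooth_add test_functions_smooth[OF \<phi>] test_functions_smooth[OF \<psi>]) auto
qed

lemma test_mult: "\<phi> \<in> test_functions \<Omega> \<Longrightarrow> smooth \<psi> \<Longrightarrow> (\<lambda>x. \<psi> x * \<phi> x) \<in> test_functions \<Omega>"
  by (rule test_functions_restrict[OF _ smooth_mult[OF _ test_functions_smooth]]) auto

lemma test_cmult: "\<phi> \<in> test_functions \<Omega> \<Longrightarrow> (\<lambda>x. c * \<phi> x) \<in> test_functions \<Omega>"
  by (rule test_mult[OF _ smooth_const])

lemma test_cnj: "\<phi> \<in> test_functions \<Omega> \<Longrightarrow> (\<lambda>x. cnj (\<phi> x)) \<in> test_functions \<Omega>"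
  by (rule test_functions_restrict[OF _ smooth_cnj[OF test_functions_smooth]]) auto

lemma test_partial_zero:
  assumes K: "compact K" "\<And>x. x \<notin> K \<Longrightarrow> \<phi> x = 0" and x: "x \<notin> K"
  shows "partial b \<phi> x = 0"
proof -
  have "((\<lambda>_. 0) has_derivative (\<lambda>_. 0)) (at x)" by simp
  then have "(\<phi> has_derivative (\<lambda>_. 0)) (at x)"
    by (rule has_derivative_transform_within_open[of _ _ _ _ "- K"]) 
      (use K x compact_imp_closed in \<open>auto simp: open_Compl\<close>)
  then show ?thesis by (simp add: partial_eq)
qed

lemma test_partial:
  assumes \<phi>: "\<phi> \<in> test_functions \<Omega>" and b: "b \<in> Basis"
  shows "partial b \<phi> \<in> test_functions \<Omega>"
proof -
  obtain K where "compact K" "K \<subseteq> \<Omega>" "\<And>x. x \<notin> K \<Longrightarrow> \<phi> x = 0" using test_functions_support[OF \<phi>] by blast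
  then show ?thesis 
    by (intro test_functionsI[of _ K] smooth_partial test_functions_smooth[OF \<phi>] b test_partial_zero)
qed

lemma test_bounded:
  assumes \<phi>: "\<phi> \<in> test_functions \<Omega>"
  obtains B where "B \<ge> 0" "\<And>x. norm (\<phi> x) \<le> B"
proof -
  obtain K where K: "compact K" "K \<subseteq> \<Omega>" "\<And>x. x \<notin> K \<Longrightarrow> \<phi> x = 0" using test_functions_support[OF \<phi>] by blast
  have "bounded (\<phi> ` K)"
    by (intro compact_imp_bounded compact_continuous_image K smooth_continuous test_functions_smooth[OF \<phi>])
  then obtain B where "\<And>x. x \<in> K \<Longrightarrow> norm (\<phi> x) \<le> B" unfolding bounded_iff by blast
  then have "norm (\<phi> x) \<le> max B 0" for x using K(3)[of x] by (cases "x \<in> K") (auto intro: max.coboundedI1)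
  then show ?thesis using that[of "max B 0"] by simp
qed

lemma integrable_compact_support:
  fixes f :: "'a::euclidean_space \<Rightarrow> 'b::euclidean_space"
  assumes "continuous_on UNIV f" "compact K" "\<And>x. x \<notin> K \<Longrightarrow> f x = 0"
  shows "integrable lborel f" "integrable lebesgue f"
proof -
  have "integrable lborel (\<lambda>x. indicator K x *\<^sub>R f x)"
    by (rule borel_integrable_compact[OF assms(2)]) (use assms continuous_on_subset in blast)
  also have "(\<lambda>x. indicator K x *\<^sub>R f x) = f" using assms(3) by (auto simp: indicator_def)
  finally show "integrable lborel f" .
  then show "integrable lebesgue f" 
    using assms(1) by (subst integrable_completion) (auto intro: borel_measurable_continuous_onI)
qed

lemma test_integrable:
  assumes \<phi>: "\<phi> \<in> test_functions \<Omega>" 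
  shows "integrable lborel \<phi>" "integrable lebesgue \<phi>"
proof -
  obtain K where K: "compact K" "K \<subseteq> \<Omega>" "\<And>x. x \<notin> K \<Longrightarrow> \<phi> x = 0" using test_functions_support[OF \<phi>] by blast
  show "integrable lborel \<phi>" "integrable lebesgue \<phi>"
    by (rule integrable_compact_support[OF smooth_continuous[OF test_functions_smooth[OF \<phi>]] K(1,3)], assumption)+
qed

lemma partial_add: "smooth f \<Longrightarrow> smooth g \<Longrightarrow> partial b (\<lambda>x. f x + g x) x = partial b f x + partial b g x"
  by (rule partial_eq[OF has_derivative_add[OF smooth_deriv smooth_deriv]])

lemma partial_mult: "smooth f \<Longrightarrow> smooth g \<Longrightarrow> partial b (\<lambda>x. f x * g x) x = f x * partial b g x + partial b f x * g x"
  by (rule partial_eq[OF has_derivative_mult[OF smooth_deriv smooth_deriv]])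

lemma partial_cmult: "smooth f \<Longrightarrow> partial b (\<lambda>x. c * f x) x = c * partial b f x"
  by (rule partial_eq[OF has_derivative_mult_right[OF smooth_deriv]])

lemma partial_cnj: "smooth f \<Longrightarrow> partial b (\<lambda>x. cnj (f x)) x = cnj (partial b f x)"
  by (rule partial_eq[OF has_derivative_cnj[OF smooth_deriv]])

lemma partial_inner: "partial b (\<lambda>x. complex_of_real (x \<bullet> u)) x = complex_of_real (b \<bullet> u)"
  by (rule partial_eq) (auto intro!: derivative_eq_intros)

lemma partial_inverse:
  "smooth f \<Longrightarrow> f x \<noteq> 0 \<Longrightarrow> partial b (\<lambda>x. inverse (f x)) x = - (inverse (f x) * partial b f x * inverse (f x))"
  by (rule partial_eq[OF Deriv.has_derivative_inverse[OF _ smooth_deriv]])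

lemma smooth_line_deriv:
  assumes "smooth f"
  shows "((\<lambda>s. f (x + s *\<^sub>R b)) has_vector_derivative partial b f (x + s *\<^sub>R b)) (at s)"
proof -
  have "((\<lambda>s. x + s *\<^sub>R b) has_derivative (\<lambda>h. h *\<^sub>R b)) (at s)" by (auto intro!: derivative_eq_intros)
  from has_derivative_compose[OF this smooth_deriv[OF assms]]
  have d: "((\<lambda>s. f (x + s *\<^sub>R b)) has_derivative (\<lambda>h. partial (h *\<^sub>R b) f (x + s *\<^sub>R b))) (at s)" .
  have "partial (h *\<^sub>R b) f y = h *\<^sub>R partial b f y" for h y
    using has_derivative_linear[OF smooth_deriv[OF assms]] linear_scale by blast
  then show ?thesis using d by (simp add: has_vector_derivative_def)
qed

lemma has_vector_derivative_quotient:
  assumes "(f has_vector_derivative d) (at x)"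
  shows "((\<lambda>s. (f (x + s) - f x) /\<^sub>R s) \<longlongrightarrow> d) (at 0)"
proof -
  have "((\<lambda>h. norm (f (x + h) - f x - h *\<^sub>R d) / norm h) \<longlongrightarrow> 0) (at 0)"
    using assms unfolding has_vector_derivative_def has_derivative_at by simp
  moreover have "\<forall>\<^sub>F h in at 0. norm (f (x + h) - f x - h *\<^sub>R d) / norm h = norm ((f (x + h) - f x) /\<^sub>R h - d)"
    unfolding eventually_at_filter
  proof (intro always_eventually allI impI)
    fix h :: real assume h: "h \<noteq> 0"
    have "(f (x + h) - f x) /\<^sub>R h - d = (f (x + h) - f x - h *\<^sub>R d) /\<^sub>R h"
      using h by (simp add: scaleR_diff_right)
    then show "norm (f (x + h) - f x - h *\<^sub>R d) / norm h = norm ((f (x + h) - f x) /\<^sub>R h - d)"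
      by (simp add: divide_inverse_commute)
  qed
  ultimately have "((\<lambda>h. norm ((f (x + h) - f x) /\<^sub>R h - d)) \<longlongrightarrow> 0) (at 0)"
    by (rule Lim_transform_eventually)
  then show ?thesis by (simp add: tendsto_norm_zero_iff LIM_zero_iff)
qed

text \<open>Translation invariance makes the integral of every difference quotient vanish, and
  dominated convergence passes to the derivative.\<close>

lemma integral_partial_zero:
  assumes \<phi>: "\<phi> \<in> test_functions \<Omega>" and b: "b \<in> Basis"
  shows "(LINT x|lebesgue. partial b \<phi> x) = 0"
proof -
  note sm = test_functions_smooth[OF \<phi>]
  have t': "partial b \<phi> \<in> test_functions \<Omega>" by (rule test_partial[OF \<phi> b])
  obtain K where K: "compact K" "K \<subseteq> \<Omega>" "\<And>x. x \<notin> K \<Longrightarrow> \<phi> x = 0" using test_functions_support[OF \<phi>] by blast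
  obtain B where B: "B \<ge> 0" "\<And>x. norm (partial b \<phi> x) \<le> B" using test_bounded[OF t'] by metis
  obtain R where R: "\<And>x. x \<in> K \<Longrightarrow> norm x \<le> R" using compact_imp_bounded[OF K(1)] bounded_iff by blast
  define h where "h n = 1 / real (Suc n)" for n
  have h: "h n > 0" "h n \<le> 1" for n by (simp_all add: h_def)
  have h0: "h \<longlonglongrightarrow> 0" unfolding h_def using LIMSEQ_Suc[OF lim_1_over_n] by simp
  let ?q = "\<lambda>n x. (\<phi> (x + h n *\<^sub>R b) - \<phi> x) /\<^sub>R h n"
  note mea = smooth_measurable(1)[OF sm]
  have tr: "lborel = distr lborel borel (\<lambda>x. x + h n *\<^sub>R b)" for n
    using lborel_distr_plus[of "h n *\<^sub>R b"] unfolding add.commute[of "h n *\<^sub>R b"] by (rule sym)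
  have int: "integrable lborel (\<lambda>x. \<phi> (x + h n *\<^sub>R b))" for n
  proof -
    have "integrable (distr lborel borel (\<lambda>x. x + h n *\<^sub>R b)) \<phi>" using test_integrable(1)[OF \<phi>] tr by simp
    then show ?thesis by (subst (asm) integrable_distr_eq) (use mea in auto)
  qed
  have zero: "(LINT x|lborel. ?q n x) = 0" for n
  proof -
    have "(LINT x|lborel. \<phi> x) = (LINT x|distr lborel borel (\<lambda>x. x + h n *\<^sub>R b). \<phi> x)" using tr by simp
    also have "\<dots> = (LINT x|lborel. \<phi> (x + h n *\<^sub>R b))" by (subst integral_distr) (use mea in auto)
    finally show ?thesis using int test_integrable(1)[OF \<phi>] by simp
  qed
  have "(\<lambda>n. LINT x|lborel. ?q n x) \<longlonglongrightarrow> (LINT x|lborel. partial b \<phi> x)"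
  proof (rule integral_dominated_convergence)
    show "partial b \<phi> \<in> borel_measurable lborel" by (rule smooth_measurable(1)[OF test_functions_smooth[OF t']])
    show "?q n \<in> borel_measurable lborel" for n using int test_integrable(1)[OF \<phi>]
      by (intro borel_measurable_integrable) auto
    \<comment> \<open>The radius grows by 1 because the translations have length
      \<open>h n \<le> 1\<close>; inside the ball the quotient is bounded by the supremum of the
      derivative.\<close>
    show "integrable lborel (\<lambda>x. B * indicator (cball 0 (R + 1)) x :: real)"
      by (intro integrable_mult_right integrable_real_indicator emeasure_bounded_finite) auto
    show "AE x in lborel. (\<lambda>n. ?q n x) \<longlonglongrightarrow> partial b \<phi> x"
    proof (intro AE_I2)
      fix x
      have "((\<lambda>s. \<phi> (x + s *\<^sub>R b)) has_vector_derivative partial b \<phi> x) (at 0)"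
        using smooth_line_deriv[OF sm, of x b 0] by simp
      then have "((\<lambda>s. (\<phi> (x + s *\<^sub>R b) - \<phi> x) /\<^sub>R s) \<longlongrightarrow> partial b \<phi> x) (at 0)"
        using has_vector_derivative_quotient[of "\<lambda>s. \<phi> (x + s *\<^sub>R b)" _ 0] by simp
      moreover have "filterlim h (at 0) sequentially"
        unfolding filterlim_at using h0 h(1) by (simp add: less_imp_neq[symmetric])
      ultimately show "(\<lambda>n. ?q n x) \<longlonglongrightarrow> partial b \<phi> x" by (rule filterlim_compose)
    qed
    show "AE x in lborel. norm (?q n x) \<le> B * indicator (cball 0 (R + 1)) x" for n
    proof (intro AE_I2)
      fix x
      show "norm (?q n x) \<le> B * indicator (cball 0 (R + 1)) x"
      proof (cases "norm x \<le> R + 1")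
        case True
        have "norm (\<phi> (x + h n *\<^sub>R b) - \<phi> (x + 0 *\<^sub>R b)) \<le> B * h n"
          by (rule norm_increment_le[OF less_imp_le[OF h(1)] smooth_line_deriv[OF sm] B(2)])
        then have "norm (\<phi> (x + h n *\<^sub>R b) - \<phi> x) / h n \<le> B" using h(1)[of n] by (simp add: pos_divide_le_eq)
        then show ?thesis using True h(1)[of n] by (simp add: divide_inverse_commute)
      next
        case False
        have "norm x \<le> norm (x + h n *\<^sub>R b) + norm (h n *\<^sub>R b)" by (metis add_diff_cancel norm_triangle_ineq4)
        then have "norm (x + h n *\<^sub>R b) > R" using False h[of n] b by simp
        then have "x + h n *\<^sub>R b \<notin> K" using R[of "x + h n *\<^sub>R b"] by linarith
        moreover have "x \<notin> K" using R[of x] False by linarith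
        ultimately show ?thesis using K(3) False by simp
      qed
    qed
  qed
  then have "(LINT x|lborel. partial b \<phi> x) = 0" unfolding zero using LIMSEQ_unique[OF _ tendsto_const] by metis
  then show ?thesis using smooth_measurable(1)[OF test_functions_smooth[OF t']] by (simp add: integral_completion)
qed

lemma test_integration_by_parts:
  assumes \<phi>: "\<phi> \<in> test_functions \<Omega>" and \<psi>: "smooth \<psi>" and b: "b \<in> Basis"
  shows "(LINT x|lebesgue. \<psi> x * partial b \<phi> x) = - (LINT x|lebesgue. partial b \<psi> x * \<phi> x)"
proof -
  note s = test_functions_smooth[OF \<phi>]
  have "(LINT x|lebesgue. partial b (\<lambda>x. \<psi> x * \<phi> x) x) = 0"
    by (rule integral_partial_zero[OF test_mult[OF \<phi> \<psi>] b])
  then have "(LINT x|lebesgue. \<psi> x * partial b \<phi> x + partial b \<psi> x * \<phi> x) = 0"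
    by (simp add: partial_mult s \<psi>)
  moreover have "integrable lebesgue (\<lambda>x. \<psi> x * partial b \<phi> x)" "integrable lebesgue (\<lambda>x. partial b \<psi> x * \<phi> x)"
    by (rule test_integrable(2)[OF test_mult[OF test_partial[OF \<phi> b] \<psi>]],
        rule test_integrable(2)[OF test_mult[OF \<phi> smooth_partial[OF \<psi> b]]])
  ultimately show ?thesis by (simp add: add_eq_0_iff2)
qed

section \<open>The Poincare inequality\<close>

lemma test_nonzero_in: "\<phi> \<in> test_functions \<Omega> \<Longrightarrow> \<phi> x \<noteq> 0 \<Longrightarrow> x \<in> \<Omega>"
  by (rule test_functions_support[of \<phi> \<Omega>]) auto

lemma test_norm_sq_integrable:
  assumes \<phi>: "\<phi> \<in> test_functions \<Omega>"
  shows "integrable lebesgue (\<lambda>x. (norm (\<phi> x))\<^sup>2)"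
proof -
  obtain K where K: "compact K" "K \<subseteq> \<Omega>" "\<And>x. x \<notin> K \<Longrightarrow> \<phi> x = 0" using test_functions_support[OF \<phi>] by blast
  show ?thesis
    by (rule integrable_compact_support(2)[OF _ K(1)])
      (intro continuous_on_power continuous_on_norm smooth_continuous test_functions_smooth[OF \<phi>], simp add: K(3))
qed

text \<open>Integrate by parts against the coordinate \<open>x \<bullet> b\<close>, whose derivative
  in direction \<open>b\<close> is 1 and which is bounded by \<open>R\<close> on \<Omega>: the
  integral of \<open>|\<phi>|^2\<close> becomes that of the coordinate times the derivative of
  \<open>|\<phi>|^2\<close>, up to sign.\<close>

lemma test_poincare:
  assumes \<phi>: "\<phi> \<in> test_functions \<Omega>" and R: "\<And>x. x \<in> \<Omega> \<Longrightarrow> norm x \<le> R" and b: "b \<in> Basis"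
  shows "(LINT x|lebesgue. (norm (\<phi> x))\<^sup>2) \<le> 4 * R\<^sup>2 * (LINT x|lebesgue. (norm (partial b \<phi> x))\<^sup>2)"
proof -
  note s = test_functions_smooth[OF \<phi>]
  let ?q = "\<lambda>x. cnj (\<phi> x) * \<phi> x" and ?p = "\<lambda>x. complex_of_real (x \<bullet> b)"
  have q: "?q \<in> test_functions \<Omega>" by (rule test_mult[OF \<phi> smooth_cnj[OF s]])
  have dq: "partial b ?q x = cnj (\<phi> x) * partial b \<phi> x + cnj (partial b \<phi> x) * \<phi> x" for x
    by (simp add: partial_mult smooth_cnj s partial_cnj)
  have "(LINT x|lebesgue. ?p x * partial b ?q x) = - (LINT x|lebesgue. partial b ?p x * ?q x)"
    by (rule test_integration_by_parts[OF q smooth_inner b])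
  also have "\<dots> = - (LINT x|lebesgue. complex_of_real ((norm (\<phi> x))\<^sup>2))"
    using b by (simp only: partial_inner complex_norm_square) (simp add: mult.commute)
  also have "\<dots> = - complex_of_real (LINT x|lebesgue. (norm (\<phi> x))\<^sup>2)"
    by (subst integral_complex_of_real) simp
  finally have "norm (LINT x|lebesgue. ?p x * partial b ?q x) = (LINT x|lebesgue. (norm (\<phi> x))\<^sup>2)"
    by (simp add: norm_minus_cancel)
  moreover have "norm (LINT x|lebesgue. ?p x * partial b ?q x) \<le> 
     (LINT x|lebesgue. 1/2 * (norm (\<phi> x))\<^sup>2 + 2 * R\<^sup>2 * (norm (partial b \<phi> x))\<^sup>2)"
  proof (rule order_trans[OF integral_norm_bound integral_mono])
    show "integrable lebesgue (\<lambda>x. norm (?p x * partial b ?q x))"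
      by (rule integrable_norm, rule test_integrable(2)[OF test_mult[OF test_partial[OF q b] smooth_inner]])
    show "integrable lebesgue (\<lambda>x. 1/2 * (norm (\<phi> x))\<^sup>2 + 2 * R\<^sup>2 * (norm (partial b \<phi> x))\<^sup>2)"
      by (intro Bochner_Integration.integrable_add integrable_mult_right test_norm_sq_integrable[OF \<phi>]
          test_norm_sq_integrable[OF test_partial[OF \<phi> b]])
    fix x
    show "norm (?p x * partial b ?q x) \<le> 1/2 * (norm (\<phi> x))\<^sup>2 + 2 * R\<^sup>2 * (norm (partial b \<phi> x))\<^sup>2"
    proof (cases "\<phi> x = 0")
      case True
      then show ?thesis by (simp add: dq)
    next
      case False
      then have "x \<in> \<Omega>" by (rule test_nonzero_in[OF \<phi>])
      then have R': "\<bar>x \<bullet> b\<bar> \<le> R" using R[of x] Basis_le_norm[OF b, of x] by linarith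
      have "norm (partial b ?q x) \<le> 2 * (norm (\<phi> x) * norm (partial b \<phi> x))"
        unfolding dq by (rule order_trans[OF norm_triangle_ineq]) (simp add: norm_mult)
      then have "norm (?p x * partial b ?q x) \<le> R * (2 * (norm (\<phi> x) * norm (partial b \<phi> x)))"
        unfolding norm_mult using R' by (intro mult_mono) auto
      \<comment> \<open>Young's inequality with the weights chosen so that half of the
        \<open>\<phi>\<close> term can be absorbed on the left; doubling the rest produces the
        constant \<open>4 * R^2\<close>.\<close>
      also have "\<dots> \<le> 1/2 * (norm (\<phi> x))\<^sup>2 + 2 * R\<^sup>2 * (norm (partial b \<phi> x))\<^sup>2"
        using zero_le_power2[of "norm (\<phi> x) - 2 * R * norm (partial b \<phi> x)"]
        by (simp add: power2_eq_square algebra_simps)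
      finally show ?thesis .
    qed
  qed
  ultimately have "(LINT x|lebesgue. (norm (\<phi> x))\<^sup>2) \<le> 
     1/2 * (LINT x|lebesgue. (norm (\<phi> x))\<^sup>2) + 2 * R\<^sup>2 * (LINT x|lebesgue. (norm (partial b \<phi> x))\<^sup>2)"
    by (simp add: test_norm_sq_integrable[OF \<phi>] test_norm_sq_integrable[OF test_partial[OF \<phi> b]])
  then show ?thesis by linarith
qed

section \<open>Gradients\<close>

text \<open>Gradients of complex functions are pairs of real vectors, so that they live in a Euclidean space.\<close>

definition cvec :: "('a::euclidean_space \<Rightarrow> complex) \<Rightarrow> 'a \<times> 'a" where
  "cvec c = (\<Sum>b\<in>Basis. Re (c b) *\<^sub>R b, \<Sum>b\<in>Basis. Im (c b) *\<^sub>R b)"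

definition ccomp :: "'a::euclidean_space \<Rightarrow> 'a \<times> 'a \<Rightarrow> complex" where
  "ccomp b g = Complex (fst g \<bullet> b) (snd g \<bullet> b)"

definition grad :: "('a::euclidean_space \<Rightarrow> complex) \<Rightarrow> 'a \<Rightarrow> 'a \<times> 'a" where
  "grad \<phi> x = cvec (\<lambda>b. partial b \<phi> x)"

lemma ccomp_cvec: "b \<in> Basis \<Longrightarrow> ccomp b (cvec c) = c b"
  by (simp add: ccomp_def cvec_def complex_eq_iff)

lemma ccomp_grad: "b \<in> Basis \<Longrightarrow> ccomp b (grad \<phi> x) = partial b \<phi> x"
  by (simp add: grad_def ccomp_cvec)

lemma ccomp_eqI:
  assumes "\<And>b. b \<in> Basis \<Longrightarrow> ccomp b g = ccomp b h"
  shows "g = h"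
proof (rule prod_eqI)
  show "fst g = fst h" "snd g = snd h"
    by (rule euclidean_eqI, use assms in \<open>simp add: ccomp_def\<close>)+
qed

lemma inner_eq_ccomp: "g \<bullet> g' = (\<Sum>b\<in>Basis. Re (ccomp b g * cnj (ccomp b g')))"
  unfolding inner_prod_def using euclidean_inner[of "fst g" "fst g'"] euclidean_inner[of "snd g" "snd g'"]
  by (simp add: ccomp_def sum.distrib)

lemma norm_eq_ccomp: "(norm g)\<^sup>2 = (\<Sum>b\<in>Basis. (norm (ccomp b g))\<^sup>2)"
  unfolding power2_norm_eq_inner[of g] inner_eq_ccomp
  by (simp add: cmod_power2) (simp add: power2_eq_square)

lemma norm_grad: "(norm (grad \<phi> x))\<^sup>2 = (\<Sum>b\<in>Basis. (norm (partial b \<phi> x))\<^sup>2)"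
  by (simp add: norm_eq_ccomp ccomp_grad)

lemma ccomp_add: "ccomp b (g + h) = ccomp b g + ccomp b h"
  by (simp add: ccomp_def inner_add_left complex_eq_iff)

lemma ccomp_diff: "ccomp b (g - h) = ccomp b g - ccomp b h"
  by (simp add: ccomp_def inner_diff_left complex_eq_iff)

lemma ccomp_scaleR: "ccomp b (c *\<^sub>R g) = c *\<^sub>R ccomp b g"
  by (simp add: ccomp_def complex_eq_iff)

lemma norm_ccomp_le: "b \<in> Basis \<Longrightarrow> norm (ccomp b g) \<le> norm g"
proof -
  assume b: "b \<in> Basis"
  have "(norm (ccomp b g))\<^sup>2 \<le> (norm g)\<^sup>2" unfolding norm_eq_ccomp by (rule member_le_sum[OF b]) auto
  then show ?thesis by (rule power2_le_imp_le) simp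
qed

lemma grad_add: "smooth f \<Longrightarrow> smooth g \<Longrightarrow> grad (\<lambda>x. f x + g x) x = grad f x + grad g x"
  by (rule ccomp_eqI) (simp add: ccomp_add ccomp_grad partial_add)

lemma grad_scaleR: "smooth f \<Longrightarrow> grad (\<lambda>x. complex_of_real c * f x) x = c *\<^sub>R grad f x"
  by (rule ccomp_eqI) (simp add: ccomp_scaleR ccomp_grad partial_cmult scaleR_conv_of_real)

lemma grad_continuous:
  assumes "smooth f"
  shows "continuous_on S (grad f)"
proof -
  have "continuous_on S (partial b f)" if "b \<in> Basis" for b
    by (rule smooth_continuous[OF smooth_partial[OF assms that]])
  then show ?thesis unfolding grad_def[abs_def] cvec_def by (intro continuous_intros)
qed

lemma grad_zero: 
  assumes "compact K" "\<And>x. x \<notin> K \<Longrightarrow> \<phi> x = 0" "x \<notin> K"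
  shows "grad \<phi> x = 0"
  by (simp add: grad_def cvec_def test_partial_zero[OF assms] zero_prod_def)

text \<open>Difference quotients are compared directly, so the gradient bound for a truncation
  follows from its contraction property and its derivative is never computed.\<close>

lemma lipschitz_partial_le:
  assumes f: "smooth f" and g: "smooth g" and le: "\<And>x y. norm (f x - f y) \<le> norm (g x - g y)"
  shows "norm (partial b f x) \<le> norm (partial b g x)"
proof (rule tendsto_le)
  show "((\<lambda>s. norm ((g (x + s *\<^sub>R b) - g x) /\<^sub>R s)) \<longlongrightarrow> norm (partial b g x)) (at 0)"
    using has_vector_derivative_quotient[OF smooth_line_deriv[OF g, of x b 0]] by (intro tendsto_norm) simp
  show "((\<lambda>s. norm ((f (x + s *\<^sub>R b) - f x) /\<^sub>R s)) \<longlongrightarrow> norm (partial b f x)) (at 0)"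
    using has_vector_derivative_quotient[OF smooth_line_deriv[OF f, of x b 0]] by (intro tendsto_norm) simp
  show "\<forall>\<^sub>F s in at 0. norm ((f (x + s *\<^sub>R b) - f x) /\<^sub>R s) \<le> norm ((g (x + s *\<^sub>R b) - g x) /\<^sub>R s)"
    by (intro always_eventually allI) (simp add: mult_left_mono le)
qed simp

text \<open>A smooth contraction approximating the truncation \<open>min (Re z) 1\<close>.\<close>

definition trunc :: "real \<Rightarrow> complex \<Rightarrow> complex" where
  "trunc e z = complex_of_real ((Re z - sqrt ((Re z - 1)\<^sup>2 + e) + sqrt (1 + e)) / 2)"

text \<open>Start from \<open>min a 1 = (a + 1 - |a - 1|) / 2\<close> and smooth the absolute value
  by a square root. Replacing the constant 1 by \<open>sqrt (1 + e)\<close> restores the value 0 at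
  0, so that truncating a test function keeps its support compact.\<close>

lemma trunc_zero: "trunc e 0 = 0"
  by (simp add: trunc_def)

lemma smooth_trunc:
  assumes e: "e > 0" and \<phi>: "smooth \<phi>"
  shows "smooth (\<lambda>x. trunc e (\<phi> x))"
proof -
  have re: "smooth (\<lambda>x. complex_of_real (Re (\<phi> x)))"
  proof -
    have "smooth (\<lambda>x. (1/2) * (\<phi> x + cnj (\<phi> x)))" by (intro smooth_mult smooth_const smooth_add smooth_cnj \<phi>)
    then show ?thesis by (simp add: complex_add_cnj)
  qed
  have "smooth (\<lambda>x. (complex_of_real (Re (\<phi> x)) - 1) * (complex_of_real (Re (\<phi> x)) - 1) + complex_of_real e)"
    by (intro smooth_add smooth_mult smooth_diff smooth_const re)
  then have "smooth (\<lambda>x. complex_of_real ((Re (\<phi> x) - 1)\<^sup>2 + e))" by (simp add: power2_eq_square)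
  then have "smooth (\<lambda>x. complex_of_real (sqrt ((Re (\<phi> x) - 1)\<^sup>2 + e)))"
    unfolding smooth_def using e by (intro allI C_k_sqrt) (auto intro: add_nonneg_pos)
  then have "smooth (\<lambda>x. (1/2) * (complex_of_real (Re (\<phi> x)) - complex_of_real (sqrt ((Re (\<phi> x) - 1)\<^sup>2 + e)) 
      + complex_of_real (sqrt (1 + e))))"
    by (intro smooth_mult smooth_add smooth_diff smooth_const re)
  then show ?thesis by (simp add: trunc_def[abs_def])
qed

text \<open>Reverse triangle inequality for the plane vectors \<open>(a, sqrt e)\<close> and
  \<open>(b, sqrt e)\<close>.\<close>

lemma sqrt_square_add_lipschitz:
  assumes "e \<ge> (0::real)"
  shows "\<bar>sqrt (a\<^sup>2 + e) - sqrt (b\<^sup>2 + e)\<bar> \<le> \<bar>a - b\<bar>"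
  using norm_triangle_ineq3[of "(a, sqrt e)" "(b, sqrt e)"] assms by (simp add: norm_Pair)

lemma trunc_lipschitz:
  assumes "e \<ge> 0"
  shows "norm (trunc e z - trunc e z') \<le> norm (z - z')"
proof -
  have "trunc e z - trunc e z' = complex_of_real ((Re z - Re z' - 
     (sqrt ((Re z - 1)\<^sup>2 + e) - sqrt ((Re z' - 1)\<^sup>2 + e))) / 2)"
    by (simp add: trunc_def diff_divide_distrib[symmetric])
  also have "norm \<dots> = \<bar>Re z - Re z' - (sqrt ((Re z - 1)\<^sup>2 + e) - sqrt ((Re z' - 1)\<^sup>2 + e))\<bar> / 2"
    by (simp only: norm_of_real) simp
  also have "\<dots> \<le> \<bar>Re z - Re z'\<bar>"
    using sqrt_square_add_lipschitz[OF assms, of "Re z - 1" "Re z' - 1"]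
      abs_triangle_ineq4[of "Re z - Re z'" "sqrt ((Re z - 1)\<^sup>2 + e) - sqrt ((Re z' - 1)\<^sup>2 + e)"] by simp
  also have "\<dots> \<le> norm (z - z')" using abs_Re_le_cmod[of "z - z'"] by simp
  finally show ?thesis .
qed

lemma norm_trunc_le: "e \<ge> 0 \<Longrightarrow> norm (trunc e z) \<le> norm z"
  using trunc_lipschitz[of e z 0] by (simp add: trunc_zero)

lemma trunc_at_0: "trunc 0 z = complex_of_real (min (Re z) 1)"
  by (simp add: trunc_def min_def field_simps)

lemma trunc_tendsto: "(e \<longlongrightarrow> 0) F \<Longrightarrow> ((\<lambda>n. trunc (e n) z) \<longlongrightarrow> trunc 0 z) F"
  unfolding trunc_def by (auto intro!: tendsto_eq_intros)

lemma norm_grad_trunc_le: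
  assumes "e > 0" "smooth \<phi>"
  shows "norm (grad (\<lambda>x. trunc e (\<phi> x)) x) \<le> norm (grad \<phi> x)"
proof -
  have "norm (partial b (\<lambda>x. trunc e (\<phi> x)) x) \<le> norm (partial b \<phi> x)" for b
    by (rule lipschitz_partial_le[OF smooth_trunc[OF assms] assms(2)]) (use assms(1) trunc_lipschitz in auto)
  then have "(norm (grad (\<lambda>x. trunc e (\<phi> x)) x))\<^sup>2 \<le> (norm (grad \<phi> x))\<^sup>2"
    unfolding norm_grad by (intro sum_mono power_mono) auto
  then show ?thesis by (rule power2_le_imp_le) simp
qed

text \<open>
  For \<open>s\<close> close to \<open>t\<close>, \<open>blend e s t\<close> is close to \<open>t\<close>; it plays the role of a truncation of \<open>t\<close> by
  \<open>s\<close> but is a smooth function of \<open>s\<close> and \<open>t\<close>.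
\<close>

definition blend :: "real \<Rightarrow> complex \<Rightarrow> complex \<Rightarrow> complex" where
  "blend e s t = 2 * (s * cnj s * t) * inverse (s * cnj s + t * cnj t + complex_of_real e)"

lemma blend_denominator: "s * cnj s + t * cnj t + complex_of_real e = complex_of_real ((norm s)\<^sup>2 + (norm t)\<^sup>2 + e)"
  by (simp only: of_real_add complex_norm_square)

lemma blend_denominator_pos: "e > 0 \<Longrightarrow> (norm s)\<^sup>2 + (norm t)\<^sup>2 + e > (0::real)"
  by (simp add: add_nonneg_pos)

lemma blend_denominator_nonzero: "e > 0 \<Longrightarrow> s * cnj s + t * cnj t + complex_of_real e \<noteq> 0"
  using blend_denominator_pos[of e s t] unfolding blend_denominator of_real_eq_0_iff by linarith

lemma norm_blend:
  "e > 0 \<Longrightarrow> norm (blend e s t) = 2 * ((norm s)\<^sup>2 * norm t) / ((norm s)\<^sup>2 + (norm t)\<^sup>2 + e)"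
  using blend_denominator_pos[of e s t] unfolding blend_def blend_denominator
  by (simp only: norm_mult norm_inverse norm_of_real) (simp add: power2_eq_square divide_inverse)

text \<open>From \<open>2 |s| |t| \<le> |s|^2 + |t|^2\<close>. With a fixed test function as
  \<open>s\<close>, this bounds all blends by one function of compact support, however large the
  other argument is.\<close>

lemma norm_blend_le1:
  assumes "e > 0" shows "norm (blend e s t) \<le> norm s"
proof -
  have "0 \<le> norm s * ((norm s - norm t)\<^sup>2 + e)" using assms by simp
  then have "2 * ((norm s)\<^sup>2 * norm t) \<le> norm s * ((norm s)\<^sup>2 + (norm t)\<^sup>2 + e)"
    by (simp add: power2_eq_square algebra_simps)
  then show ?thesis using blend_denominator_pos[OF assms, of s t] 
    by (simp add: norm_blend[OF assms] pos_divide_le_eq)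
qed

text \<open>With the limit function as \<open>t\<close>, this supplies a majorant that does not
  depend on the approximating test function \<open>s\<close>.\<close>

lemma norm_blend_le2:
  assumes "e > 0" shows "norm (blend e s t) \<le> 2 * norm t"
proof -
  have "0 \<le> 2 * norm t * ((norm t)\<^sup>2 + e)" using assms by simp
  then have "2 * ((norm s)\<^sup>2 * norm t) \<le> 2 * norm t * ((norm s)\<^sup>2 + (norm t)\<^sup>2 + e)"
    by (simp add: algebra_simps)
  then show ?thesis using blend_denominator_pos[OF assms, of s t] 
    by (simp add: norm_blend[OF assms] pos_divide_le_eq)
qed

lemma blend_tendsto_right:
  assumes "e > 0" "(t \<longlongrightarrow> u) F" 
  shows "((\<lambda>n. blend e s (t n)) \<longlongrightarrow> blend e s u) F"
  unfolding blend_def by (intro tendsto_intros assms blend_denominator_nonzero)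

text \<open>For \<open>t \<noteq> 0\<close> the limit is \<open>2 |t|^2 t / (2 |t|^2) = t\<close>,
  which explains the factor 2 in \<open>blend\<close>. For \<open>t = 0\<close> the limiting
  denominator vanishes, but the blend is constantly 0.\<close>

lemma blend_tendsto_diag:
  assumes e: "\<And>n. e n > 0" "e \<longlonglongrightarrow> 0" and s: "s \<longlonglongrightarrow> t"
  shows "(\<lambda>n. blend (e n) (s n) t) \<longlonglongrightarrow> t"
proof (cases "t = 0")
  case False
  have "(\<lambda>n. blend (e n) (s n) t) \<longlonglongrightarrow> 2 * (t * cnj t * t) * inverse (t * cnj t + t * cnj t + complex_of_real 0)"
    unfolding blend_def using False
    by (intro tendsto_intros e s) simp
  also have "2 * (t * cnj t * t) * inverse (t * cnj t + t * cnj t + complex_of_real 0) = t"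
    using False by (simp add: field_simps)
  finally show ?thesis .
qed (simp add: blend_def)

lemma smooth_blend:
  assumes "e > 0" "smooth f" "smooth g"
  shows "smooth (\<lambda>x. blend e (f x) (g x))"
  unfolding blend_def
  by (intro smooth_mult smooth_add smooth_cnj smooth_const smooth_inverse assms blend_denominator_nonzero)

text \<open>Apart from \<open>e\<close> the blend is homogeneous of degree one, so its derivatives
  are bounded independently of \<open>s\<close>, \<open>t\<close> and \<open>e\<close>. With
  \<open>?d\<close> the modulus of the denominator, both parts of the quotient rule are at most
  \<open>norm p + norm q\<close>: the first since \<open>2 |s| |t|\<close> and \<open>|s|^2\<close>
  are at most \<open>?d\<close>, the second by using these bounds twice. Two parts and the leading
  factor 2 give 4.\<close>

lemma norm_partial_blend_le:
  assumes e: "e > 0" and f: "smooth f" and g: "smooth g"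
  shows "norm (partial b (\<lambda>x. blend e (f x) (g x)) x) \<le> 4 * (norm (partial b f x) + norm (partial b g x))"
proof -
  define s t where "s = f x" and "t = g x"
  define p q where "p = partial b f x" and "q = partial b g x"
  let ?D = "\<lambda>x. f x * cnj (f x) + g x * cnj (g x) + complex_of_real e" 
  let ?N = "\<lambda>x. f x * cnj (f x) * g x"
  let ?d = "(norm s)\<^sup>2 + (norm t)\<^sup>2 + e"
  have d: "?d > 0" by (rule blend_denominator_pos[OF e])
  have D: "?D y \<noteq> 0" for y by (rule blend_denominator_nonzero[OF e])
  have sN: "smooth ?N" and sD: "smooth ?D" by (intro smooth_mult smooth_add smooth_cnj smooth_const f g)+
  have N': "partial b ?N x = s * cnj s * q + (s * cnj p + p * cnj s) * t"
    by (simp add: partial_mult partial_cnj smooth_mult smooth_cnj f g s_def t_def p_def q_def)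
  have D': "partial b ?D x = s * cnj p + p * cnj s + (t * cnj q + q * cnj t)"
  proof -
    have "partial b (\<lambda>x. complex_of_real e) x = 0" by (rule partial_eq) simp
    then show ?thesis
      by (simp add: partial_add partial_mult partial_cnj smooth_mult smooth_add smooth_const smooth_cnj f g s_def t_def p_def q_def)
  qed
  have "partial b (\<lambda>x. blend e (f x) (g x)) x = partial b (\<lambda>x. 2 * (?N x * inverse (?D x))) x"
    by (simp add: blend_def mult.assoc)
  also have "\<dots> = 2 * (?N x * (- (inverse (?D x) * partial b ?D x * inverse (?D x))) + partial b ?N x * inverse (?D x))"
    by (simp only: partial_cmult partial_mult partial_inverse sN sD D smooth_inverse smooth_mult not_False_eq_True)
  finally have eq: "partial b (\<lambda>x. blend e (f x) (g x)) x =
     2 * (partial b ?N x * inverse (?D x) - ?N x * (inverse (?D x) * partial b ?D x * inverse (?D x)))" by simp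
  have nD: "norm (inverse (?D x)) = inverse ?d"
    using d unfolding blend_denominator by (simp only: norm_inverse norm_of_real) (simp add: s_def t_def)
  have nN': "norm (partial b ?N x) \<le> (norm s)\<^sup>2 * norm q + 2 * norm s * norm t * norm p"
  proof -
    have "norm (partial b ?N x) \<le> norm (s * cnj s * q) + norm ((s * cnj p + p * cnj s) * t)"
      unfolding N' by (rule norm_triangle_ineq)
    also have "norm ((s * cnj p + p * cnj s) * t) \<le> (norm (s * cnj p) + norm (p * cnj s)) * norm t"
      unfolding norm_mult[of _ t] by (intro mult_right_mono norm_triangle_ineq) simp
    finally show ?thesis by (simp add: norm_mult power2_eq_square algebra_simps)
  qed
  have nD': "norm (partial b ?D x) \<le> 2 * norm s * norm p + 2 * norm t * norm q"
  proof -
    have "norm (partial b ?D x) \<le> (norm (s * cnj p) + norm (p * cnj s)) + (norm (t * cnj q) + norm (q * cnj t))"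
      unfolding D' by (intro order_trans[OF norm_triangle_ineq] add_mono norm_triangle_ineq)
    then show ?thesis by (simp add: norm_mult algebra_simps)
  qed
  have nN: "norm (?N x) = (norm s)\<^sup>2 * norm t" by (simp add: norm_mult power2_eq_square s_def t_def)
  have 1: "norm (partial b ?N x * inverse (?D x)) \<le> norm p + norm q"
  proof -
    have "0 \<le> (norm s - norm t)\<^sup>2" by simp
    then have st: "2 * norm s * norm t \<le> ?d" using e by (simp add: power2_eq_square algebra_simps)
    have ss: "(norm s)\<^sup>2 \<le> ?d" using e by simp
    have "norm (partial b ?N x) \<le> ?d * norm q + ?d * norm p"
      using nN' mult_right_mono[OF st, of "norm p"] mult_right_mono[OF ss, of "norm q"] by simp
    then show ?thesis using d unfolding norm_mult nD
      by (simp add: divide_inverse[symmetric] pos_divide_le_eq algebra_simps)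
  qed
  have 2: "norm (?N x * (inverse (?D x) * partial b ?D x * inverse (?D x))) \<le> norm p + norm q"
  proof -
    have "0 \<le> (norm s - norm t)\<^sup>2" by simp
    then have st: "2 * norm s * norm t \<le> ?d" using e by (simp add: power2_eq_square algebra_simps)
    have ss: "(norm s)\<^sup>2 \<le> ?d" using e by simp
    have "norm (?N x) * norm (partial b ?D x) \<le> ((norm s)\<^sup>2 * norm t) * (2 * norm s * norm p + 2 * norm t * norm q)"
      unfolding nN by (intro mult_left_mono nD') simp
    also have "\<dots> = (norm s)\<^sup>2 * (2 * norm s * norm t) * norm p + (2 * norm s * norm t) * (2 * norm s * norm t) / 2 * norm q"
      by (simp add: power2_eq_square algebra_simps)
    also have "\<dots> \<le> ?d * ?d * norm p + ?d * ?d / 2 * norm q"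
      using st ss d by (intro add_mono mult_right_mono mult_mono divide_right_mono) auto
    also have "\<dots> \<le> ?d * ?d * norm p + ?d * ?d * norm q"
      using d by (intro add_left_mono mult_right_mono) auto
    finally have "norm (?N x) * norm (partial b ?D x) \<le> ?d * ?d * (norm p + norm q)" by (simp add: algebra_simps)
    then have "norm (?N x) * norm (partial b ?D x) / (?d * ?d) \<le> norm p + norm q"
      using d by (simp add: pos_divide_le_eq mult.commute)
    then show ?thesis unfolding norm_mult nD by (simp add: divide_inverse mult_ac)
  qed
  have "norm (partial b (\<lambda>x. blend e (f x) (g x)) x) \<le> 2 * ((norm p + norm q) + (norm p + norm q))"
    unfolding eq norm_mult[of 2] norm_numeral
    by (rule mult_left_mono[OF order_trans[OF norm_triangle_ineq4 add_mono[OF 1 2]]]) simp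
  then show ?thesis by (simp add: p_def q_def)
qed

lemma norm_grad_blend_le:
  assumes e: "e > 0" and f: "smooth f" and g: "smooth g"
  shows "(norm (grad (\<lambda>x. blend e (f x) (g x)) x))\<^sup>2 \<le> 32 * ((norm (grad f x))\<^sup>2 + (norm (grad g x))\<^sup>2)"
proof -
  have "(norm (partial b (\<lambda>x. blend e (f x) (g x)) x))\<^sup>2 \<le> 32 * ((norm (partial b f x))\<^sup>2 + (norm (partial b g x))\<^sup>2)" for b
  proof -
    have "(norm (partial b (\<lambda>x. blend e (f x) (g x)) x))\<^sup>2 \<le> (4 * (norm (partial b f x) + norm (partial b g x)))\<^sup>2"
      by (intro power_mono norm_partial_blend_le assms) simp
    \<comment> \<open>The constant is \<open>2 * 4^2\<close>, from
      \<open>(a + b)^2 \<le> 2 a^2 + 2 b^2\<close>.\<close>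
    also have "\<dots> \<le> 32 * ((norm (partial b f x))\<^sup>2 + (norm (partial b g x))\<^sup>2)"
      using zero_le_power2[of "norm (partial b f x) - norm (partial b g x)"]
      by (simp add: power2_eq_square algebra_simps)
    finally show ?thesis .
  qed
  then show ?thesis unfolding norm_grad sum.distrib[symmetric] sum_distrib_left by (intro sum_mono) 
qed

section \<open>The fundamental lemma of the calculus of variations\<close>

text \<open>Open boxes form an intersection-stable generator of the Borel sets, so vanishing box
  integrals extend to all Borel sets by induction over the generated sigma-algebra;
  \<open>tot\<close> is what the step to complements uses. Integrating over the sets where
  \<open>h\<close> or \<open>- h\<close> is positive then gives the claim.\<close>

lemma AE_zero_if_box_integrals_zero_borel:
  fixes h :: "'a::euclidean_space \<Rightarrow> real"
  assumes h: "integrable lborel h" and box: "\<And>a b. (LINT x:box a b|lborel. h x) = 0" and tot: "(LINT x|lborel. h x) = 0"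
  shows "AE x in lborel. h x = 0"
proof -
  have meas [measurable]: "h \<in> borel_measurable borel" using h by auto
  have si: "set_integrable lborel A h" if "A \<in> sets borel" for A
    using that h unfolding set_integrable_def by (intro integrable_mult_indicator) auto
  let ?G = "range (\<lambda>(a, b). box a b :: 'a set)"
  have zero: "(LINT x:A|lborel. h x) = 0" if "A \<in> sets borel" for A
  proof -
    have A: "A \<in> sigma_sets UNIV ?G" using that unfolding borel_eq_box by (simp add: sets_measure_of)
    have "Int_stable ?G"
    proof (rule Int_stableI)
      fix A B assume "A \<in> ?G" "B \<in> ?G"
      then obtain a b c d where "A = box a b" "B = box c d" by auto
      then have "A \<inter> B = box (\<Sum>i\<in>Basis. max (a \<bullet> i) (c \<bullet> i) *\<^sub>R i) (\<Sum>i\<in>Basis. min (b \<bullet> i) (d \<bullet> i) *\<^sub>R i)"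
        by (auto simp: mem_box)
      then show "A \<inter> B \<in> ?G" by auto
    qed
    moreover have "?G \<subseteq> Pow UNIV" by blast
    ultimately show ?thesis using A
    proof (induction rule: sigma_sets_induct_disjoint)
      case (basic A)
      then show ?case using box by auto
    next
      case (compl A)
      then have A: "A \<in> sets borel" unfolding borel_eq_box by (simp add: sets_measure_of)
      have "(LINT x:A \<union> (UNIV - A)|lborel. h x) = (LINT x:A|lborel. h x) + (LINT x:UNIV - A|lborel. h x)"
        by (rule set_integral_Un) (use A si in auto)
      moreover have "(LINT x:A \<union> (UNIV - A)|lborel. h x) = 0" using tot by (simp add: set_lebesgue_integral_def)
      ultimately show ?case using compl by simp
    next
      case (union A)
      then have A: "A i \<in> sets borel" for i unfolding borel_eq_box by (auto simp: sets_measure_of)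
      have "(LINT x:(\<Union>i. A i)|lborel. h x) = (\<Sum>i. (LINT x:A i|lborel. h x))"
        by (rule lebesgue_integral_countable_add) (use A union(1) si in \<open>auto simp: disjoint_family_on_def\<close>)
      then show ?case using union by simp
    qed (auto simp: set_lebesgue_integral_def)
  qed
  have *: "AE x in lborel. g x \<le> 0" if "g \<in> borel_measurable borel" "integrable lborel g" "\<And>A. A \<in> sets borel \<Longrightarrow> (LINT x:A|lborel. g x) = 0" for g :: "'a \<Rightarrow> real"
  proof -
    let ?A = "{x. g x > 0}"
    have A: "?A \<in> sets borel" using that(1) by measurable
    have "integrable lborel (\<lambda>x. indicator ?A x *\<^sub>R g x)" by (rule integrable_mult_indicator) (use A that in auto)
    moreover have "AE x in lborel. 0 \<le> indicator ?A x *\<^sub>R g x" by (auto simp: indicator_def)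
    moreover have "(LINT x|lborel. indicator ?A x *\<^sub>R g x) = 0" using that(3)[OF A] by (simp add: set_lebesgue_integral_def)
    ultimately have "AE x in lborel. indicator ?A x *\<^sub>R g x = 0" using integral_nonneg_eq_0_iff_AE by blast
    then show ?thesis by eventually_elim (auto simp: indicator_def split: if_splits)
  qed
  have "AE x in lborel. h x \<le> 0" by (rule *[OF meas h zero])
  moreover have "AE x in lborel. - h x \<le> 0"
  proof (rule *)
    show "(LINT x:A|lborel. - h x) = 0" if "A \<in> sets borel" for A
      using zero[OF that] by (simp add: set_lebesgue_integral_def)
  qed (use h in auto)
  ultimately show ?thesis by eventually_elim simp
qed

text \<open>Replaces \<open>h\<close> by a Borel function that agrees with it almost everywhere, for
  which the argument over the Borel sigma-algebra is available.\<close>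

lemma AE_zero_if_box_integrals_zero:
  fixes h :: "'a::euclidean_space \<Rightarrow> real"
  assumes h: "integrable lebesgue h" and box: "\<And>a b. (LINT x|lebesgue. indicator (box a b) x *\<^sub>R h x) = 0" 
    and tot: "(LINT x|lebesgue. h x) = 0"
  shows "AE x in lebesgue. h x = 0"
proof -
  obtain h' where h' [measurable]: "h' \<in> borel_measurable lborel" and eq: "AE x in lborel. h x = h' x"
    using completion_ex_borel_measurable_real[OF borel_measurable_integrable[OF h]] by blast
  have eqc: "AE x in lebesgue. h x = h' x" using eq by (rule AE_completion)
  have hm: "h' \<in> borel_measurable lebesgue" using h' by (rule measurable_completion)
  have hl: "h \<in> borel_measurable lebesgue" using h by auto
  have i: "integrable lborel h'"
  proof -
    have "integrable lebesgue h'" using h integrable_cong_AE[OF hl hm eqc] by simp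
    then show ?thesis using h' by (simp add: integrable_completion)
  qed
  have "AE x in lborel. h' x = 0"
  proof (rule AE_zero_if_box_integrals_zero_borel[OF i])
    fix a b
    have "(LINT x|lebesgue. indicator (box a b) x *\<^sub>R h' x) = (LINT x|lebesgue. indicator (box a b) x *\<^sub>R h x)"
      by (rule integral_cong_AE) (use eqc hm hl in \<open>auto intro!: borel_measurable_times borel_measurable_indicator\<close>)
    moreover have "(LINT x|lebesgue. indicator (box a b) x *\<^sub>R h' x) = (LINT x|lborel. indicator (box a b) x *\<^sub>R h' x)"
      by (rule integral_completion) measurable
    ultimately show "(LINT x:box a b|lborel. h' x) = 0" using box by (simp add: set_lebesgue_integral_def)
  next
    have "(LINT x|lebesgue. h' x) = (LINT x|lebesgue. h x)"
      by (rule integral_cong_AE) (use eqc hm hl in auto)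
    then show "(LINT x|lborel. h' x) = 0" using tot integral_completion[OF h'] by simp
  qed
  then have "AE x in lebesgue. h' x = 0" by (rule AE_completion)
  with eqc show ?thesis by eventually_elim simp
qed

text \<open>In each coordinate this is \<open>exp (- c / (x - a)) * exp (- c / (b - x))\<close>
  between \<open>a\<close> and \<open>b\<close>, and 0 elsewhere. As \<open>c\<close> tends to 0 it
  tends to the indicator of the open box.\<close>

definition box_bump :: "real \<Rightarrow> 'a::euclidean_space \<Rightarrow> 'a \<Rightarrow> 'a \<Rightarrow> complex" where
  "box_bump c a b x = (\<Prod>i\<in>Basis. complex_of_real (flat_exp c 0 (x \<bullet> i + - (a \<bullet> i))) * 
     complex_of_real (flat_exp c 0 (x \<bullet> (- i) + b \<bullet> i)))"

lemma flat_exp_bounds: "c > 0 \<Longrightarrow> 0 \<le> flat_exp c 0 t" "c > 0 \<Longrightarrow> flat_exp c 0 t \<le> 1"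
  by (auto simp: flat_exp_def)

lemma box_bump_outside:
  assumes "x \<notin> box a b"
  shows "box_bump c a b x = 0"
proof -
  obtain i where "i \<in> Basis" "\<not> (a \<bullet> i < x \<bullet> i \<and> x \<bullet> i < b \<bullet> i)" using assms by (auto simp: mem_box)
  then show ?thesis unfolding box_bump_def by (intro prod_zero) (auto simp: flat_exp_def intro!: bexI[of _ i])
qed

lemma box_bump_test:
  assumes "c > 0" "cbox a b \<subseteq> \<Omega>"
  shows "box_bump c a b \<in> test_functions \<Omega>"
proof (rule test_functionsI[OF _ compact_cbox assms(2)])
  show "smooth (box_bump c a b)"
    unfolding box_bump_def[abs_def] smooth_def using assms(1) by (intro allI C_k_prod C_k_mult C_k_flat_exp) auto
  show "x \<notin> cbox a b \<Longrightarrow> box_bump c a b x = 0" for x using box_bump_outside box_subset_cbox by blast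
qed

lemma norm_box_bump_le:
  assumes "c > 0"
  shows "norm (box_bump c a b x) \<le> 1"
  unfolding box_bump_def prod_norm[symmetric] norm_mult norm_of_real
  using flat_exp_bounds[OF assms] by (intro prod_le_1) (auto intro!: mult_le_one)

lemma box_bump_tendsto:
  "(\<lambda>n. box_bump (1 / real (Suc n)) a b x) \<longlonglongrightarrow> indicator (box a b) x"
proof (cases "x \<in> box a b")
  case True
  have one: "(\<lambda>n. complex_of_real (flat_exp (1 / real (Suc n)) 0 t)) \<longlonglongrightarrow> 1" if t: "t > 0" for t
  proof -
    have "(\<lambda>n. complex_of_real (exp (- (1 / real (Suc n) * inverse t)))) \<longlonglongrightarrow> complex_of_real (exp (- (0 * inverse t)))"
      by (intro tendsto_intros LIMSEQ_Suc[OF lim_1_over_n])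
    then show ?thesis using t by (simp add: flat_exp_def)
  qed
  have "(\<lambda>n. box_bump (1 / real (Suc n)) a b x) \<longlonglongrightarrow> (\<Prod>i\<in>(Basis::'a set). 1 * 1)"
    unfolding box_bump_def
    by (intro tendsto_prod tendsto_mult one) (use True in \<open>auto simp: mem_box\<close>)
  then show ?thesis using True by simp
qed (simp add: box_bump_outside)

lemma AE_lebesgue_on_iff:
  "open \<Omega> \<Longrightarrow> (AE x in lebesgue_on \<Omega>. P x) \<longleftrightarrow> (AE x in lebesgue. x \<in> \<Omega> \<longrightarrow> P x)"
  by (rule AE_restrict_space_iff) auto

text \<open>The bumps are bounded by 1 and live in the box, so \<open>g\<close> restricted to the
  closed box dominates; integrability on that box is all the argument uses of the size of
  \<open>g\<close>.\<close>

lemma box_integral_zero_if_test_integrals_zero: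
  fixes g :: "'a::euclidean_space \<Rightarrow> complex"
  assumes \<Omega>: "open \<Omega>" and g: "integrable lebesgue (\<lambda>x. indicator (cbox a b) x *\<^sub>R g x)" and ab: "cbox a b \<subseteq> \<Omega>"
    and zero: "\<And>\<phi>. \<phi> \<in> test_functions \<Omega> \<Longrightarrow> (LINT x|lebesgue_on \<Omega>. g x * \<phi> x) = 0"
  shows "(LINT x|lebesgue. indicator (box a b) x *\<^sub>R g x) = 0"
proof -
  let ?\<phi> = "\<lambda>n. box_bump (1 / real (Suc n)) a b" and ?g = "\<lambda>x. indicator (cbox a b) x *\<^sub>R g x"
  have t: "?\<phi> n \<in> test_functions \<Omega>" for n by (rule box_bump_test[OF _ ab]) simp
  have z: "(LINT x|lebesgue. ?g x * ?\<phi> n x) = 0" for n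
  proof -
    have "(LINT x|lebesgue_on \<Omega>. g x * ?\<phi> n x) = (LINT x|lebesgue. indicator \<Omega> x *\<^sub>R (g x * ?\<phi> n x))"
      by (rule integral_restrict_space) (use \<Omega> in simp)
    also have "(\<lambda>x. indicator \<Omega> x *\<^sub>R (g x * ?\<phi> n x)) = (\<lambda>x. ?g x * ?\<phi> n x)"
    proof
      fix x
      show "indicator \<Omega> x *\<^sub>R (g x * ?\<phi> n x) = ?g x * ?\<phi> n x"
        using ab box_subset_cbox[of a b] box_bump_outside[of x a b "1 / real (Suc n)"]
        by (cases "x \<in> box a b") (auto simp: indicator_def)
    qed
    finally show ?thesis using zero[OF t] by simp
  qed
  have "(\<lambda>n. LINT x|lebesgue. ?g x * ?\<phi> n x) \<longlonglongrightarrow> (LINT x|lebesgue. ?g x * indicator (box a b) x)"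
  proof (rule integral_dominated_convergence)
    show "integrable lebesgue (\<lambda>x. norm (?g x))" using g by (rule integrable_norm)
    have gm: "?g \<in> borel_measurable lebesgue" using g by auto
    show "(\<lambda>x. ?g x * indicator (box a b) x) \<in> borel_measurable lebesgue"
      by (intro borel_measurable_times gm borel_measurable_indicator) auto
    show "(\<lambda>x. ?g x * ?\<phi> n x) \<in> borel_measurable lebesgue" for n
      by (intro borel_measurable_times gm smooth_measurable(2)[OF test_functions_smooth[OF t]])
    show "AE x in lebesgue. (\<lambda>n. ?g x * ?\<phi> n x) \<longlonglongrightarrow> ?g x * indicator (box a b) x"
      by (intro AE_I2 tendsto_mult tendsto_const box_bump_tendsto)
    show "AE x in lebesgue. norm (?g x * ?\<phi> n x) \<le> norm (?g x)" for n
      unfolding norm_mult[of _ "?\<phi> n _"] by (intro AE_I2 mult_left_le norm_box_bump_le) auto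
  qed
  then have "(LINT x|lebesgue. ?g x * indicator (box a b) x) = 0" 
    unfolding z using LIMSEQ_unique[OF _ tendsto_const] by metis
  moreover have "(\<lambda>x. ?g x * indicator (box a b) x) = (\<lambda>x. indicator (box a b) x *\<^sub>R g x)"
    using box_subset_cbox[of a b] by (auto simp: fun_eq_iff split: split_indicator)
  ultimately show ?thesis by simp
qed

text \<open>Works box by box inside \<Omega>, where \<open>g\<close> is integrable, and covers
  \<Omega> by countably many such boxes. Only local integrability is assumed, because the lemma will
  be applied to a function divided by \<open>m\<close>.\<close>

lemma AE_zero_if_test_integrals_zero:
  fixes g :: "'a::euclidean_space \<Rightarrow> complex"
  assumes \<Omega>: "open \<Omega>" and g: "\<And>a b. cbox a b \<subseteq> \<Omega> \<Longrightarrow> integrable lebesgue (\<lambda>x. indicator (cbox a b) x *\<^sub>R g x)"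
    and zero: "\<And>\<phi>. \<phi> \<in> test_functions \<Omega> \<Longrightarrow> (LINT x|lebesgue_on \<Omega>. g x * \<phi> x) = 0"
  shows "AE x in lebesgue_on \<Omega>. g x = 0"
proof -
  have cb: "AE x in lebesgue. x \<in> cbox a b \<longrightarrow> g x = 0" if ab: "cbox a b \<subseteq> \<Omega>" for a b
  proof -
    let ?g = "\<lambda>x. indicator (box a b) x *\<^sub>R g x"
    have gi: "integrable lebesgue ?g"
    proof -
      have "integrable lebesgue (\<lambda>x. indicator (box a b) x *\<^sub>R (indicator (cbox a b) x *\<^sub>R g x))"
        by (rule integrable_mult_indicator[OF _ g[OF ab]]) auto
      moreover have "(\<lambda>x. indicator (box a b) x *\<^sub>R (indicator (cbox a b) x *\<^sub>R g x)) = ?g"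
        using box_subset_cbox[of a b] by (auto simp: fun_eq_iff split: split_indicator)
      ultimately show ?thesis by simp
    qed
    have z: "(LINT x|lebesgue. indicator (box c d) x *\<^sub>R ?g x) = 0" for c d
    proof -
      let ?e = "\<Sum>i\<in>Basis. max (a \<bullet> i) (c \<bullet> i) *\<^sub>R i" and ?f = "\<Sum>i\<in>Basis. min (b \<bullet> i) (d \<bullet> i) *\<^sub>R i"
      have 1: "box a b \<inter> box c d = box ?e ?f" and 2: "cbox ?e ?f \<subseteq> cbox a b" by (auto simp: mem_box)
      have "(\<lambda>x. indicator (box c d) x *\<^sub>R ?g x) = (\<lambda>x. indicator (box ?e ?f) x *\<^sub>R g x)"
        unfolding 1[symmetric] by (auto simp: indicator_def)
      then show ?thesis
        using box_integral_zero_if_test_integrals_zero[OF \<Omega> g _ zero, of ?e ?f] 2 ab by simp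
    qed
    have tot: "(LINT x|lebesgue. ?g x) = 0"
      by (rule box_integral_zero_if_test_integrals_zero[OF \<Omega> g[OF ab] ab zero])
    have "AE x in lebesgue. Re (?g x) = 0"
    proof (rule AE_zero_if_box_integrals_zero)
      show "(LINT x|lebesgue. Re (?g x)) = 0" using integral_Re[OF gi] tot by simp
      show "(LINT x|lebesgue. indicator (box c d) x *\<^sub>R Re (?g x)) = 0" for c d
        using integral_Re[OF integrable_mult_indicator[OF _ gi], of "box c d"] z[of c d] by (simp add: mult.assoc)
    qed (use integrable_bounded_linear[OF bounded_linear_Re gi] in simp)
    moreover have "AE x in lebesgue. Im (?g x) = 0"
    proof (rule AE_zero_if_box_integrals_zero)
      show "(LINT x|lebesgue. Im (?g x)) = 0" using integral_Im[OF gi] tot by simp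
      show "(LINT x|lebesgue. indicator (box c d) x *\<^sub>R Im (?g x)) = 0" for c d
        using integral_Im[OF integrable_mult_indicator[OF _ gi], of "box c d"] z[of c d] by (simp add: mult.assoc)
    qed (use integrable_bounded_linear[OF bounded_linear_Im gi] in simp)
    \<comment> \<open>The integrals above only see the open box; its frontier is a null set.\<close>
    moreover have "AE x in lebesgue. x \<notin> cbox a b - box a b"
      using negligible_frontier_interval[of a b] by (intro AE_not_in) (simp add: negligible_iff_null_sets)
    ultimately show ?thesis
      by eventually_elim (auto simp: indicator_def complex_eq_iff)
  qed
  obtain D where D: "countable D" "D \<subseteq> Pow \<Omega>" "\<And>X. X \<in> D \<Longrightarrow> \<exists>a b. X = cbox a b" "\<Union>D = \<Omega>"
    using open_countable_Union_open_cbox[OF \<Omega>] by metis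
  have "AE x in lebesgue. x \<in> X \<longrightarrow> g x = 0" if X: "X \<in> D" for X
  proof -
    obtain a b where "X = cbox a b" using D(3)[OF X] by blast
    moreover have "X \<subseteq> \<Omega>" using D(2) X by blast
    ultimately show ?thesis using cb by simp
  qed
  then have "AE x in lebesgue. \<forall>X\<in>D. x \<in> X \<longrightarrow> g x = 0" by (intro AE_ball_countable' D(1))
  then have "AE x in lebesgue. x \<in> \<Omega> \<longrightarrow> g x = 0"
    by eventually_elim (use D(4) in blast)
  then show ?thesis using AE_lebesgue_on_iff[OF \<Omega>] by blast
qed

section \<open>The Hilbert space of square integrable functions\<close>

lemma L2_D: "f \<in> L2 M \<Longrightarrow> f \<in> borel_measurable M" "f \<in> L2 M \<Longrightarrow> integrable M (\<lambda>x. (norm (f x))\<^sup>2)"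
  by (auto simp: L2_def)

lemma L2_dominated:
  fixes f :: "'a \<Rightarrow> 'b::euclidean_space" and g :: "'a \<Rightarrow> 'c::real_normed_vector"
  assumes f [measurable]: "f \<in> borel_measurable M" and g: "g \<in> L2 M" and le: "AE x in M. norm (f x) \<le> c * norm (g x)"
  shows "f \<in> L2 M"
proof -
  have "integrable M (\<lambda>x. (norm (f x))\<^sup>2)"
  proof (rule Bochner_Integration.integrable_bound)
    show "integrable M (\<lambda>x. c\<^sup>2 * (norm (g x))\<^sup>2)" by (intro integrable_mult_right L2_D(2) g)
    show "(\<lambda>x. (norm (f x))\<^sup>2) \<in> borel_measurable M"
      by measurable
    show "AE x in M. norm ((norm (f x))\<^sup>2) \<le> norm (c\<^sup>2 * (norm (g x))\<^sup>2)"
      using le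
    proof eventually_elim
      case (elim x)
      have "(norm (f x))\<^sup>2 \<le> (c * norm (g x))\<^sup>2" by (intro power_mono elim) simp
      then show ?case by (simp add: power_mult_distrib)
    qed
  qed
  then show ?thesis using f by (simp add: L2_def)
qed

lemma L2_zero: "(\<lambda>x. 0) \<in> L2 M"
  by (simp add: L2_def)

lemma L2_scaleR:
  fixes f :: "'a \<Rightarrow> 'b::euclidean_space"
  assumes "f \<in> L2 M"
  shows "(\<lambda>x. c *\<^sub>R f x) \<in> L2 M"
  by (rule L2_dominated[OF borel_measurable_scaleR[OF _ L2_D(1)[OF assms]] assms, of _ "\<bar>c\<bar>"]) simp_all

lemma L2_minus:
  fixes f :: "'a \<Rightarrow> 'b::euclidean_space"
  shows "f \<in> L2 M \<Longrightarrow> (\<lambda>x. - f x) \<in> L2 M"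
  using L2_scaleR[of f M "-1"] by simp

lemma L2_add:
  fixes f g :: "'a \<Rightarrow> 'b::euclidean_space"
  assumes f: "f \<in> L2 M" and g: "g \<in> L2 M"
  shows "(\<lambda>x. f x + g x) \<in> L2 M"
proof -
  have "integrable M (\<lambda>x. (norm (f x + g x))\<^sup>2)"
  proof (rule Bochner_Integration.integrable_bound)
    show "integrable M (\<lambda>x. 2 * (norm (f x))\<^sup>2 + 2 * (norm (g x))\<^sup>2)" 
      by (intro Bochner_Integration.integrable_add integrable_mult_right L2_D(2) f g)
    show "(\<lambda>x. (norm (f x + g x))\<^sup>2) \<in> borel_measurable M"
      using L2_D(1)[OF f] L2_D(1)[OF g] by measurable
    show "AE x in M. norm ((norm (f x + g x))\<^sup>2) \<le> norm (2 * (norm (f x))\<^sup>2 + 2 * (norm (g x))\<^sup>2)"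
    proof (intro AE_I2)
      fix x
      have "(norm (f x + g x))\<^sup>2 \<le> (norm (f x) + norm (g x))\<^sup>2" by (intro power_mono norm_triangle_ineq) simp
      also have "\<dots> \<le> 2 * (norm (f x))\<^sup>2 + 2 * (norm (g x))\<^sup>2"
        using zero_le_power2[of "norm (f x) - norm (g x)"] by (simp add: power2_eq_square algebra_simps)
      finally show "norm ((norm (f x + g x))\<^sup>2) \<le> norm (2 * (norm (f x))\<^sup>2 + 2 * (norm (g x))\<^sup>2)" by simp
    qed
  qed
  then show ?thesis using f g by (auto simp: L2_def)
qed

lemma L2_diff:
  fixes f g :: "'a \<Rightarrow> 'b::euclidean_space"
  shows "f \<in> L2 M \<Longrightarrow> g \<in> L2 M \<Longrightarrow> (\<lambda>x. f x - g x) \<in> L2 M"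
  using L2_add[of f M "\<lambda>x. - 1 *\<^sub>R g x"] L2_scaleR[of g M "-1"] by simp

lemma L2_inner_integrable:
  fixes f g :: "'a \<Rightarrow> 'b::euclidean_space"
  assumes f: "f \<in> L2 M" and g: "g \<in> L2 M"
  shows "integrable M (\<lambda>x. f x \<bullet> g x)"
proof (rule Bochner_Integration.integrable_bound)
  show "integrable M (\<lambda>x. (norm (f x))\<^sup>2 + (norm (g x))\<^sup>2)" 
    by (intro Bochner_Integration.integrable_add L2_D(2) f g)
  show "(\<lambda>x. f x \<bullet> g x) \<in> borel_measurable M"
    by (rule borel_measurable_inner[OF L2_D(1)[OF f] L2_D(1)[OF g]])
  show "AE x in M. norm (f x \<bullet> g x) \<le> norm ((norm (f x))\<^sup>2 + (norm (g x))\<^sup>2)"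
  proof (intro AE_I2)
    fix x
    have "norm (f x \<bullet> g x) \<le> norm (f x) * norm (g x)" by (simp add: Cauchy_Schwarz_ineq2)
    also have "\<dots> \<le> (norm (f x))\<^sup>2 + (norm (g x))\<^sup>2"
    proof -
      have "2 * (norm (f x) * norm (g x)) \<le> (norm (f x))\<^sup>2 + (norm (g x))\<^sup>2"
        using zero_le_power2[of "norm (f x) - norm (g x)"] by (simp add: power2_eq_square algebra_simps)
      moreover have "0 \<le> norm (f x) * norm (g x)" by simp
      ultimately show ?thesis by linarith
    qed
    finally show "norm (f x \<bullet> g x) \<le> norm ((norm (f x))\<^sup>2 + (norm (g x))\<^sup>2)" by simp
  qed
qed

lemma part_equivp_L2_AE_eq:
  "part_equivp (\<lambda>f g :: 'a::euclidean_space \<Rightarrow> 'b::euclidean_space. 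
    f \<in> L2 lebesgue \<and> g \<in> L2 lebesgue \<and> (AE x in lebesgue. f x = g x))" (is "part_equivp ?R")
proof (rule part_equivpI)
  show "\<exists>f. ?R f f" by (rule exI[of _ "\<lambda>x. 0"]) (simp add: L2_zero)
  show "symp ?R" by (rule sympI) (auto elim: eventually_mono)
  show "transp ?R"
  proof (rule transpI)
    fix f g h :: "'a \<Rightarrow> 'b"
    assume "?R f g" "?R g h"
    moreover from this have "AE x in lebesgue. f x = g x" "AE x in lebesgue. g x = h x" by auto
    then have "AE x in lebesgue. f x = h x" by eventually_elim simp
    ultimately show "?R f h" by simp
  qed
qed

\<comment> \<open>Classes of functions on the whole space; functions on \<Omega> enter by extension
  with 0. The partial equivalence leaves out the functions that are not square integrable.\<close>
quotient_type (overloaded) ('a, 'b) l2 = "'a::euclidean_space \<Rightarrow> 'b::euclidean_space" / partial: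
  "\<lambda>f g. f \<in> L2 lebesgue \<and> g \<in> L2 lebesgue \<and> (AE x in lebesgue. f x = g x)"
  morphisms rep_l2 to_l2
  by (rule part_equivp_L2_AE_eq)

lemma rep_l2_in [simp]: "rep_l2 x \<in> L2 lebesgue"
  using Quotient3_rep_reflp[OF Quotient3_l2, of x] by simp

lemma to_l2_rep [simp]: "to_l2 (rep_l2 x) = x"
  by (rule Quotient3_abs_rep[OF Quotient3_l2])

lemma rep_to_l2: "f \<in> L2 lebesgue \<Longrightarrow> AE x in lebesgue. rep_l2 (to_l2 f) x = f x"
  using Quotient3_rep_abs[OF Quotient3_l2, of f] by simp

lemma to_l2_eq_iff: "f \<in> L2 lebesgue \<Longrightarrow> g \<in> L2 lebesgue \<Longrightarrow> to_l2 f = to_l2 g \<longleftrightarrow> (AE x in lebesgue. f x = g x)"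
  using Quotient3_rel[OF Quotient3_l2, of f g] by simp

lemma to_l2_cases:
  obtains f where "f \<in> L2 lebesgue" "x = to_l2 f"
  using that[of "rep_l2 x"] by simp

instantiation l2 :: (euclidean_space, euclidean_space) "{zero,plus,minus,uminus,scaleR,norm}"
begin
definition zero_l2 :: "('a, 'b) l2" where "0 = to_l2 (\<lambda>t. 0)"
definition plus_l2 :: "('a, 'b) l2 \<Rightarrow> ('a, 'b) l2 \<Rightarrow> ('a, 'b) l2"
  where "x + y = to_l2 (\<lambda>t. rep_l2 x t + rep_l2 y t)"
definition scaleR_l2 :: "real \<Rightarrow> ('a, 'b) l2 \<Rightarrow> ('a, 'b) l2"
  where "c *\<^sub>R x = to_l2 (\<lambda>t. c *\<^sub>R rep_l2 x t)"
definition uminus_l2 :: "('a, 'b) l2 \<Rightarrow> ('a, 'b) l2" where "- x = (-1) *\<^sub>R (x :: ('a, 'b) l2)"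
definition minus_l2 :: "('a, 'b) l2 \<Rightarrow> ('a, 'b) l2 \<Rightarrow> ('a, 'b) l2" where "x - y = x + - (y :: ('a, 'b) l2)"
definition norm_l2 :: "('a, 'b) l2 \<Rightarrow> real" where "norm x = sqrt (LINT t|lebesgue. rep_l2 x t \<bullet> rep_l2 x t)"
instance ..
end

instantiation l2 :: (euclidean_space, euclidean_space) real_inner
begin
definition inner_l2 :: "('a, 'b) l2 \<Rightarrow> ('a, 'b) l2 \<Rightarrow> real"
  where "x \<bullet> y = (LINT t|lebesgue. rep_l2 x t \<bullet> rep_l2 y t)"
definition dist_l2 :: "('a, 'b) l2 \<Rightarrow> ('a, 'b) l2 \<Rightarrow> real" where "dist x y = norm (x - (y :: ('a, 'b) l2))"
definition sgn_l2 :: "('a, 'b) l2 \<Rightarrow> ('a, 'b) l2" where "sgn x = inverse (norm x) *\<^sub>R (x :: ('a, 'b) l2)"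
definition uniformity_l2 :: "(('a, 'b) l2 \<times> ('a, 'b) l2) filter"
  where "uniformity_l2 = (INF e\<in>{0<..}. principal {(x, y). dist x y < e})"
definition open_l2 :: "('a, 'b) l2 set \<Rightarrow> bool"
  where "open_l2 U = (\<forall>x\<in>U. \<forall>\<^sub>F (x', y) in uniformity. x' = x \<longrightarrow> y \<in> U)"

lemma to_l2_add: 
  fixes f g :: "'a \<Rightarrow> 'b"
  assumes "f \<in> L2 lebesgue" "g \<in> L2 lebesgue"
  shows "to_l2 f + to_l2 g = to_l2 (\<lambda>t. f t + g t)"
  unfolding plus_l2_def using rep_to_l2[OF assms(1)] rep_to_l2[OF assms(2)]
  by (subst to_l2_eq_iff) (auto intro!: L2_add assms)

lemma to_l2_scaleR: 
  fixes f :: "'a \<Rightarrow> 'b"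
  assumes "f \<in> L2 lebesgue"
  shows "c *\<^sub>R to_l2 f = to_l2 (\<lambda>t. c *\<^sub>R f t)"
  unfolding scaleR_l2_def using rep_to_l2[OF assms(1)]
  by (subst to_l2_eq_iff) (auto intro!: L2_scaleR assms)

lemma to_l2_inner:
  fixes f g :: "'a \<Rightarrow> 'b"
  assumes "f \<in> L2 lebesgue" "g \<in> L2 lebesgue"
  shows "to_l2 f \<bullet> to_l2 g = (LINT t|lebesgue. f t \<bullet> g t)"
  unfolding inner_l2_def
proof (rule integral_cong_AE)
  show "AE t in lebesgue. rep_l2 (to_l2 f) t \<bullet> rep_l2 (to_l2 g) t = f t \<bullet> g t"
    using rep_to_l2[OF assms(1)] rep_to_l2[OF assms(2)] by eventually_elim simp
qed (rule borel_measurable_inner[OF L2_D(1) L2_D(1)], simp_all add: assms)+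

instance
proof
  fix x y z :: "('a, 'b) l2" and r s :: real
  obtain f g h where x: "x = to_l2 f" "f \<in> L2 lebesgue" and y: "y = to_l2 g" "g \<in> L2 lebesgue" 
    and z: "z = to_l2 h" "h \<in> L2 lebesgue" using to_l2_cases by metis
  note L = x y z to_l2_add to_l2_scaleR L2_add L2_scaleR L2_zero L2_minus
  show "x + y + z = x + (y + z)" by (simp add: L add.assoc)
  show "x + y = y + x" by (simp add: L add.commute)
  show "0 + x = x" by (simp add: L zero_l2_def)
  show "- x + x = 0" by (simp add: L zero_l2_def uminus_l2_def)
  show "x - y = x + - y" by (simp add: minus_l2_def)
  show "r *\<^sub>R (x + y) = r *\<^sub>R x + r *\<^sub>R y" by (simp add: L scaleR_add_right)
  show "(r + s) *\<^sub>R x = r *\<^sub>R x + s *\<^sub>R x" by (simp add: L scaleR_add_left)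
  show "r *\<^sub>R s *\<^sub>R x = (r * s) *\<^sub>R x" by (simp add: L)
  show "1 *\<^sub>R x = x" by (simp add: L)
  show "dist x y = norm (x - y)" by (rule dist_l2_def)
  show "sgn x = x /\<^sub>R norm x" by (simp add: sgn_l2_def)
  show "uniformity = (INF e\<in>{0<..}. principal {(x, y :: ('a, 'b) l2). dist x y < e})"
    by (rule uniformity_l2_def)
  show "open U = (\<forall>x\<in>U. \<forall>\<^sub>F (x', y) in uniformity. x' = x \<longrightarrow> y \<in> U)" for U :: "('a, 'b) l2 set"
    by (rule open_l2_def)
  show "x \<bullet> y = y \<bullet> x" by (simp add: inner_l2_def inner_commute)
  show "(x + y) \<bullet> z = x \<bullet> z + y \<bullet> z"
    using L2_inner_integrable[OF x(2) z(2)] L2_inner_integrable[OF y(2) z(2)] 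
    by (simp add: L to_l2_inner inner_add_left)
  show "r *\<^sub>R x \<bullet> y = r * (x \<bullet> y)" by (simp add: L to_l2_inner)
  show "0 \<le> x \<bullet> x" by (simp add: inner_l2_def)
  show "(x \<bullet> x = 0) = (x = 0)"
  proof -
    have "(x \<bullet> x = 0) = (AE t in lebesgue. f t \<bullet> f t = 0)"
      unfolding x(1) to_l2_inner[OF x(2) x(2)]
      by (rule integral_nonneg_eq_0_iff_AE[OF L2_inner_integrable[OF x(2) x(2)]]) simp
    also have "\<dots> = (x = 0)" by (simp add: x zero_l2_def to_l2_eq_iff L2_zero)
    finally show ?thesis .
  qed
  show "norm x = sqrt (x \<bullet> x)" by (simp add: norm_l2_def inner_l2_def)
qed
end

lemma to_l2_diff:
  assumes "f \<in> L2 lebesgue" "g \<in> L2 lebesgue"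
  shows "to_l2 f - to_l2 g = to_l2 (\<lambda>t. f t - g t)"
proof -
  have "to_l2 f - to_l2 g = to_l2 f + (-1) *\<^sub>R to_l2 g" by simp
  also have "\<dots> = to_l2 (\<lambda>t. f t + (-1) *\<^sub>R g t)"
    unfolding to_l2_scaleR[OF assms(2)] by (rule to_l2_add[OF assms(1) L2_scaleR[OF assms(2)]])
  finally show ?thesis by simp
qed

lemma norm_to_l2:
  assumes "f \<in> L2 lebesgue"
  shows "(norm (to_l2 f))\<^sup>2 = (LINT t|lebesgue. (norm (f t))\<^sup>2)"
  unfolding power2_norm_eq_inner to_l2_inner[OF assms assms] by (simp add: power2_norm_eq_inner)

lemma rep_l2_add: "AE t in lebesgue. rep_l2 (x + y) t = rep_l2 x t + rep_l2 y t"
  unfolding plus_l2_def by (intro rep_to_l2 L2_add) simp_all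

lemma rep_l2_scaleR: "AE t in lebesgue. rep_l2 (c *\<^sub>R x) t = c *\<^sub>R rep_l2 x t"
  unfolding scaleR_l2_def by (intro rep_to_l2 L2_scaleR) simp

lemma norm_to_l2_le:
  fixes f :: "'a::euclidean_space \<Rightarrow> 'b::euclidean_space" and g :: "'a \<Rightarrow> 'c::euclidean_space"
  assumes f: "f \<in> L2 lebesgue" and g: "g \<in> L2 lebesgue" and le: "AE x in lebesgue. norm (f x) \<le> norm (g x)"
  shows "norm (to_l2 f) \<le> norm (to_l2 g)"
proof -
  have "(norm (to_l2 f))\<^sup>2 \<le> (norm (to_l2 g))\<^sup>2"
    unfolding norm_to_l2[OF f] norm_to_l2[OF g]
  proof (rule integral_mono_AE[OF L2_D(2)[OF f] L2_D(2)[OF g]])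
    show "AE x in lebesgue. (norm (f x))\<^sup>2 \<le> (norm (g x))\<^sup>2"
      using le by eventually_elim (simp add: power_mono)
  qed
  then show ?thesis by (rule power2_le_imp_le) simp
qed

lemma not_open_singleton_if_nonzero:
  fixes u :: "'v::real_normed_vector"
  assumes "u \<noteq> 0"
  shows "\<not> open {x :: 'v}"
proof
  assume "open {x}"
  then obtain e where e: "e > 0" "ball x e \<subseteq> {x}" unfolding open_contains_ball by blast
  have "x + (e / (2 * norm u)) *\<^sub>R u \<in> ball x e" using e(1) assms by (simp add: dist_norm)
  then have "(e / (2 * norm u)) *\<^sub>R u = 0" using e(2) by auto
  then show False using e(1) assms by simp
qed

text \<open>Makes the operators on this space a unital normed algebra. The witness is the indicator
  of the unit cube times a basis vector, a nonzero element.\<close>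

instance l2 :: (euclidean_space, euclidean_space) perfect_space
proof
  fix x :: "('a, 'b) l2"
  obtain b :: 'b where b: "b \<in> Basis" using nonempty_Basis by blast
  let ?f = "\<lambda>t::'a. indicator (cbox 0 One) t *\<^sub>R b"
  have "(\<lambda>t. (norm (?f t))\<^sup>2) = indicator (cbox 0 One)" using b by (auto simp: indicator_def)
  moreover have "integrable lebesgue (indicator (cbox 0 (One::'a)) :: 'a \<Rightarrow> real)"
    by (rule integrable_real_indicator) (simp_all add: emeasure_lborel_cbox_eq)
  moreover have "?f \<in> borel_measurable lebesgue"
    by (intro borel_measurable_scaleR borel_measurable_indicator) auto
  ultimately have f: "?f \<in> L2 lebesgue" unfolding L2_def by simp
  have "(norm (to_l2 ?f))\<^sup>2 = (LINT t|lebesgue. indicator (cbox 0 (One::'a)) t)"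
    unfolding norm_to_l2[OF f] using b by (intro Bochner_Integration.integral_cong) (auto simp: indicator_def)
  also have "\<dots> = 1" by simp
  finally have "to_l2 ?f \<noteq> 0" by force
  then show "\<not> open {x}" by (rule not_open_singleton_if_nonzero)
qed

section \<open>Completeness and convergence theorems for square integrable functions\<close>

lemma nn_integral_norm_sq:
  assumes "f \<in> L2 M"
  shows "(\<integral>\<^sup>+x. ennreal ((norm (f x))\<^sup>2) \<partial>M) = ennreal (LINT x|M. (norm (f x))\<^sup>2)"
  by (rule nn_integral_eq_integral[OF L2_D(2)[OF assms]]) simp

text \<open>The weights \<open>4 ^ n\<close> leave the convergent series of
  \<open>(4 / 9) ^ n\<close> for the integrals, so the weighted series is finite almost everywhere.
  Its terms are then bounded by some \<open>C\<close>, which makes the increments at most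
  \<open>sqrt C / 2 ^ n\<close>, hence summable.\<close>

lemma fast_Cauchy_AE_convergent:
  fixes f :: "nat \<Rightarrow> 'a \<Rightarrow> 'b::euclidean_space"
  assumes f: "\<And>n. f n \<in> L2 M" and fast: "\<And>n. (LINT x|M. (norm (f (Suc n) x - f n x))\<^sup>2) \<le> (1 / 9) ^ n"
  shows "AE x in M. convergent (\<lambda>n. f n x)"
proof -
  let ?d = "\<lambda>n x. f (Suc n) x - f n x"
  have d: "?d n \<in> L2 M" for n by (rule L2_diff[OF f f])
  let ?F = "\<lambda>x. \<Sum>n. ennreal (4 ^ n * (norm (?d n x))\<^sup>2)"
  have m: "(\<lambda>x. ennreal (4 ^ n * (norm (?d n x))\<^sup>2)) \<in> borel_measurable M" for n
    using L2_D(1)[OF d[of n]] by measurable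
  have "(\<integral>\<^sup>+x. ?F x \<partial>M) = (\<Sum>n. \<integral>\<^sup>+x. ennreal (4 ^ n * (norm (?d n x))\<^sup>2) \<partial>M)"
    by (rule nn_integral_suminf[OF m])
  also have "\<dots> \<le> (\<Sum>n. ennreal ((4 / 9) ^ n))"
  proof (rule suminf_le)
    fix n
    have "(\<integral>\<^sup>+x. ennreal (4 ^ n * (norm (?d n x))\<^sup>2) \<partial>M) = ennreal (4 ^ n) * (\<integral>\<^sup>+x. ennreal ((norm (?d n x))\<^sup>2) \<partial>M)"
      using L2_D(1)[OF d[of n]] by (subst nn_integral_cmult[symmetric]) (auto simp: ennreal_mult)
    also have "\<dots> = ennreal (4 ^ n * (LINT x|M. (norm (?d n x))\<^sup>2))"
      unfolding nn_integral_norm_sq[OF d] by (simp add: ennreal_mult)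
    also have "\<dots> \<le> ennreal (4 ^ n * (1 / 9) ^ n)" by (intro ennreal_leI mult_left_mono fast) simp
    also have "4 ^ n * (1 / 9) ^ n = (4 / 9 :: real) ^ n" by (simp add: power_divide)
    finally show "(\<integral>\<^sup>+x. ennreal (4 ^ n * (norm (?d n x))\<^sup>2) \<partial>M) \<le> ennreal ((4 / 9) ^ n)" .
  qed simp_all
  also have "\<dots> < \<infinity>"
    by (subst suminf_ennreal2) (auto simp: summable_geometric)
  finally have "(\<integral>\<^sup>+x. ?F x \<partial>M) \<noteq> \<infinity>" by simp
  then have "AE x in M. ?F x \<noteq> \<infinity>"
    by (intro nn_integral_noteq_infinite borel_measurable_suminf_order m)
  then show ?thesis
  proof eventually_elim
    case (elim x)
    have "summable (\<lambda>n. 4 ^ n * (norm (?d n x))\<^sup>2)"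
      by (rule summable_suminf_not_top) (use elim in auto)
    then obtain C where C: "\<And>n. norm (4 ^ n * (norm (?d n x))\<^sup>2) \<le> C" 
      using summable_imp_bounded unfolding bounded_iff by blast
    have dle: "norm (?d n x) \<le> sqrt C * (1 / 2) ^ n" for n
    proof -
      have "((2::real) ^ n)\<^sup>2 = 4 ^ n" by (simp add: power2_eq_square flip: power_mult_distrib)
      then have "(2 ^ n * norm (?d n x))\<^sup>2 = 4 ^ n * (norm (?d n x))\<^sup>2" by (simp add: power_mult_distrib)
      then have "(2 ^ n * norm (?d n x))\<^sup>2 \<le> C" using C[of n] by simp
      then have "2 ^ n * norm (?d n x) \<le> sqrt C" by (rule real_le_rsqrt)
      then show ?thesis by (simp add: power_divide field_simps)
    qed
    have "summable (\<lambda>n. sqrt C * (1 / 2) ^ n)" by (intro summable_mult summable_geometric) simp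
    then have "summable (\<lambda>n. ?d n x)" by (rule summable_comparison_test'[where N=0]) (rule dle)
    then have "convergent (\<lambda>N. \<Sum>n<N. ?d n x)" by (simp add: summable_iff_convergent)
    moreover have "(\<Sum>n<N. ?d n x) = f N x - f 0 x" for N by (rule sum_lessThan_telescope)
    ultimately have "convergent (\<lambda>N. f N x - f 0 x)" by simp
    then have "convergent (\<lambda>N. (f N x - f 0 x) + f 0 x)" by (intro convergent_add convergent_const)
    then show ?case by simp
  qed
qed

text \<open>Riesz-Fischer: a rapidly converging selection has an almost everywhere limit
  \<open>F\<close>, and Fatou's lemma carries the \<open>L2\<close> estimates over to
  \<open>F\<close>.\<close>

instance l2 :: (euclidean_space, euclidean_space) complete_space
proof
  fix X :: "nat \<Rightarrow> ('a, 'b) l2" assume "Cauchy X"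
  then have "\<exists>N. \<forall>i\<ge>N. \<forall>j\<ge>N. norm (X i - X j) < (1 / 3) ^ n" for n
    unfolding Cauchy_def dist_norm by (metis zero_less_divide_1_iff zero_less_numeral zero_less_power)
  then obtain N where N: "\<And>n i j. i \<ge> N n \<Longrightarrow> j \<ge> N n \<Longrightarrow> norm (X i - X j) < (1 / 3) ^ n" by metis
  \<comment> \<open>Summing the thresholds makes \<open>r k\<close> exceed every \<open>N n\<close>
    with \<open>n \<le> k\<close>, which is the only property of the selection that is used.\<close>
  define r where "r n = (\<Sum>k\<le>n. N k)" for n
  have rN: "r k \<ge> N n" if "k \<ge> n" for k n
    unfolding r_def by (rule member_le_sum) (use that in auto)
  define f where "f n = rep_l2 (X (r n))" for n
  have f: "f n \<in> L2 lebesgue" for n by (simp add: f_def)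
  have ff: "(LINT x|lebesgue. (norm (f k x - f n x))\<^sup>2) \<le> (1 / 9) ^ n" if k: "k \<ge> n" for k n
  proof -
    have "(LINT x|lebesgue. (norm (f k x - f n x))\<^sup>2) = (norm (X (r k) - X (r n)))\<^sup>2"
      using norm_to_l2[OF L2_diff[OF f f], of k n] to_l2_diff[OF f f, of k n] by (simp add: f_def)
    also have "\<dots> \<le> ((1 / 3) ^ n)\<^sup>2" using N[OF rN[OF k] rN[OF order_refl]] by (intro power_mono) auto
    also have "\<dots> = (1 / 9) ^ n" by (simp add: power2_eq_square flip: power_mult_distrib)
    finally show ?thesis .
  qed
  have conv: "AE x in lebesgue. convergent (\<lambda>n. f n x)"
    by (rule fast_Cauchy_AE_convergent[OF f ff]) simp
  define F where "F x = lim (\<lambda>n. f n x)" for x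
  have Fm: "F \<in> borel_measurable lebesgue"
    unfolding F_def[abs_def] by (rule borel_measurable_lim_metric) (rule L2_D(1)[OF f])
  have Ff: "(\<integral>\<^sup>+x. ennreal ((norm (F x - f n x))\<^sup>2) \<partial>lebesgue) \<le> ennreal ((1 / 9) ^ n)" for n
  proof -
    have "(\<integral>\<^sup>+x. ennreal ((norm (F x - f n x))\<^sup>2) \<partial>lebesgue) = 
       (\<integral>\<^sup>+x. liminf (\<lambda>k. ennreal ((norm (f k x - f n x))\<^sup>2)) \<partial>lebesgue)"
    proof (rule nn_integral_cong_AE)
      show "AE x in lebesgue. ennreal ((norm (F x - f n x))\<^sup>2) = liminf (\<lambda>k. ennreal ((norm (f k x - f n x))\<^sup>2))"
        using conv
      proof eventually_elim
        case (elim x)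
        then have "(\<lambda>k. f k x) \<longlonglongrightarrow> F x" unfolding F_def by (simp add: convergent_LIMSEQ_iff)
        then have "(\<lambda>k. ennreal ((norm (f k x - f n x))\<^sup>2)) \<longlonglongrightarrow> ennreal ((norm (F x - f n x))\<^sup>2)"
          by (intro tendsto_intros)
        then show ?case by (rule lim_imp_Liminf[symmetric, rotated]) simp
      qed
    qed
    also have "\<dots> \<le> liminf (\<lambda>k. \<integral>\<^sup>+x. ennreal ((norm (f k x - f n x))\<^sup>2) \<partial>lebesgue)"
      by (rule nn_integral_liminf) (use L2_D(1)[OF f] in measurable)
    also have "\<dots> \<le> ennreal ((1 / 9) ^ n)"
    proof (rule Liminf_le)
      show "\<forall>\<^sub>F k in sequentially. (\<integral>\<^sup>+x. ennreal ((norm (f k x - f n x))\<^sup>2) \<partial>lebesgue) \<le> ennreal ((1 / 9) ^ n)"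
        unfolding nn_integral_norm_sq[OF L2_diff[OF f f]] eventually_sequentially
        by (intro exI[of _ n] allI impI ennreal_leI ff)
    qed simp
    finally show ?thesis .
  qed
  have Fd: "(\<lambda>x. F x - f n x) \<in> L2 lebesgue" for n
  proof -
    have m: "(\<lambda>x. F x - f n x) \<in> borel_measurable lebesgue" using Fm L2_D(1)[OF f] by measurable
    have "integrable lebesgue (\<lambda>x. (norm (F x - f n x))\<^sup>2)"
    proof (rule integrableI_nonneg)
      show "(\<integral>\<^sup>+x. ennreal ((norm (F x - f n x))\<^sup>2) \<partial>lebesgue) < \<infinity>"
        by (rule le_less_trans[OF Ff]) simp
    qed (use m in measurable)
    then show ?thesis using m by (simp add: L2_def)
  qed
  have F: "F \<in> L2 lebesgue" using L2_add[OF Fd[of 0] f[of 0]] by simp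
  have near: "norm (to_l2 F - X (r n)) \<le> (1 / 3) ^ n" for n
  proof -
    have "to_l2 F - X (r n) = to_l2 (\<lambda>x. F x - f n x)" using to_l2_diff[OF F f] by (simp add: f_def)
    then have "(norm (to_l2 F - X (r n)))\<^sup>2 = (LINT x|lebesgue. (norm (F x - f n x))\<^sup>2)" 
      using norm_to_l2[OF Fd] by simp
    also have "\<dots> \<le> (1 / 9) ^ n" using Ff[of n] unfolding nn_integral_norm_sq[OF Fd] by simp
    also have "\<dots> = ((1 / 3) ^ n)\<^sup>2" by (simp add: power2_eq_square flip: power_mult_distrib)
    finally show ?thesis by (rule power2_le_imp_le) simp
  qed
  have "X \<longlonglongrightarrow> to_l2 F"
  proof (rule LIMSEQ_I)
    fix e :: real assume e: "e > 0"
    obtain n where n: "(1 / 3 :: real) ^ n < e / 2" using real_arch_pow_inv[of "e / 2" "1 / 3"] e by auto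
    have "norm (X m - to_l2 F) < e" if "m \<ge> N n" for m
    proof -
      have "norm (X m - to_l2 F) \<le> norm (X m - X (r n)) + norm (X (r n) - to_l2 F)"
        using norm_triangle_ineq[of "X m - X (r n)" "X (r n) - to_l2 F"] by simp
      then show ?thesis using N[OF that rN[OF order_refl]] near[of n] n by (simp add: norm_minus_commute)
    qed
    then show "\<exists>no. \<forall>m\<ge>no. norm (X m - to_l2 F) < e" by blast
  qed
  then show "convergent X" by (rule convergentI)
qed

instance l2 :: (euclidean_space, euclidean_space) banach ..

lemma to_l2_dominated_convergence:
  fixes f :: "nat \<Rightarrow> 'a::euclidean_space \<Rightarrow> 'b::euclidean_space" and h :: "'a \<Rightarrow> 'c::real_normed_vector"
  assumes f: "\<And>n. f n \<in> borel_measurable lebesgue" and g: "g \<in> borel_measurable lebesgue" and h: "h \<in> L2 lebesgue"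
    and le: "\<And>n. AE x in lebesgue. norm (f n x) \<le> c * norm (h x)" 
    and lim: "AE x in lebesgue. (\<lambda>n. f n x) \<longlonglongrightarrow> g x"
  shows "\<And>n. f n \<in> L2 lebesgue" "g \<in> L2 lebesgue" "(\<lambda>n. to_l2 (f n)) \<longlonglongrightarrow> to_l2 g"
proof -
  show fL: "f n \<in> L2 lebesgue" for n by (rule L2_dominated[OF f h le])
  have "AE x in lebesgue. \<forall>n. norm (f n x) \<le> c * norm (h x)" using le by (simp add: AE_all_countable)
  with lim have gle: "AE x in lebesgue. norm (g x) \<le> c * norm (h x)"
  proof eventually_elim
    case (elim x)
    show ?case by (rule LIMSEQ_le_const2[OF tendsto_norm[OF elim(1)]]) (use elim(2) in blast)
  qed
  show gL: "g \<in> L2 lebesgue" by (rule L2_dominated[OF g h gle])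
  have "(\<lambda>n. LINT x|lebesgue. (norm (f n x - g x))\<^sup>2) \<longlonglongrightarrow> (LINT x|(lebesgue :: 'a measure). (0::real))"
  proof (rule integral_dominated_convergence[where w="\<lambda>x. (2 * c)\<^sup>2 * (norm (h x))\<^sup>2"])
    show "integrable lebesgue (\<lambda>x. (2 * c)\<^sup>2 * (norm (h x))\<^sup>2)" by (intro integrable_mult_right L2_D(2) h)
    show "(\<lambda>x. (norm (f n x - g x))\<^sup>2) \<in> borel_measurable lebesgue" for n using f g by measurable
    show "AE x in lebesgue. (\<lambda>n. (norm (f n x - g x))\<^sup>2) \<longlonglongrightarrow> 0" 
      using lim
    proof eventually_elim
      case (elim x)
      have "(\<lambda>n. (norm (f n x - g x))\<^sup>2) \<longlonglongrightarrow> (norm (g x - g x))\<^sup>2" by (intro tendsto_intros elim)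
      then show ?case by simp
    qed
    show "AE x in lebesgue. norm ((norm (f n x - g x))\<^sup>2) \<le> (2 * c)\<^sup>2 * (norm (h x))\<^sup>2" for n
      using le[of n] gle
    proof eventually_elim
      case (elim x)
      have "norm (f n x - g x) \<le> 2 * c * norm (h x)"
        using norm_triangle_ineq4[of "f n x" "g x"] elim by simp
      then have "(norm (f n x - g x))\<^sup>2 \<le> (2 * c * norm (h x))\<^sup>2" by (intro power_mono) auto
      then show ?case by (simp add: power_mult_distrib)
    qed
  qed simp
  then have "(\<lambda>n. (norm (to_l2 (f n) - to_l2 g))\<^sup>2) \<longlonglongrightarrow> 0"
    by (simp add: to_l2_diff[OF fL gL] norm_to_l2[OF L2_diff[OF fL gL]])
  then have "(\<lambda>n. sqrt ((norm (to_l2 (f n) - to_l2 g))\<^sup>2)) \<longlonglongrightarrow> sqrt 0" by (rule tendsto_real_sqrt)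
  then have "(\<lambda>n. norm (to_l2 (f n) - to_l2 g)) \<longlonglongrightarrow> 0" by simp
  then show "(\<lambda>n. to_l2 (f n)) \<longlonglongrightarrow> to_l2 g" using LIM_zero_iff tendsto_norm_zero_iff by blast
qed

lemma to_l2_tendsto_AE_subseq:
  fixes f :: "nat \<Rightarrow> 'a::euclidean_space \<Rightarrow> 'b::euclidean_space"
  assumes f: "\<And>n. f n \<in> L2 lebesgue" and g: "g \<in> L2 lebesgue" and lim: "(\<lambda>n. to_l2 (f n)) \<longlonglongrightarrow> to_l2 g"
  obtains r where "strict_mono (r :: nat \<Rightarrow> nat)" "AE x in lebesgue. (\<lambda>n. f (r n) x) \<longlonglongrightarrow> g x"
proof -
  let ?u = "\<lambda>n x. (norm (f n x - g x))\<^sup>2"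
  have "(\<lambda>n. (norm (to_l2 (f n) - to_l2 g))\<^sup>2) \<longlonglongrightarrow> 0\<^sup>2"
    using lim by (intro tendsto_power tendsto_norm_zero) (simp add: LIM_zero_iff)
  then have "(\<lambda>n. LINT x|lebesgue. norm (?u n x)) \<longlonglongrightarrow> 0"
    by (simp add: to_l2_diff[OF f g] norm_to_l2[OF L2_diff[OF f g]])
  then obtain r where r: "strict_mono (r :: nat \<Rightarrow> nat)" "AE x in lebesgue. (\<lambda>n. ?u (r n) x) \<longlonglongrightarrow> 0"
    using tendsto_L1_AE_subseq[of lebesgue ?u] L2_D(2)[OF L2_diff[OF f g]] by blast
  have "AE x in lebesgue. (\<lambda>n. f (r n) x) \<longlonglongrightarrow> g x" using r(2)
  proof eventually_elim
    case (elim x)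
    have "(\<lambda>n. sqrt (?u (r n) x)) \<longlonglongrightarrow> sqrt 0" by (rule tendsto_real_sqrt[OF elim])
    then have "(\<lambda>n. norm (f (r n) x - g x)) \<longlonglongrightarrow> 0" by simp
    then show ?case using LIM_zero_iff tendsto_norm_zero_iff by blast
  qed
  then show ?thesis using that r(1) by blast
qed

section \<open>Functions on an open set\<close>

text \<open>The pairing with test functions is complex bilinear, whereas the inner product of
  \<open>l2\<close> is the real part of a sesquilinear one; Cauchy-Schwarz is therefore applied to
  the moduli.\<close>

lemma L2_integral_mult_le:
  fixes f h :: "'a::euclidean_space \<Rightarrow> complex"
  assumes f: "f \<in> L2 lebesgue" and h: "h \<in> L2 lebesgue"
  shows "integrable lebesgue (\<lambda>x. f x * h x)" "norm (LINT x|lebesgue. f x * h x) \<le> norm (to_l2 f) * norm (to_l2 h)"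
proof -
  have nf: "(\<lambda>x. norm (f x)) \<in> L2 lebesgue" and nh: "(\<lambda>x. norm (h x)) \<in> L2 lebesgue"
    using f h by (auto simp: L2_def intro: borel_measurable_norm)
  have i: "integrable lebesgue (\<lambda>x. norm (f x) * norm (h x))" using L2_inner_integrable[OF nf nh] by simp
  show int: "integrable lebesgue (\<lambda>x. f x * h x)"
    by (rule Bochner_Integration.integrable_bound[OF i])
      (use L2_D(1)[OF f] L2_D(1)[OF h] in \<open>auto simp: norm_mult intro!: borel_measurable_times\<close>)
  have "norm (LINT x|lebesgue. f x * h x) \<le> (LINT x|lebesgue. norm (f x * h x))" by (rule integral_norm_bound)
  also have "\<dots> = to_l2 (\<lambda>x. norm (f x)) \<bullet> to_l2 (\<lambda>x. norm (h x))"
    by (simp add: to_l2_inner[OF nf nh] norm_mult)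
  also have "\<dots> \<le> norm (to_l2 (\<lambda>x. norm (f x))) * norm (to_l2 (\<lambda>x. norm (h x)))" by (rule norm_cauchy_schwarz)
  also have "\<dots> \<le> norm (to_l2 f) * norm (to_l2 h)"
    by (intro mult_mono norm_to_l2_le nf nh f h) auto
  finally show "norm (LINT x|lebesgue. f x * h x) \<le> norm (to_l2 f) * norm (to_l2 h)" .
qed

lemma L2_integral_mult_tendsto:
  fixes f :: "nat \<Rightarrow> 'a::euclidean_space \<Rightarrow> complex"
  assumes f: "\<And>n. f n \<in> L2 lebesgue" and g: "g \<in> L2 lebesgue" and lim: "(\<lambda>n. to_l2 (f n)) \<longlonglongrightarrow> to_l2 g" 
    and h: "h \<in> L2 lebesgue"
  shows "(\<lambda>n. LINT x|lebesgue. f n x * h x) \<longlonglongrightarrow> (LINT x|lebesgue. g x * h x)"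
proof -
  have "(\<lambda>n. (LINT x|lebesgue. f n x * h x) - (LINT x|lebesgue. g x * h x)) \<longlonglongrightarrow> 0"
  proof (rule Lim_null_comparison)
    have "(\<lambda>n. norm (to_l2 (f n) - to_l2 g) * norm (to_l2 h)) \<longlonglongrightarrow> 0 * norm (to_l2 h)"
      using lim by (intro tendsto_mult tendsto_const tendsto_norm_zero) (simp add: LIM_zero_iff)
    then show "(\<lambda>n. norm (to_l2 (f n) - to_l2 g) * norm (to_l2 h)) \<longlonglongrightarrow> 0" by simp
    have "(LINT x|lebesgue. f n x * h x) - (LINT x|lebesgue. g x * h x) = (LINT x|lebesgue. (f n x - g x) * h x)" for n
      using L2_integral_mult_le(1)[OF f h] L2_integral_mult_le(1)[OF g h] 
      by (simp add: left_diff_distrib)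
    then show "\<forall>\<^sub>F n in sequentially. norm ((LINT x|lebesgue. f n x * h x) - (LINT x|lebesgue. g x * h x))
        \<le> norm (to_l2 (f n) - to_l2 g) * norm (to_l2 h)"
      using L2_integral_mult_le(2)[OF L2_diff[OF f g] h] by (simp add: to_l2_diff[OF f g])
  qed
  then show ?thesis by (simp add: LIM_zero_iff)
qed

lemma test_L2: "\<phi> \<in> test_functions \<Omega> \<Longrightarrow> \<phi> \<in> L2 lebesgue"
  unfolding L2_def by (intro CollectI conjI test_norm_sq_integrable smooth_measurable(2) test_functions_smooth)

lemma grad_L2:
  assumes \<phi>: "\<phi> \<in> test_functions \<Omega>"
  shows "grad \<phi> \<in> L2 lebesgue"
proof -
  obtain K where K: "compact K" "K \<subseteq> \<Omega>" "\<And>x. x \<notin> K \<Longrightarrow> \<phi> x = 0" using test_functions_support[OF \<phi>] by blast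
  have c: "continuous_on UNIV (grad \<phi>)" by (rule grad_continuous[OF test_functions_smooth[OF \<phi>]])
  have "integrable lebesgue (\<lambda>x. (norm (grad \<phi> x))\<^sup>2)"
    by (rule integrable_compact_support(2)[OF _ K(1)])
      (intro continuous_on_power continuous_on_norm c, simp add: grad_zero[OF K(1,3)])
  moreover have "grad \<phi> \<in> borel_measurable lebesgue"
    by (rule integrable_compact_support(2)[OF c K(1), THEN borel_measurable_integrable]) (simp add: grad_zero[OF K(1,3)])
  ultimately show ?thesis by (simp add: L2_def)
qed

lemma ccomp_L2:
  assumes "f \<in> L2 lebesgue" "b \<in> Basis"
  shows "(\<lambda>x. ccomp b (f x)) \<in> L2 lebesgue"
proof (rule L2_dominated[OF _ assms(1), of _ 1])
  have "bounded_linear (ccomp b)"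
    by (rule bounded_linear_intro[where K=1]) (simp_all add: ccomp_add ccomp_scaleR norm_ccomp_le assms)
  then show "(\<lambda>x. ccomp b (f x)) \<in> borel_measurable lebesgue"
    by (rule borel_measurable_continuous_on[OF linear_continuous_on L2_D(1)[OF assms(1)]])
qed (simp add: norm_ccomp_le assms)

lemma ccomp_tendsto:
  fixes f :: "nat \<Rightarrow> 'a::euclidean_space \<Rightarrow> 'b::euclidean_space \<times> 'b"
  assumes f: "\<And>n. f n \<in> L2 lebesgue" and g: "g \<in> L2 lebesgue" and lim: "(\<lambda>n. to_l2 (f n)) \<longlonglongrightarrow> to_l2 g" 
    and b: "b \<in> Basis"
  shows "(\<lambda>n. to_l2 (\<lambda>x. ccomp b (f n x))) \<longlonglongrightarrow> to_l2 (\<lambda>x. ccomp b (g x))"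
proof -
  have "(\<lambda>n. to_l2 (\<lambda>x. ccomp b (f n x)) - to_l2 (\<lambda>x. ccomp b (g x))) \<longlonglongrightarrow> 0"
  proof (rule Lim_null_comparison)
    show "(\<lambda>n. norm (to_l2 (f n) - to_l2 g)) \<longlonglongrightarrow> 0" using lim by (intro tendsto_norm_zero) (simp add: LIM_zero_iff)
    have "norm (to_l2 (\<lambda>x. ccomp b (f n x)) - to_l2 (\<lambda>x. ccomp b (g x))) \<le> norm (to_l2 (f n) - to_l2 g)" for n
      unfolding to_l2_diff[OF f g] to_l2_diff[OF ccomp_L2[OF f b] ccomp_L2[OF g b]] ccomp_diff[symmetric]
      by (intro norm_to_l2_le ccomp_L2 L2_diff f g b AE_I2 norm_ccomp_le)
    then show "\<forall>\<^sub>F n in sequentially. norm (to_l2 (\<lambda>x. ccomp b (f n x)) - to_l2 (\<lambda>x. ccomp b (g x)))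
        \<le> norm (to_l2 (f n) - to_l2 g)" by simp
  qed
  then show ?thesis by (simp add: LIM_zero_iff)
qed

lemma norm_test_le_grad:
  assumes \<phi>: "\<phi> \<in> test_functions \<Omega>" and R: "\<And>x. x \<in> \<Omega> \<Longrightarrow> norm x \<le> R" "R \<ge> 0"
  shows "norm (to_l2 \<phi>) \<le> 2 * R * norm (to_l2 (grad \<phi>))"
proof -
  obtain b :: 'a where b: "b \<in> Basis" using nonempty_Basis by blast
  have "(norm (to_l2 \<phi>))\<^sup>2 \<le> 4 * R\<^sup>2 * (norm (to_l2 (partial b \<phi>)))\<^sup>2"
    unfolding norm_to_l2[OF test_L2[OF \<phi>]] norm_to_l2[OF test_L2[OF test_partial[OF \<phi> b]]]
    by (rule test_poincare[OF \<phi> R(1) b])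
  also have "\<dots> \<le> 4 * R\<^sup>2 * (norm (to_l2 (grad \<phi>)))\<^sup>2"
  proof (intro mult_left_mono power_mono norm_to_l2_le test_L2[OF test_partial[OF \<phi> b]] grad_L2[OF \<phi>] AE_I2)
    show "norm (partial b \<phi> x) \<le> norm (grad \<phi> x)" for x
      using norm_ccomp_le[OF b, of "grad \<phi> x"] by (simp add: ccomp_grad b)
  qed auto
  also have "\<dots> = (2 * R * norm (to_l2 (grad \<phi>)))\<^sup>2" by (simp add: power_mult_distrib)
  finally show ?thesis by (rule power2_le_imp_le) (simp add: R(2))
qed

lemma integral_lebesgue_on_open:
  fixes f :: "'a::euclidean_space \<Rightarrow> 'b::{banach,second_countable_topology}"
  assumes "open \<Omega>"
  shows "(LINT x|lebesgue_on \<Omega>. f x) = (LINT x|lebesgue. indicator \<Omega> x *\<^sub>R f x)"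
  by (rule integral_restrict_space) (use assms in simp)

lemma L2_lebesgue_on_measurable_iff:
  fixes f :: "'a::euclidean_space \<Rightarrow> 'b::euclidean_space"
  assumes "\<Omega> \<in> sets lebesgue"
  shows "f \<in> L2 (lebesgue_on \<Omega>) \<longleftrightarrow> (\<lambda>x. indicator \<Omega> x *\<^sub>R f x) \<in> L2 lebesgue"
proof -
  have "\<Omega> \<inter> space lebesgue \<in> sets lebesgue" using assms by simp
  moreover have "(\<lambda>x. indicator \<Omega> x *\<^sub>R (norm (f x))\<^sup>2) = (\<lambda>x. (norm (indicator \<Omega> x *\<^sub>R f x))\<^sup>2)"
    by (auto simp: fun_eq_iff split: split_indicator)
  ultimately show ?thesis
    by (simp only: L2_def mem_Collect_eq borel_measurable_restrict_space_iff integrable_restrict_space)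
qed

lemma L2_lebesgue_on_iff:
  fixes f :: "'a::euclidean_space \<Rightarrow> 'b::euclidean_space"
  assumes "open \<Omega>"
  shows "f \<in> L2 (lebesgue_on \<Omega>) \<longleftrightarrow> (\<lambda>x. indicator \<Omega> x *\<^sub>R f x) \<in> L2 lebesgue"
  by (rule L2_lebesgue_on_measurable_iff) (use assms in simp)

lemma L2_restrict:
  fixes f :: "'a::euclidean_space \<Rightarrow> 'b::euclidean_space"
  assumes "A \<in> sets lebesgue" "f \<in> L2 lebesgue"
  shows "(\<lambda>x. indicator A x *\<^sub>R f x) \<in> L2 lebesgue"
  by (rule L2_dominated[OF borel_measurable_scaleR[OF borel_measurable_indicator[OF assms(1)] L2_D(1)[OF assms(2)]] assms(2), of 1])
    (simp add: indicator_def)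

lemma L2_cmult:
  assumes "f \<in> L2 M"
  shows "(\<lambda>x. (c::complex) * f x) \<in> L2 M"
  by (rule L2_dominated[OF borel_measurable_times[OF _ L2_D(1)[OF assms]] assms, of _ "norm c"]) (simp_all add: norm_mult)

lemma L2_integrable_cbox:
  fixes g :: "'a::euclidean_space \<Rightarrow> complex"
  assumes "g \<in> L2 lebesgue"
  shows "integrable lebesgue (\<lambda>x. indicator (cbox a b) x *\<^sub>R g x)"
proof -
  let ?k = "\<lambda>x. indicator (cbox a b) x *\<^sub>R (1 :: complex)"
  have "?k \<in> L2 lebesgue"
  proof -
    have "(\<lambda>x. (norm (?k x))\<^sup>2) = indicator (cbox a b)" 
      by (auto simp: fun_eq_iff split: split_indicator)
    moreover have "integrable lebesgue (indicator (cbox a b) :: 'a \<Rightarrow> real)"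
      by (rule integrable_real_indicator) (auto simp: emeasure_lborel_cbox_eq)
    moreover have "?k \<in> borel_measurable lebesgue"
      by (intro borel_measurable_scaleR borel_measurable_indicator) auto
    ultimately show ?thesis by (simp add: L2_def)
  qed
  from L2_integral_mult_le(1)[OF this assms]
  have "integrable lebesgue (\<lambda>x. ?k x * g x)" .
  moreover have "(\<lambda>x. ?k x * g x) = (\<lambda>x. indicator (cbox a b) x *\<^sub>R g x)"
    by simp
  ultimately show ?thesis by (simp only:)
qed

section \<open>Weak derivatives\<close>

lemma has_weak_partial_iff:
  assumes \<Omega>: "open \<Omega>"
  shows "has_weak_partial \<Omega> b u g \<longleftrightarrow> g \<in> L2 (lebesgue_on \<Omega>) \<and> 
    (\<forall>\<psi>\<in>test_functions \<Omega>. - (LINT x|lebesgue_on \<Omega>. u x * partial b \<psi> x) = (LINT x|lebesgue_on \<Omega>. g x * \<psi> x))"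
  by (simp add: has_weak_partial_def distr_eq_def distr_partial_def regular_distr_def)

lemma L2_test_integrable:
  assumes \<Omega>: "open \<Omega>" and g: "g \<in> L2 (lebesgue_on \<Omega>)" and \<psi>: "\<psi> \<in> test_functions \<Omega>"
  shows "integrable (lebesgue_on \<Omega>) (\<lambda>x. g x * \<psi> x)"
proof -
  have "integrable lebesgue (\<lambda>x. (indicator \<Omega> x *\<^sub>R g x) * \<psi> x)"
    by (rule L2_integral_mult_le(1)[OF iffD1[OF L2_lebesgue_on_iff[OF \<Omega>] g] test_L2[OF \<psi>]])
  then show ?thesis using \<Omega> by (subst integrable_restrict_space) simp_all
qed

lemma has_weak_partial_unique:
  assumes \<Omega>: "open \<Omega>" and "has_weak_partial \<Omega> b u g" "has_weak_partial \<Omega> b u h"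
  shows "AE x in lebesgue_on \<Omega>. g x = h x"
proof -
  have g: "g \<in> L2 (lebesgue_on \<Omega>)" and h: "h \<in> L2 (lebesgue_on \<Omega>)" 
    and eq: "\<And>\<psi>. \<psi> \<in> test_functions \<Omega> \<Longrightarrow> (LINT x|lebesgue_on \<Omega>. g x * \<psi> x) = (LINT x|lebesgue_on \<Omega>. h x * \<psi> x)"
    using assms by (auto simp: has_weak_partial_iff)
  have "AE x in lebesgue_on \<Omega>. g x - h x = 0"
  proof (rule AE_zero_if_test_integrals_zero[OF \<Omega>])
    fix a b assume ab: "cbox a b \<subseteq> \<Omega>"
    have "(\<lambda>x. indicator \<Omega> x *\<^sub>R (g x - h x)) \<in> L2 lebesgue"
      by (rule iffD1[OF L2_lebesgue_on_iff[OF \<Omega>] L2_diff[OF g h]])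
    from L2_integrable_cbox[OF this, of a b]
    have "integrable lebesgue (\<lambda>x. indicator (cbox a b) x *\<^sub>R (indicator \<Omega> x *\<^sub>R (g x - h x)))" .
    moreover have "(\<lambda>x. indicator (cbox a b) x *\<^sub>R (indicator \<Omega> x *\<^sub>R (g x - h x))) = 
       (\<lambda>x. indicator (cbox a b) x *\<^sub>R (g x - h x))"
      using ab by (auto simp: fun_eq_iff split: split_indicator)
    ultimately show "integrable lebesgue (\<lambda>x. indicator (cbox a b) x *\<^sub>R (g x - h x))" by (simp only:)
  next
    fix \<psi> assume \<psi>: "\<psi> \<in> test_functions \<Omega>"
    show "(LINT x|lebesgue_on \<Omega>. (g x - h x) * \<psi> x) = 0"
      using eq[OF \<psi>] L2_test_integrable[OF \<Omega> g \<psi>] L2_test_integrable[OF \<Omega> h \<psi>] by (simp add: left_diff_distrib)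
  qed
  then show ?thesis by simp
qed

lemma integral_lebesgue_on_test:
  assumes \<Omega>: "open \<Omega>" and \<phi>: "\<phi> \<in> test_functions \<Omega>"
  shows "(LINT x|lebesgue_on \<Omega>. \<phi> x) = (LINT x|lebesgue. \<phi> x)"
proof -
  have "(\<lambda>x. indicator \<Omega> x *\<^sub>R \<phi> x) = \<phi>" using test_nonzero_in[OF \<phi>] by (auto simp: fun_eq_iff split: split_indicator)
  then show ?thesis by (simp only: integral_lebesgue_on_open[OF \<Omega>])
qed

lemma test_has_weak_partial:
  assumes \<Omega>: "open \<Omega>" and \<phi>: "\<phi> \<in> test_functions \<Omega>" and b: "b \<in> Basis"
  shows "has_weak_partial \<Omega> b \<phi> (partial b \<phi>)"
  unfolding has_weak_partial_iff[OF \<Omega>]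
proof (intro conjI ballI)
  have "partial b \<phi> \<in> L2 lebesgue" by (rule test_L2[OF test_partial[OF \<phi> b]])
  then show "partial b \<phi> \<in> L2 (lebesgue_on \<Omega>)" 
    unfolding L2_lebesgue_on_iff[OF \<Omega>] by (intro L2_restrict) (use \<Omega> in auto)
  fix \<psi> assume \<psi>: "\<psi> \<in> test_functions \<Omega>"
  have "(LINT x|lebesgue_on \<Omega>. \<phi> x * partial b \<psi> x) = (LINT x|lebesgue. \<phi> x * partial b \<psi> x)"
    by (rule integral_lebesgue_on_test[OF \<Omega> test_mult[OF test_partial[OF \<psi> b] test_functions_smooth[OF \<phi>]]])
  moreover have "(LINT x|lebesgue_on \<Omega>. partial b \<phi> x * \<psi> x) = (LINT x|lebesgue. partial b \<phi> x * \<psi> x)"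
    by (rule integral_lebesgue_on_test[OF \<Omega> test_mult[OF \<psi> test_functions_smooth[OF test_partial[OF \<phi> b]]]])
  ultimately show "- (LINT x|lebesgue_on \<Omega>. \<phi> x * partial b \<psi> x) = (LINT x|lebesgue_on \<Omega>. partial b \<phi> x * \<psi> x)"
    using test_integration_by_parts[OF \<psi> test_functions_smooth[OF \<phi>] b] by simp
qed

lemma has_weak_partial_diff:
  assumes \<Omega>: "open \<Omega>" and b: "b \<in> Basis" and u: "u \<in> L2 (lebesgue_on \<Omega>)" and v: "v \<in> L2 (lebesgue_on \<Omega>)"
    and g: "has_weak_partial \<Omega> b u g" and h: "has_weak_partial \<Omega> b v h"
  shows "has_weak_partial \<Omega> b (\<lambda>x. u x - v x) (\<lambda>x. g x - h x)"
  unfolding has_weak_partial_iff[OF \<Omega>]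
proof (intro conjI ballI)
  have gL: "g \<in> L2 (lebesgue_on \<Omega>)" and hL: "h \<in> L2 (lebesgue_on \<Omega>)" using g h by (auto simp: has_weak_partial_iff \<Omega>)
  then show "(\<lambda>x. g x - h x) \<in> L2 (lebesgue_on \<Omega>)" by (rule L2_diff)
  fix \<psi> assume \<psi>: "\<psi> \<in> test_functions \<Omega>"
  note i = L2_test_integrable[OF \<Omega> u test_partial[OF \<psi> b]] L2_test_integrable[OF \<Omega> v test_partial[OF \<psi> b]]
    L2_test_integrable[OF \<Omega> gL \<psi>] L2_test_integrable[OF \<Omega> hL \<psi>]
  have eq: "(LINT x|lebesgue_on \<Omega>. g x * \<psi> x) = - (LINT x|lebesgue_on \<Omega>. u x * partial b \<psi> x)"
    "(LINT x|lebesgue_on \<Omega>. h x * \<psi> x) = - (LINT x|lebesgue_on \<Omega>. v x * partial b \<psi> x)"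
    using g h \<psi> by (auto simp: has_weak_partial_iff \<Omega>)
  then show "- (LINT x|lebesgue_on \<Omega>. (u x - v x) * partial b \<psi> x) = (LINT x|lebesgue_on \<Omega>. (g x - h x) * \<psi> x)"
    unfolding left_diff_distrib using i by (simp add: eq)
qed

lemma L2_norm_lebesgue_on:
  fixes f :: "'a::euclidean_space \<Rightarrow> 'b::euclidean_space"
  assumes \<Omega>: "open \<Omega>" and f: "f \<in> L2 (lebesgue_on \<Omega>)"
  shows "L2_norm (lebesgue_on \<Omega>) f = norm (to_l2 (\<lambda>x. indicator \<Omega> x *\<^sub>R f x))"
proof -
  have "(\<lambda>x. indicator \<Omega> x *\<^sub>R f x) \<in> L2 lebesgue" by (rule iffD1[OF L2_lebesgue_on_iff[OF \<Omega>] f])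
  from norm_to_l2[OF this]
  have "(norm (to_l2 (\<lambda>x. indicator \<Omega> x *\<^sub>R f x)))\<^sup>2 = (LINT x|lebesgue. (norm (indicator \<Omega> x *\<^sub>R f x))\<^sup>2)" .
  also have "\<dots> = (LINT x|lebesgue. indicator \<Omega> x *\<^sub>R (norm (f x))\<^sup>2)"
    by (rule Bochner_Integration.integral_cong) (auto split: split_indicator)
  also have "\<dots> = (LINT x|lebesgue_on \<Omega>. (norm (f x))\<^sup>2)" by (rule integral_lebesgue_on_open[OF \<Omega>, symmetric])
  finally show ?thesis unfolding L2_norm_def by (metis norm_ge_zero real_sqrt_unique)
qed

text \<open>Frees \<open>H1_norm\<close> from the choice made in \<open>weak_partial\<close>: any
  weak derivative at hand may be used to evaluate it.\<close>

lemma weak_partial_eq: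
  assumes \<Omega>: "open \<Omega>" and g: "has_weak_partial \<Omega> b u g"
  shows "AE x in lebesgue_on \<Omega>. weak_partial \<Omega> b u x = g x" 
    "L2_norm (lebesgue_on \<Omega>) (weak_partial \<Omega> b u) = L2_norm (lebesgue_on \<Omega>) g"
proof -
  have w: "has_weak_partial \<Omega> b u (weak_partial \<Omega> b u)" 
    unfolding weak_partial_def by (rule someI[of "has_weak_partial \<Omega> b u", OF g])
  show eq: "AE x in lebesgue_on \<Omega>. weak_partial \<Omega> b u x = g x" by (rule has_weak_partial_unique[OF \<Omega> w g])
  have "weak_partial \<Omega> b u \<in> L2 (lebesgue_on \<Omega>)" "g \<in> L2 (lebesgue_on \<Omega>)"
    using w g by (auto simp: has_weak_partial_iff \<Omega>)
  then have "(LINT x|lebesgue_on \<Omega>. (norm (weak_partial \<Omega> b u x))\<^sup>2) = (LINT x|lebesgue_on \<Omega>. (norm (g x))\<^sup>2)"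
    by (intro integral_cong_AE) (use eq L2_D(2) in \<open>auto intro: borel_measurable_integrable\<close>)
  then show "L2_norm (lebesgue_on \<Omega>) (weak_partial \<Omega> b u) = L2_norm (lebesgue_on \<Omega>) g"
    by (simp add: L2_norm_def)
qed

lemma test_diff:
  assumes "\<phi> \<in> test_functions \<Omega>" "\<psi> \<in> test_functions \<Omega>"
  shows "(\<lambda>x. \<phi> x - \<psi> x) \<in> test_functions \<Omega>"
  using test_add[OF assms(1) test_cmult[OF assms(2), of "-1"]] by simp

lemma grad_diff:
  assumes f: "smooth f" and g: "smooth g"
  shows "grad (\<lambda>x. f x - g x) x = grad f x - grad g x"
proof -
  have "smooth (\<lambda>x. complex_of_real (-1) * g x)" by (intro smooth_mult smooth_const g)
  from grad_add[OF f this, of x] have "grad (\<lambda>x. f x + complex_of_real (-1) * g x) x = grad f x + (-1) *\<^sub>R grad g x"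
    by (simp only: grad_scaleR[OF g])
  then show ?thesis by simp
qed

lemma inner_complex_eq: "a \<bullet> b = Re (a * cnj b)"
  by (simp add: inner_complex_def)

section \<open>Multiplication by bounded functions and by the imaginary unit\<close>

definition mul :: "('a::euclidean_space \<Rightarrow> complex) \<Rightarrow> ('a, complex) l2 \<Rightarrow> ('a, complex) l2" where
  "mul h x = to_l2 (\<lambda>t. h t * rep_l2 x t)"

context
  fixes h :: "'a::euclidean_space \<Rightarrow> complex" and B :: real
  assumes hm: "h \<in> borel_measurable lebesgue" and hb: "\<And>t. norm (h t) \<le> B"
begin

lemma mul_L2:
  assumes "f \<in> L2 lebesgue"
  shows "(\<lambda>t. h t * f t) \<in> L2 lebesgue"
  by (rule L2_dominated[OF borel_measurable_times[OF hm L2_D(1)[OF assms]] assms, of B])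
    (simp add: norm_mult mult_right_mono hb)

lemma rep_mul: "AE t in lebesgue. rep_l2 (mul h x) t = h t * rep_l2 x t"
  unfolding mul_def by (rule rep_to_l2[OF mul_L2[OF rep_l2_in]])

lemma mul_to_l2:
  assumes "f \<in> L2 lebesgue"
  shows "mul h (to_l2 f) = to_l2 (\<lambda>t. h t * f t)"
proof -
  have "AE t in lebesgue. h t * rep_l2 (to_l2 f) t = h t * f t"
    using rep_to_l2[OF assms] by eventually_elim simp
  then show ?thesis unfolding mul_def using to_l2_eq_iff[OF mul_L2[OF rep_l2_in] mul_L2[OF assms]] by simp
qed

lemma bounded_linear_mul: "bounded_linear (mul h)"
proof (rule bounded_linear_intro)
  fix x y :: "('a, complex) l2" and r :: real
  obtain f where x: "f \<in> L2 lebesgue" "x = to_l2 f" by (rule to_l2_cases)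
  obtain g where y: "g \<in> L2 lebesgue" "y = to_l2 g" by (rule to_l2_cases)
  show "mul h (x + y) = mul h x + mul h y"
    unfolding x(2) y(2) to_l2_add[OF x(1) y(1)] mul_to_l2[OF x(1)] mul_to_l2[OF y(1)] 
      mul_to_l2[OF L2_add[OF x(1) y(1)]] to_l2_add[OF mul_L2[OF x(1)] mul_L2[OF y(1)]]
    by (simp add: distrib_left)
  show "mul h (r *\<^sub>R x) = r *\<^sub>R mul h x"
    unfolding x(2) to_l2_scaleR[OF x(1)] mul_to_l2[OF x(1)] mul_to_l2[OF L2_scaleR[OF x(1)]] to_l2_scaleR[OF mul_L2[OF x(1)]]
    by simp
  have "B \<ge> 0" by (rule order_trans[OF norm_ge_zero hb])
  then have "norm (mul h x) \<le> norm (B *\<^sub>R x)"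
    unfolding x(2) mul_to_l2[OF x(1)] to_l2_scaleR[OF x(1)]
    by (intro norm_to_l2_le mul_L2 L2_scaleR x(1) AE_I2) (simp add: norm_mult mult_right_mono hb)
  then show "norm (mul h x) \<le> norm x * B" using \<open>B \<ge> 0\<close> by (simp add: mult.commute)
qed

end

text \<open>Multiplication by \<i> for gradients, in their encoding as pairs of real and imaginary
  parts.\<close>

definition rot :: "('a::euclidean_space, 'a \<times> 'a) l2 \<Rightarrow> ('a, 'a \<times> 'a) l2" where
  "rot y = to_l2 (\<lambda>t. (- snd (rep_l2 y t), fst (rep_l2 y t)))"

lemma rot_L2:
  fixes f :: "'a::euclidean_space \<Rightarrow> 'b::euclidean_space \<times> 'b"
  assumes "f \<in> L2 lebesgue"
  shows "(\<lambda>t. (- snd (f t), fst (f t))) \<in> L2 lebesgue"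
proof (rule L2_dominated[OF _ assms, of _ 1])
  have "continuous_on UNIV (\<lambda>p :: 'b \<times> 'b. (- snd p, fst p))" by (intro continuous_intros)
  then show "(\<lambda>t. (- snd (f t), fst (f t))) \<in> borel_measurable lebesgue"
    by (rule borel_measurable_continuous_on[OF _ L2_D(1)[OF assms]])
  show "AE x in lebesgue. norm (- snd (f x), fst (f x)) \<le> 1 * norm (f x)"
    by (simp add: norm_prod_def add.commute)
qed

lemma rot_to_l2:
  assumes "f \<in> L2 lebesgue"
  shows "rot (to_l2 f) = to_l2 (\<lambda>t. (- snd (f t), fst (f t)))"
proof -
  have "AE t in lebesgue. (- snd (rep_l2 (to_l2 f) t), fst (rep_l2 (to_l2 f) t)) = (- snd (f t), fst (f t))"
    using rep_to_l2[OF assms] by eventually_elim simp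
  then show ?thesis unfolding rot_def using to_l2_eq_iff[OF rot_L2[OF rep_l2_in] rot_L2[OF assms]] by simp
qed

lemma bounded_linear_rot: "bounded_linear (rot :: ('a::euclidean_space, 'a \<times> 'a) l2 \<Rightarrow> _)"
proof (rule bounded_linear_intro)
  fix x y :: "('a, 'a \<times> 'a) l2" and r :: real
  obtain f where x: "f \<in> L2 lebesgue" "x = to_l2 f" by (rule to_l2_cases)
  obtain g where y: "g \<in> L2 lebesgue" "y = to_l2 g" by (rule to_l2_cases)
  show "rot (x + y) = rot x + rot y"
    unfolding x(2) y(2) to_l2_add[OF x(1) y(1)] rot_to_l2[OF x(1)] rot_to_l2[OF y(1)] 
      rot_to_l2[OF L2_add[OF x(1) y(1)]] to_l2_add[OF rot_L2[OF x(1)] rot_L2[OF y(1)]]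
    by simp
  show "rot (r *\<^sub>R x) = r *\<^sub>R rot x"
    unfolding x(2) to_l2_scaleR[OF x(1)] rot_to_l2[OF x(1)] rot_to_l2[OF L2_scaleR[OF x(1)]] to_l2_scaleR[OF rot_L2[OF x(1)]]
    by simp
  show "norm (rot x) \<le> norm x * 1"
    unfolding x(2) rot_to_l2[OF x(1)] mult_1_right
    by (intro norm_to_l2_le rot_L2 x(1) AE_I2) (simp add: norm_prod_def add.commute)
qed

lemma inner_rot: "rot x \<bullet> y = - (x \<bullet> rot y)"
proof -
  obtain f where x: "f \<in> L2 lebesgue" "x = to_l2 f" by (rule to_l2_cases)
  obtain g where y: "g \<in> L2 lebesgue" "y = to_l2 g" by (rule to_l2_cases)
  have "rot x \<bullet> y = (LINT t|lebesgue. (- snd (f t), fst (f t)) \<bullet> g t)"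
    unfolding x(2) y(2) rot_to_l2[OF x(1)] by (rule to_l2_inner[OF rot_L2[OF x(1)] y(1)])
  also have "\<dots> = (LINT t|lebesgue. - (f t \<bullet> (- snd (g t), fst (g t))))"
    by (rule Bochner_Integration.integral_cong) (simp_all add: inner_prod_def)
  also have "\<dots> = - (x \<bullet> rot y)"
    unfolding x(2) y(2) rot_to_l2[OF y(1)] to_l2_inner[OF x(1) rot_L2[OF y(1)]] by simp
  finally show ?thesis .
qed

lemma inner_mul_i: "mul (\<lambda>t. \<i>) x \<bullet> y = - (x \<bullet> mul (\<lambda>t. \<i>) y)"
proof -
  obtain f where x: "f \<in> L2 lebesgue" "x = to_l2 f" by (rule to_l2_cases)
  obtain g where y: "g \<in> L2 lebesgue" "y = to_l2 g" by (rule to_l2_cases)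
  have i: "(\<lambda>t. \<i>) \<in> borel_measurable lebesgue" "\<And>t. norm \<i> \<le> 1" by auto
  note m = mul_to_l2[OF i] and L = mul_L2[OF i]
  have "mul (\<lambda>t. \<i>) x \<bullet> y = (LINT t|lebesgue. (\<i> * f t) \<bullet> g t)"
    unfolding x(2) y(2) m[OF x(1)] by (rule to_l2_inner[OF L[OF x(1)] y(1)])
  also have "\<dots> = (LINT t|lebesgue. - (f t \<bullet> (\<i> * g t)))"
    by (rule Bochner_Integration.integral_cong) (simp_all add: inner_complex_def)
  also have "\<dots> = - (x \<bullet> mul (\<lambda>t. \<i>) y)"
    unfolding x(2) y(2) m[OF y(1)] to_l2_inner[OF x(1) L[OF y(1)]] by simp
  finally show ?thesis .
qed

lemma grad_mult_i: "smooth \<phi> \<Longrightarrow> grad (\<lambda>x. \<i> * \<phi> x) x = (- snd (grad \<phi> x), fst (grad \<phi> x))"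
  by (rule ccomp_eqI) (simp add: ccomp_grad partial_cmult, simp add: ccomp_def grad_def cvec_def complex_eq_iff)

section \<open>The closed graph of the weighted gradient\<close>

locale weighted_domain =
  fixes \<Omega> :: "'a::euclidean_space set" and m :: "'a \<Rightarrow> real"
  assumes open_\<Omega>: "open \<Omega>" and bounded_\<Omega>: "bounded \<Omega>"
    and m_measurable: "m \<in> borel_measurable (lebesgue_on \<Omega>)"
    and m_pos: "x \<in> \<Omega> \<Longrightarrow> 0 < m x"
    and inv_m_L2_loc: "(\<lambda>x. 1 / m x) \<in> L2_loc \<Omega>"
begin

lemma \<Omega>_sets: "\<Omega> \<in> sets lebesgue" using open_\<Omega> by simp

text \<open>\<open>1 / m\<close> extended by 0 to the whole space; \<open>wt\<close> below is
  division by \<open>m\<close> in this sense.\<close>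

definition \<rho> :: "'a \<Rightarrow> real" where "\<rho> x = indicator \<Omega> x *\<^sub>R (1 / m x)"

definition wt :: "('a \<Rightarrow> complex) \<Rightarrow> 'a \<Rightarrow> complex" where "wt \<phi> x = \<rho> x *\<^sub>R \<phi> x"

lemma \<rho>_measurable: "\<rho> \<in> borel_measurable lebesgue"
proof -
  have "(\<lambda>x. 1 / m x) \<in> borel_measurable (lebesgue_on \<Omega>)" using m_measurable by measurable
  then show ?thesis unfolding \<rho>_def[abs_def] 
    by (subst (asm) borel_measurable_restrict_space_iff) (use \<Omega>_sets in auto)
qed

lemma wt_measurable: "f \<in> borel_measurable lebesgue \<Longrightarrow> wt f \<in> borel_measurable lebesgue"
  unfolding wt_def[abs_def] by (rule borel_measurable_scaleR[OF \<rho>_measurable])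

lemma \<rho>_pos: "x \<in> \<Omega> \<Longrightarrow> \<rho> x > 0"
  by (simp add: \<rho>_def m_pos)

lemma \<rho>_nonneg: "\<rho> x \<ge> 0"
  by (cases "x \<in> \<Omega>") (auto simp: \<rho>_def intro: less_imp_le m_pos)

text \<open>Local square integrability of \<open>1 / m\<close> enters here: a test function is
  bounded and vanishes off a compact subset of \<Omega>.\<close>

lemma wt_L2:
  assumes \<phi>: "\<phi> \<in> test_functions \<Omega>"
  shows "wt \<phi> \<in> L2 lebesgue"
proof -
  obtain K where K: "compact K" "K \<subseteq> \<Omega>" "\<And>x. x \<notin> K \<Longrightarrow> \<phi> x = 0" using test_functions_support[OF \<phi>] by blast
  obtain B where B: "B \<ge> 0" "\<And>x. norm (\<phi> x) \<le> B" using test_bounded[OF \<phi>] by blast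
  have "K \<in> sets lebesgue" using K(1) by (simp add: compact_imp_closed)
  moreover have "(\<lambda>x. 1 / m x) \<in> L2 (lebesgue_on K)" using inv_m_L2_loc K by (simp add: L2_loc_def)
  ultimately have g: "(\<lambda>x. indicator K x *\<^sub>R (1 / m x)) \<in> L2 lebesgue"
    using L2_lebesgue_on_measurable_iff[of K "\<lambda>x. 1 / m x"] by simp
  show ?thesis
  proof (rule L2_dominated[OF wt_measurable[OF L2_D(1)[OF test_L2[OF \<phi>]]] g, of B], intro AE_I2)
    fix x
    show "norm (wt \<phi> x) \<le> B * norm (indicator K x *\<^sub>R (1 / m x))"
    proof (cases "x \<in> K")
      case True
      then show ?thesis using K(2) B(2)[of x] 
        by (auto simp: wt_def \<rho>_def divide_right_mono)
    qed (simp add: wt_def K(3))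
  qed
qed

text \<open>\<open>w\<close> is prescribed on \<Omega> only and may be any square integrable
  function outside, without contributing to the gradient. This makes the domain dense in the whole
  space, and it forces the values of \<open>form_op G\<close> to vanish outside \<Omega>.\<close>

definition G0 :: "(('a, complex) l2 \<times> ('a, 'a \<times> 'a) l2) set" where
  "G0 = {(to_l2 w, to_l2 (grad \<phi>)) | w \<phi>. \<phi> \<in> test_functions \<Omega> \<and> w \<in> L2 lebesgue \<and> 
     (AE x in lebesgue. x \<in> \<Omega> \<longrightarrow> w x = wt \<phi> x)}"

definition G :: "(('a, complex) l2 \<times> ('a, 'a \<times> 'a) l2) set" where "G = closure G0"

lemma G0I:
  "\<phi> \<in> test_functions \<Omega> \<Longrightarrow> w \<in> L2 lebesgue \<Longrightarrow> (AE x in lebesgue. x \<in> \<Omega> \<longrightarrow> w x = wt \<phi> x) \<Longrightarrow> (to_l2 w, to_l2 (grad \<phi>)) \<in> G0"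
  unfolding G0_def by blast

lemma G0E:
  assumes "p \<in> G0"
  obtains w \<phi> where "p = (to_l2 w, to_l2 (grad \<phi>))" "\<phi> \<in> test_functions \<Omega>" "w \<in> L2 lebesgue" 
    "AE x in lebesgue. x \<in> \<Omega> \<longrightarrow> w x = wt \<phi> x"
  using assms unfolding G0_def by blast

lemma G0_subset_G: "G0 \<subseteq> G" unfolding G_def by (rule closure_subset)

lemma test_in_G: "\<phi> \<in> test_functions \<Omega> \<Longrightarrow> (to_l2 (wt \<phi>), to_l2 (grad \<phi>)) \<in> G"
  by (intro subsetD[OF G0_subset_G] G0I wt_L2) auto

lemma grad_test_zero: "grad (\<lambda>x. 0) = (\<lambda>x. 0 :: 'a \<times> 'a)"
  using grad_zero[of "{}" "\<lambda>x :: 'a. 0 :: complex"] by auto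

lemma G0_outside: 
  assumes "w \<in> L2 lebesgue" "\<And>x. x \<in> \<Omega> \<Longrightarrow> w x = 0"
  shows "(to_l2 w, 0) \<in> G0"
  using G0I[OF test_zero assms(1)] assms(2) by (simp add: wt_def grad_test_zero zero_l2_def)

lemma subspace_G0: "subspace G0"
  unfolding subspace_def
proof (intro conjI ballI allI)
  show "0 \<in> G0" using G0_outside[OF L2_zero] by (simp add: zero_prod_def zero_l2_def)
  fix p q assume "p \<in> G0"
  then obtain w \<phi> where p: "p = (to_l2 w, to_l2 (grad \<phi>))" "\<phi> \<in> test_functions \<Omega>" "w \<in> L2 lebesgue" 
    "AE x in lebesgue. x \<in> \<Omega> \<longrightarrow> w x = wt \<phi> x" by (rule G0E)
  note s\<phi> = test_functions_smooth[OF p(2)]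
  { assume "q \<in> G0"
    then obtain v \<psi> where q: "q = (to_l2 v, to_l2 (grad \<psi>))" "\<psi> \<in> test_functions \<Omega>" "v \<in> L2 lebesgue" 
      "AE x in lebesgue. x \<in> \<Omega> \<longrightarrow> v x = wt \<psi> x" by (rule G0E)
    have "(to_l2 (\<lambda>x. w x + v x), to_l2 (grad (\<lambda>x. \<phi> x + \<psi> x))) \<in> G0"
    proof (rule G0I[OF test_add[OF p(2) q(2)] L2_add[OF p(3) q(3)]])
      show "AE x in lebesgue. x \<in> \<Omega> \<longrightarrow> w x + v x = wt (\<lambda>x. \<phi> x + \<psi> x) x"
        using p(4) q(4) by eventually_elim (simp add: wt_def scaleR_add_right)
    qed
    moreover have "grad (\<lambda>x. \<phi> x + \<psi> x) = (\<lambda>x. grad \<phi> x + grad \<psi> x)"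
      using grad_add[OF s\<phi> test_functions_smooth[OF q(2)]] by auto
    ultimately show "p + q \<in> G0" 
      by (simp add: p(1) q(1) to_l2_add p(3) q(3) grad_L2[OF p(2)] grad_L2[OF q(2)]) }
  fix c :: real
  have "(to_l2 (\<lambda>x. c *\<^sub>R w x), to_l2 (grad (\<lambda>x. complex_of_real c * \<phi> x))) \<in> G0"
  proof (rule G0I[OF test_cmult[OF p(2)] L2_scaleR[OF p(3)]])
    show "AE x in lebesgue. x \<in> \<Omega> \<longrightarrow> c *\<^sub>R w x = wt (\<lambda>x. complex_of_real c * \<phi> x) x"
      using p(4) by eventually_elim (simp add: wt_def scaleR_conv_of_real)
  qed
  moreover have "grad (\<lambda>x. complex_of_real c * \<phi> x) = (\<lambda>x. c *\<^sub>R grad \<phi> x)"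
    using grad_scaleR[OF s\<phi>] by auto
  ultimately show "c *\<^sub>R p \<in> G0"
    by (simp add: p(1) to_l2_scaleR p(3) grad_L2[OF p(2)])
qed

lemma closed_G: "closed G" by (simp add: G_def)

lemma subspace_G: "subspace G" unfolding G_def by (rule subspace_closure[OF subspace_G0])

lemma G_invariant:
  assumes F: "bounded_linear F" and inv: "\<And>p. p \<in> G0 \<Longrightarrow> F p \<in> G0" and p: "p \<in> G"
  shows "F p \<in> G"
proof -
  have "F ` closure G0 \<subseteq> closure G0"
    by (rule image_closure_subset[OF linear_continuous_on[OF F] closed_closure]) (use inv closure_subset in blast)
  then show ?thesis using p unfolding G_def by blast
qed

definition chi :: "'a \<Rightarrow> complex" where "chi t = (if t \<in> \<Omega> then 1 else 0)"

abbreviation res :: "('a, complex) l2 \<Rightarrow> ('a, complex) l2" where "res \<equiv> mul chi"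

abbreviation mi :: "('a, complex) l2 \<Rightarrow> ('a, complex) l2" where "mi \<equiv> mul (\<lambda>t. \<i>)"

lemma chi_bounded: "chi \<in> borel_measurable lebesgue" "\<And>t. norm (chi t) \<le> 1"
  unfolding chi_def[abs_def] using \<Omega>_sets by (auto intro!: measurable_If_set)

lemma const_i: "(\<lambda>t::'a. \<i>) \<in> borel_measurable lebesgue" "\<And>t::'a. norm \<i> \<le> 1" by auto

lemmas res_linear = bounded_linear_mul[OF chi_bounded] and res_L2 = mul_L2[OF chi_bounded] and rep_res = rep_mul[OF chi_bounded] 
  and res_to_l2 = mul_to_l2[OF chi_bounded]

lemma res_in_G: "(w, g) \<in> G \<Longrightarrow> (res w, g) \<in> G"
proof -
  assume wg: "(w, g) \<in> G"
  let ?F = "\<lambda>p. (res (fst p), snd p)"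
  have "?F (w, g) \<in> G"
  proof (rule G_invariant[OF _ _ wg])
    show "bounded_linear ?F"
      by (intro bounded_linear_Pair bounded_linear_compose[OF res_linear] bounded_linear_fst bounded_linear_snd)
    fix p assume "p \<in> G0"
    then obtain w \<phi> where p: "p = (to_l2 w, to_l2 (grad \<phi>))" "\<phi> \<in> test_functions \<Omega>" "w \<in> L2 lebesgue" 
      "AE x in lebesgue. x \<in> \<Omega> \<longrightarrow> w x = wt \<phi> x" by (rule G0E)
    have "AE x in lebesgue. x \<in> \<Omega> \<longrightarrow> chi x * w x = wt \<phi> x"
      using p(4) by eventually_elim (simp add: chi_def)
    then show "?F p \<in> G0" unfolding p(1) fst_conv snd_conv res_to_l2[OF p(3)] by (rule G0I[OF p(2) res_L2[OF p(3)]])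
  qed
  then show ?thesis by simp
qed

text \<open>\<open>G\<close> is closed under real linear combinations by construction; this adds
  multiplication by \<i> and is the origin of complex linearity of the operator.\<close>

lemma mi_in_G: "(w, g) \<in> G \<Longrightarrow> (mi w, rot g) \<in> G"
proof -
  assume wg: "(w, g) \<in> G"
  let ?F = "\<lambda>p. (mi (fst p), rot (snd p))"
  have "?F (w, g) \<in> G"
  proof (rule G_invariant[OF _ _ wg])
    show "bounded_linear ?F"
      by (intro bounded_linear_Pair bounded_linear_compose[OF bounded_linear_mul[OF const_i]] 
          bounded_linear_compose[OF bounded_linear_rot] bounded_linear_fst bounded_linear_snd)
    fix p assume "p \<in> G0"
    then obtain w \<phi> where p: "p = (to_l2 w, to_l2 (grad \<phi>))" "\<phi> \<in> test_functions \<Omega>" "w \<in> L2 lebesgue" 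
      "AE x in lebesgue. x \<in> \<Omega> \<longrightarrow> w x = wt \<phi> x" by (rule G0E)
    have "AE x in lebesgue. x \<in> \<Omega> \<longrightarrow> \<i> * w x = wt (\<lambda>x. \<i> * \<phi> x) x"
      using p(4) by eventually_elim (simp add: wt_def)
    from G0I[OF test_cmult[OF p(2)] mul_L2[OF const_i p(3)] this]
    have "(to_l2 (\<lambda>t. \<i> * w t), to_l2 (grad (\<lambda>x. \<i> * \<phi> x))) \<in> G0" .
    moreover have "grad (\<lambda>x. \<i> * \<phi> x) = (\<lambda>x. (- snd (grad \<phi> x), fst (grad \<phi> x)))"
      using grad_mult_i[OF test_functions_smooth[OF p(2)]] by auto
    ultimately show "?F p \<in> G0" 
      unfolding p(1) fst_conv snd_conv mul_to_l2[OF const_i p(3)] rot_to_l2[OF grad_L2[OF p(2)]] by simp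
  qed
  then show ?thesis by simp
qed

text \<open>Unfolds the closure. Convergence of the gradients and the Poincare inequality make the
  test functions themselves converge to some \<open>u\<close>, and almost everywhere convergence
  identifies \<open>u / m\<close> with the restriction of \<open>x\<close> to \<Omega>.\<close>

lemma G_approx:
  assumes xy: "(x, y) \<in> G"
  obtains \<phi> u where "\<And>n. \<phi> n \<in> test_functions \<Omega>" "(\<lambda>n. to_l2 (grad (\<phi> n))) \<longlonglongrightarrow> y"
    "(\<lambda>n. to_l2 (wt (\<phi> n))) \<longlonglongrightarrow> res x" "u \<in> L2 lebesgue" "(\<lambda>n. to_l2 (\<phi> n)) \<longlonglongrightarrow> to_l2 u"
    "AE t in lebesgue. (\<lambda>n. \<phi> n t) \<longlonglongrightarrow> u t" "AE t in lebesgue. wt u t = chi t * rep_l2 x t"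
    "AE t in lebesgue. t \<notin> \<Omega> \<longrightarrow> u t = 0"
proof -
  obtain p where p: "\<And>n. p n \<in> G0" "p \<longlonglongrightarrow> (x, y)" using xy unfolding G_def closure_sequential by blast
  have "\<exists>z. p n = (to_l2 (fst z), to_l2 (grad (snd z))) \<and> snd z \<in> test_functions \<Omega> \<and> fst z \<in> L2 lebesgue \<and> 
      (AE x in lebesgue. x \<in> \<Omega> \<longrightarrow> fst z x = wt (snd z) x)" (is "\<exists>z. ?P n z") for n
  proof -
    obtain w \<phi> where "p n = (to_l2 w, to_l2 (grad \<phi>))" "\<phi> \<in> test_functions \<Omega>" "w \<in> L2 lebesgue" 
      "AE x in lebesgue. x \<in> \<Omega> \<longrightarrow> w x = wt \<phi> x" using p(1)[of n] by (rule G0E)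
    then show ?thesis by (intro exI[of _ "(w, \<phi>)"]) simp
  qed
  then obtain z where z: "\<And>n. ?P n (z n)" using choice[of ?P] by blast
  define w \<phi> where "w n = fst (z n)" and "\<phi> n = snd (z n)" for n
  have w: "\<And>n. p n = (to_l2 (w n), to_l2 (grad (\<phi> n)))" "\<And>n. \<phi> n \<in> test_functions \<Omega>"
    "\<And>n. w n \<in> L2 lebesgue" "\<And>n. AE x in lebesgue. x \<in> \<Omega> \<longrightarrow> w n x = wt (\<phi> n) x"
    using z by (simp_all add: w_def \<phi>_def)
  note sm = test_functions_smooth[OF w(2)]
  have lx: "(\<lambda>n. to_l2 (w n)) \<longlonglongrightarrow> x" using tendsto_fst[OF p(2)] by (simp add: w(1))
  have ly: "(\<lambda>n. to_l2 (grad (\<phi> n))) \<longlonglongrightarrow> y" using tendsto_snd[OF p(2)] by (simp add: w(1))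
  have wtw: "to_l2 (wt (\<phi> n)) = res (to_l2 (w n))" for n
  proof -
    have "AE t in lebesgue. wt (\<phi> n) t = chi t * w n t"
      using w(4)[of n] by eventually_elim (auto simp: chi_def wt_def \<rho>_def)
    then show ?thesis unfolding res_to_l2[OF w(3)] by (rule iffD2[OF to_l2_eq_iff[OF wt_L2[OF w(2)] res_L2[OF w(3)]]])
  qed
  have lw: "(\<lambda>n. to_l2 (wt (\<phi> n))) \<longlonglongrightarrow> res x"
    unfolding wtw by (rule bounded_linear.tendsto[OF res_linear lx])
  obtain R0 where "\<And>x. x \<in> \<Omega> \<Longrightarrow> norm x \<le> R0" using bounded_\<Omega> unfolding bounded_iff by blast
  then have R: "\<And>x. x \<in> \<Omega> \<Longrightarrow> norm x \<le> max R0 1" by (rule max.coboundedI1)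
  define R where "R = max R0 1"
  have R0: "R > 0" by (simp add: R_def)
  have po: "norm (to_l2 (\<phi> i) - to_l2 (\<phi> j)) \<le> 2 * R * norm (to_l2 (grad (\<phi> i)) - to_l2 (grad (\<phi> j)))" for i j
  proof -
    have "grad (\<lambda>x. \<phi> i x - \<phi> j x) = (\<lambda>x. grad (\<phi> i) x - grad (\<phi> j) x)" using grad_diff[OF sm sm] by auto
    then show ?thesis
      using norm_test_le_grad[OF test_diff[OF w(2) w(2)] R, of i j] 
      by (simp add: R_def[symmetric] less_imp_le[OF R0] to_l2_diff test_L2[OF w(2)] grad_L2[OF w(2)])
  qed
  have "Cauchy (\<lambda>n. to_l2 (\<phi> n))"
  proof (rule metric_CauchyI)
    fix e :: real assume e: "e > 0"
    then have "e / (2 * R) > 0" using R0 by simp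
    then obtain M where M: "\<And>i j. i \<ge> M \<Longrightarrow> j \<ge> M \<Longrightarrow> dist (to_l2 (grad (\<phi> i))) (to_l2 (grad (\<phi> j))) < e / (2 * R)"
      using metric_CauchyD[OF LIMSEQ_imp_Cauchy[OF ly]] by blast
    have "dist (to_l2 (\<phi> i)) (to_l2 (\<phi> j)) < e" if "i \<ge> M" "j \<ge> M" for i j
    proof -
      have "norm (to_l2 (grad (\<phi> i)) - to_l2 (grad (\<phi> j))) < e / (2 * R)" using M[OF that] by (simp add: dist_norm)
      then have "2 * R * norm (to_l2 (grad (\<phi> i)) - to_l2 (grad (\<phi> j))) < e"
        using R0 by (simp add: pos_less_divide_eq mult.commute)
      then show ?thesis unfolding dist_norm using po[of i j] by linarith
    qed
    then show "\<exists>M. \<forall>i\<ge>M. \<forall>j\<ge>M. dist (to_l2 (\<phi> i)) (to_l2 (\<phi> j)) < e" by blast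
  qed
  then obtain v where v: "(\<lambda>n. to_l2 (\<phi> n)) \<longlonglongrightarrow> v" using Cauchy_convergent convergent_def by blast
  define u where "u = rep_l2 v"
  have u: "u \<in> L2 lebesgue" "to_l2 u = v" by (simp_all add: u_def)
  \<comment> \<open>Two successive selections, so that along one subsequence both the test functions
    and their quotients by \<open>m\<close> converge almost everywhere.\<close>
  obtain r1 where r1: "strict_mono (r1 :: nat \<Rightarrow> nat)" "AE t in lebesgue. (\<lambda>n. \<phi> (r1 n) t) \<longlonglongrightarrow> u t"
    using to_l2_tendsto_AE_subseq[of \<phi> u, OF test_L2[OF w(2)] u(1)] v unfolding u(2) by blast
  have lw1: "(\<lambda>n. to_l2 (wt (\<phi> (r1 n)))) \<longlonglongrightarrow> to_l2 (rep_l2 (res x))" 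
    using LIMSEQ_subseq_LIMSEQ[OF lw r1(1)] by (simp add: o_def)
  obtain r2 where r2: "strict_mono (r2 :: nat \<Rightarrow> nat)" "AE t in lebesgue. (\<lambda>n. wt (\<phi> (r1 (r2 n))) t) \<longlonglongrightarrow> rep_l2 (res x) t"
    using to_l2_tendsto_AE_subseq[OF wt_L2[OF w(2)] rep_l2_in lw1] by blast
  define r where "r = r1 \<circ> r2"
  have r: "strict_mono r" unfolding r_def by (rule strict_mono_o[OF r1(1) r2(1)])
  have ae: "AE t in lebesgue. (\<lambda>n. \<phi> (r n) t) \<longlonglongrightarrow> u t" using r1(2)
  proof eventually_elim
    case (elim t)
    show ?case using LIMSEQ_subseq_LIMSEQ[OF elim r2(1)] by (simp add: r_def o_def)
  qed
  have ae2: "AE t in lebesgue. wt u t = chi t * rep_l2 x t" using r2(2) ae rep_res[of x]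
  proof eventually_elim
    case (elim t)
    have "(\<lambda>n. wt (\<phi> (r n)) t) \<longlonglongrightarrow> wt u t" unfolding wt_def by (intro tendsto_intros elim(2))
    moreover have "(\<lambda>n. wt (\<phi> (r n)) t) \<longlonglongrightarrow> chi t * rep_l2 x t" using elim(1,3) by (simp add: r_def)
    ultimately show ?case by (rule LIMSEQ_unique)
  qed
  have ae3: "AE t in lebesgue. t \<notin> \<Omega> \<longrightarrow> u t = 0" using ae
  proof eventually_elim
    case (elim t)
    show ?case
    proof
      assume "t \<notin> \<Omega>"
      then have "\<phi> n t = 0" for n using test_nonzero_in[OF w(2)] by blast
      then show "u t = 0" using elim LIMSEQ_unique[OF _ tendsto_const] by simp
    qed
  qed
  show ?thesis
  proof (rule that[of "\<lambda>n. \<phi> (r n)" u])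
    show "(\<lambda>n. to_l2 (grad (\<phi> (r n)))) \<longlonglongrightarrow> y" using LIMSEQ_subseq_LIMSEQ[OF ly r] by (simp add: o_def)
    show "(\<lambda>n. to_l2 (wt (\<phi> (r n)))) \<longlonglongrightarrow> res x" using LIMSEQ_subseq_LIMSEQ[OF lw r] by (simp add: o_def)
    show "(\<lambda>n. to_l2 (\<phi> (r n))) \<longlonglongrightarrow> to_l2 u" using LIMSEQ_subseq_LIMSEQ[OF v r] by (simp add: o_def u(2))
  qed (fact w(2) u(1) ae ae2 ae3)+
qed

abbreviation emb :: "('a \<Rightarrow> complex) \<Rightarrow> ('a, complex) l2" where
  "emb f \<equiv> to_l2 (\<lambda>x. indicator \<Omega> x *\<^sub>R f x)"

lemma L2_on_iff:
  fixes f :: "'a \<Rightarrow> complex"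
  shows "f \<in> L2 (lebesgue_on \<Omega>) \<longleftrightarrow> (\<lambda>x. indicator \<Omega> x *\<^sub>R f x) \<in> L2 lebesgue"
  by (rule L2_lebesgue_on_iff[OF open_\<Omega>])

lemma emb_L2: "f \<in> L2 (lebesgue_on \<Omega>) \<Longrightarrow> (\<lambda>x. indicator \<Omega> x *\<^sub>R f x :: complex) \<in> L2 lebesgue"
  using L2_on_iff by blast

lemma L2_on_lebesgue: "(f :: 'a \<Rightarrow> complex) \<in> L2 lebesgue \<Longrightarrow> f \<in> L2 (lebesgue_on \<Omega>)"
  using L2_on_iff L2_restrict[OF \<Omega>_sets] by blast

lemma rep_emb: "f \<in> L2 (lebesgue_on \<Omega>) \<Longrightarrow> AE x in lebesgue. rep_l2 (emb f) x = indicator \<Omega> x *\<^sub>R f x"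
  by (rule rep_to_l2[OF emb_L2])

lemma AE_on_iff: "(AE x in lebesgue_on \<Omega>. P x) \<longleftrightarrow> (AE x in lebesgue. x \<in> \<Omega> \<longrightarrow> P x)"
  by (rule AE_lebesgue_on_iff[OF open_\<Omega>])

lemma res_emb: "f \<in> L2 (lebesgue_on \<Omega>) \<Longrightarrow> res (emb f) = emb f"
  unfolding res_to_l2[OF emb_L2] by (rule arg_cong[of _ _ to_l2]) (auto simp: fun_eq_iff chi_def)

lemma emb_rep: "emb (rep_l2 x) = res x"
  unfolding mul_def by (rule arg_cong[of _ _ to_l2]) (auto simp: fun_eq_iff chi_def)

lemma wt_mult_integrable:
  assumes \<psi>: "\<psi> \<in> test_functions \<Omega>"
  shows "integrable lebesgue (\<lambda>t. rep_l2 z t * wt \<psi> t)"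
  by (rule L2_integral_mult_le(1)[OF rep_l2_in wt_L2[OF \<psi>]])

text \<open>The sum of the pairings of \<open>z\<close> with \<open>\<psi> / m\<close> and of
  \<open>y\<close> with the gradient of \<open>\<psi>\<close>. It is bilinear without conjugation,
  matching \<open>regular_distr\<close>.\<close>

definition weak_form :: "('a, complex) l2 \<Rightarrow> ('a, 'a \<times> 'a) l2 \<Rightarrow> ('a \<Rightarrow> complex) \<Rightarrow> complex" where
  "weak_form z y \<psi> = (LINT t|lebesgue. rep_l2 z t * wt \<psi> t) + 
     (\<Sum>b\<in>Basis. LINT t|lebesgue. ccomp b (rep_l2 y t) * partial b \<psi> t)"

lemma ccomp_mult_integrable:
  assumes \<psi>: "\<psi> \<in> test_functions \<Omega>" and b: "b \<in> Basis"
  shows "integrable lebesgue (\<lambda>t. ccomp b (rep_l2 y t) * partial b \<psi> t)"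
  by (rule L2_integral_mult_le(1)[OF ccomp_L2[OF rep_l2_in b] test_L2[OF test_partial[OF \<psi> b]]])

lemma weak_form_cmult:
  assumes \<psi>: "\<psi> \<in> test_functions \<Omega>"
  shows "weak_form z y (\<lambda>x. c * \<psi> x) = c * weak_form z y \<psi>"
proof -
  have "(LINT t|lebesgue. rep_l2 z t * wt (\<lambda>x. c * \<psi> x) t) = c * (LINT t|lebesgue. rep_l2 z t * wt \<psi> t)"
    by (subst integral_mult_right_zero[symmetric], rule Bochner_Integration.integral_cong) (simp_all add: wt_def)
  moreover have "(LINT t|lebesgue. ccomp b (rep_l2 y t) * partial b (\<lambda>x. c * \<psi> x) t) =
    c * (LINT t|lebesgue. ccomp b (rep_l2 y t) * partial b \<psi> t)" for b
    by (subst integral_mult_right_zero[symmetric], rule Bochner_Integration.integral_cong)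
      (simp_all add: partial_cmult[OF test_functions_smooth[OF \<psi>]])
  ultimately show ?thesis by (simp add: weak_form_def distrib_left sum_distrib_left)
qed

text \<open>The conjugate compensates for the one hidden in the real inner product. Hypothesis
  \<open>out\<close> removes the arbitrary values of \<open>w\<close> outside \<Omega>.\<close>

lemma inner_eq_weak_form:
  assumes \<phi>: "\<phi> \<in> test_functions \<Omega>" and w: "w \<in> L2 lebesgue" "AE x in lebesgue. x \<in> \<Omega> \<longrightarrow> w x = wt \<phi> x"
    and out: "AE x in lebesgue. x \<notin> \<Omega> \<longrightarrow> rep_l2 z x * cnj (w x) = 0"
  shows "z \<bullet> to_l2 w + y \<bullet> to_l2 (grad \<phi>) = Re (weak_form z y (\<lambda>x. cnj (\<phi> x)))"
proof -
  note s = test_functions_smooth[OF \<phi>] and c = test_cnj[OF \<phi>]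
  have "z \<bullet> to_l2 w = to_l2 (rep_l2 z) \<bullet> to_l2 w" by simp
  also have "\<dots> = (LINT t|lebesgue. rep_l2 z t \<bullet> w t)" by (rule to_l2_inner[OF rep_l2_in w(1)])
  also have "\<dots> = (LINT t|lebesgue. Re (rep_l2 z t * wt (\<lambda>x. cnj (\<phi> x)) t))"
  proof (rule integral_cong_AE)
    show "(\<lambda>t. rep_l2 z t \<bullet> w t) \<in> borel_measurable lebesgue"
      by (rule borel_measurable_integrable[OF L2_inner_integrable[OF rep_l2_in w(1)]])
    show "(\<lambda>t. Re (rep_l2 z t * wt (\<lambda>x. cnj (\<phi> x)) t)) \<in> borel_measurable lebesgue"
      by (rule borel_measurable_integrable[OF integrable_bounded_linear[OF bounded_linear_Re wt_mult_integrable[OF c]]])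
    show "AE t in lebesgue. rep_l2 z t \<bullet> w t = Re (rep_l2 z t * wt (\<lambda>x. cnj (\<phi> x)) t)"
      using w(2) out
    proof eventually_elim
      case (elim t)
      have "rep_l2 z t * cnj (w t) = rep_l2 z t * wt (\<lambda>x. cnj (\<phi> x)) t"
        using elim by (cases "t \<in> \<Omega>") (simp_all add: wt_def \<rho>_def)
      then show ?case by (simp only: inner_complex_eq)
    qed
  qed
  also have "\<dots> = Re (LINT t|lebesgue. rep_l2 z t * wt (\<lambda>x. cnj (\<phi> x)) t)"
    by (rule integral_bounded_linear[OF bounded_linear_Re wt_mult_integrable[OF c]])
  finally have 1: "z \<bullet> to_l2 w = Re (LINT t|lebesgue. rep_l2 z t * wt (\<lambda>x. cnj (\<phi> x)) t)" .
  have "y \<bullet> to_l2 (grad \<phi>) = to_l2 (rep_l2 y) \<bullet> to_l2 (grad \<phi>)" by simp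
  also have "\<dots> = (LINT t|lebesgue. rep_l2 y t \<bullet> grad \<phi> t)" by (rule to_l2_inner[OF rep_l2_in grad_L2[OF \<phi>]])
  also have "\<dots> = (LINT t|lebesgue. (\<Sum>b\<in>Basis. Re (ccomp b (rep_l2 y t) * partial b (\<lambda>x. cnj (\<phi> x)) t)))"
    unfolding inner_eq_ccomp by (rule Bochner_Integration.integral_cong) (simp_all add: ccomp_grad partial_cnj[OF s])
  also have "\<dots> = (\<Sum>b\<in>Basis. LINT t|lebesgue. Re (ccomp b (rep_l2 y t) * partial b (\<lambda>x. cnj (\<phi> x)) t))"
    by (rule Bochner_Integration.integral_sum) (rule integrable_bounded_linear[OF bounded_linear_Re ccomp_mult_integrable[OF c]])
  also have "\<dots> = (\<Sum>b\<in>Basis. Re (LINT t|lebesgue. ccomp b (rep_l2 y t) * partial b (\<lambda>x. cnj (\<phi> x)) t))"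
    by (rule sum.cong[OF refl]) (rule integral_bounded_linear[OF bounded_linear_Re ccomp_mult_integrable[OF c]])
  finally show ?thesis unfolding 1 weak_form_def by (simp add: Re_sum)
qed

lemma AE_zero_outside:
  assumes "\<And>w. w \<in> L2 lebesgue \<Longrightarrow> (\<And>x. x \<in> \<Omega> \<Longrightarrow> w x = 0) \<Longrightarrow> z \<bullet> to_l2 w = 0"
  shows "AE x in lebesgue. x \<notin> \<Omega> \<longrightarrow> rep_l2 z x = 0"
proof -
  \<comment> \<open>The test function is \<open>z\<close> itself, cut off to the complement of
    \<Omega>.\<close>
  let ?w = "\<lambda>x. indicator (- \<Omega>) x *\<^sub>R rep_l2 z x"
  have "- \<Omega> \<in> sets lebesgue" using sets.compl_sets[OF \<Omega>_sets] by (simp add: Compl_eq_Diff_UNIV)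
  then have w: "?w \<in> L2 lebesgue" by (rule L2_restrict[OF _ rep_l2_in])
  have "to_l2 ?w \<bullet> to_l2 ?w = (LINT t|lebesgue. ?w t \<bullet> ?w t)" by (rule to_l2_inner[OF w w])
  also have "\<dots> = (LINT t|lebesgue. rep_l2 z t \<bullet> ?w t)"
    by (rule Bochner_Integration.integral_cong) (auto simp: indicator_def)
  also have "\<dots> = z \<bullet> to_l2 ?w" using to_l2_inner[OF rep_l2_in w, of z] by simp
  also have "\<dots> = 0" by (rule assms[OF w]) simp
  finally have "to_l2 ?w = 0" by simp
  then have "AE x in lebesgue. ?w x = 0" unfolding zero_l2_def to_l2_eq_iff[OF w L2_zero] .
  then show ?thesis by eventually_elim auto
qed

text \<open>Orthogonality is a closed condition, so it need only be checked on \<open>G0\<close>.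
  There it splits into the arbitrary part outside \<Omega>, which forces \<open>z\<close> to vanish,
  and the test functions.\<close>

lemma form_iff_weak_form:
  "(\<forall>v k. (v, k) \<in> G \<longrightarrow> z \<bullet> v + y \<bullet> k = 0) \<longleftrightarrow>
   (AE x in lebesgue. x \<notin> \<Omega> \<longrightarrow> rep_l2 z x = 0) \<and> (\<forall>\<psi>\<in>test_functions \<Omega>. weak_form z y \<psi> = 0)"
proof (intro iffI conjI ballI)
  assume H: "\<forall>v k. (v, k) \<in> G \<longrightarrow> z \<bullet> v + y \<bullet> k = 0"
  show out: "AE x in lebesgue. x \<notin> \<Omega> \<longrightarrow> rep_l2 z x = 0"
  proof (rule AE_zero_outside)
    fix w :: "'a \<Rightarrow> complex" assume "w \<in> L2 lebesgue" "\<And>x. x \<in> \<Omega> \<Longrightarrow> w x = 0"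
    then have "(to_l2 w, 0) \<in> G" using G0_outside G0_subset_G by blast
    then have "z \<bullet> to_l2 w + y \<bullet> 0 = 0" using H by blast
    then show "z \<bullet> to_l2 w = 0" by simp
  qed
  have re: "Re (weak_form z y \<psi>) = 0" if \<psi>: "\<psi> \<in> test_functions \<Omega>" for \<psi>
  proof -
    note c = test_cnj[OF \<psi>]
    have "z \<bullet> to_l2 (wt (\<lambda>x. cnj (\<psi> x))) + y \<bullet> to_l2 (grad (\<lambda>x. cnj (\<psi> x))) = Re (weak_form z y (\<lambda>x. cnj (cnj (\<psi> x))))"
      by (rule inner_eq_weak_form[OF c wt_L2[OF c]]) (use out in \<open>auto elim: eventually_mono\<close>)
    then show ?thesis using H test_in_G[OF c] by simp
  qed
  fix \<psi> assume \<psi>: "\<psi> \<in> test_functions \<Omega>"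
  \<comment> \<open>The real equation for \<i> times the test function gives the imaginary
    part.\<close>
  have "Re (\<i> * weak_form z y \<psi>) = 0" 
    using re[OF test_cmult[OF \<psi>, of \<i>]] by (simp only: weak_form_cmult[OF \<psi>])
  then show "weak_form z y \<psi> = 0" using re[OF \<psi>] by (simp add: complex_eq_iff)
next
  assume H: "(AE x in lebesgue. x \<notin> \<Omega> \<longrightarrow> rep_l2 z x = 0) \<and> (\<forall>\<psi>\<in>test_functions \<Omega>. weak_form z y \<psi> = 0)"
  let ?K = "{p. z \<bullet> fst p + y \<bullet> snd p = 0}"
  have "closed ?K" by (intro closed_Collect_eq continuous_intros)
  moreover have "G0 \<subseteq> ?K"
  proof
    fix p assume "p \<in> G0"
    then obtain w \<phi> where p: "p = (to_l2 w, to_l2 (grad \<phi>))" "\<phi> \<in> test_functions \<Omega>" "w \<in> L2 lebesgue" 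
      "AE x in lebesgue. x \<in> \<Omega> \<longrightarrow> w x = wt \<phi> x" by (rule G0E)
    have "AE x in lebesgue. x \<notin> \<Omega> \<longrightarrow> rep_l2 z x * cnj (w x) = 0"
      using conjunct1[OF H] by eventually_elim simp
    from inner_eq_weak_form[OF p(2-4) this, of y] show "p \<in> ?K"
      using H test_cnj[OF p(2)] by (simp add: p(1))
  qed
  ultimately have "G \<subseteq> ?K" unfolding G_def by (rule closure_minimal[rotated])
  then show "\<forall>v k. (v, k) \<in> G \<longrightarrow> z \<bullet> v + y \<bullet> k = 0" by auto
qed

text \<open>A vector \<open>z\<close> orthogonal to the domain vanishes outside \<Omega>, and
  \<open>z / m\<close> annihilates all test functions. As a product of two locally square integrable
  functions it is locally integrable, hence zero by the fundamental lemma, and \<open>m\<close> is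
  finite and positive.\<close>

lemma G_dense: "closure (Domain G) = UNIV"
proof (rule dense_subspaceI)
  have "Domain G = fst ` G" by (rule Domain_fst)
  then show "subspace (Domain G)" using linear_subspace_image[OF linear_fst subspace_G] by simp
  fix z :: "('a, complex) l2" assume orth: "\<And>s. s \<in> Domain G \<Longrightarrow> z \<bullet> s = 0"
  have "\<forall>v k. (v, k) \<in> G \<longrightarrow> z \<bullet> v + 0 \<bullet> k = 0" using orth by auto
  then have out: "AE x in lebesgue. x \<notin> \<Omega> \<longrightarrow> rep_l2 z x = 0" and wf: "\<And>\<psi>. \<psi> \<in> test_functions \<Omega> \<Longrightarrow> weak_form z 0 \<psi> = 0"
    using form_iff_weak_form[of z 0] by blast+
  have r0: "AE t in lebesgue. rep_l2 (0 :: ('a, 'a \<times> 'a) l2) t = 0"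
    unfolding zero_l2_def by (rule rep_to_l2[OF L2_zero])
  let ?g = "\<lambda>t. \<rho> t *\<^sub>R rep_l2 z t"
  have "AE x in lebesgue_on \<Omega>. ?g x = 0"
  proof (rule AE_zero_if_test_integrals_zero[OF open_\<Omega>])
    fix a b assume ab: "cbox a b \<subseteq> \<Omega>"
    have "(\<lambda>x. 1 / m x) \<in> L2 (lebesgue_on (cbox a b))" using inv_m_L2_loc ab by (simp add: L2_loc_def)
    then have k: "(\<lambda>x. indicator (cbox a b) x *\<^sub>R (1 / m x)) \<in> L2 lebesgue"
      using L2_lebesgue_on_measurable_iff[of "cbox a b" "\<lambda>x. 1 / m x"] by simp
    have "(\<lambda>x. complex_of_real (indicator (cbox a b) x *\<^sub>R (1 / m x))) \<in> L2 lebesgue"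
    proof (rule L2_dominated[OF _ k, of _ 1])
      show "(\<lambda>x. complex_of_real (indicator (cbox a b) x *\<^sub>R (1 / m x))) \<in> borel_measurable lebesgue"
        by (rule borel_measurable_continuous_on[OF _ L2_D(1)[OF k]]) (intro continuous_intros)
      show "AE x in lebesgue. norm (complex_of_real (indicator (cbox a b) x *\<^sub>R (1 / m x))) \<le> 
          1 * norm (indicator (cbox a b) x *\<^sub>R (1 / m x))"
        by (simp only: norm_of_real) simp
    qed
    from L2_integral_mult_le(1)[OF this rep_l2_in, of z]
    have "integrable lebesgue (\<lambda>x. complex_of_real (indicator (cbox a b) x *\<^sub>R (1 / m x)) * rep_l2 z x)" .
    moreover have "(\<lambda>x. complex_of_real (indicator (cbox a b) x *\<^sub>R (1 / m x)) * rep_l2 z x) = 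
      (\<lambda>x. indicator (cbox a b) x *\<^sub>R ?g x)"
      using ab by (auto simp: fun_eq_iff \<rho>_def scaleR_conv_of_real split: split_indicator)
    ultimately show "integrable lebesgue (\<lambda>x. indicator (cbox a b) x *\<^sub>R ?g x)" by (simp only:)
  next
    fix \<psi> assume \<psi>: "\<psi> \<in> test_functions \<Omega>"
    have "(LINT t|lebesgue. ccomp b (rep_l2 (0 :: ('a, 'a \<times> 'a) l2) t) * partial b \<psi> t) = 0" for b
      using r0 by (intro integral_eq_zero_AE) (auto elim!: eventually_mono simp: ccomp_def complex_eq_iff)
    then have "(LINT t|lebesgue. rep_l2 z t * wt \<psi> t) = 0" using wf[OF \<psi>] by (simp add: weak_form_def)
    moreover have "(LINT x|lebesgue_on \<Omega>. ?g x * \<psi> x) = (LINT t|lebesgue. rep_l2 z t * wt \<psi> t)"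
      unfolding integral_lebesgue_on_open[OF open_\<Omega>]
      by (rule Bochner_Integration.integral_cong) (auto simp: wt_def \<rho>_def split: split_indicator)
    ultimately show "(LINT x|lebesgue_on \<Omega>. ?g x * \<psi> x) = 0" by simp
  qed
  then have "AE x in lebesgue. x \<in> \<Omega> \<longrightarrow> ?g x = 0" unfolding AE_on_iff .
  with out have "AE x in lebesgue. rep_l2 z x = 0"
  proof eventually_elim
    case (elim x)
    then show ?case using \<rho>_pos[of x] by (cases "x \<in> \<Omega>") auto
  qed
  then show "z = 0" using to_l2_eq_iff[OF rep_l2_in[of z] L2_zero] by (simp add: zero_l2_def)
qed

text \<open>From here on \<open>J\<close> and \<open>S\<close> are the resolvents and the semigroup
  of \<open>form_op G\<close> on the whole space.\<close>

sublocale m_dissipative "form_op G"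
  by (rule m_dissipative_form_op[OF closed_G subspace_G G_dense])

section \<open>Identification with the distributional operator\<close>

lemma G_weak_derivative:
  assumes \<phi>: "\<And>n. \<phi> n \<in> test_functions \<Omega>" "(\<lambda>n. to_l2 (grad (\<phi> n))) \<longlonglongrightarrow> y" 
    and u: "u \<in> L2 lebesgue" "(\<lambda>n. to_l2 (\<phi> n)) \<longlonglongrightarrow> to_l2 u"
    and \<psi>: "\<psi> \<in> test_functions \<Omega>" and b: "b \<in> Basis"
  shows "- (LINT t|lebesgue. u t * partial b \<psi> t) = (LINT t|lebesgue. ccomp b (rep_l2 y t) * \<psi> t)"
proof (rule LIMSEQ_unique)
  have "(\<lambda>n. LINT t|lebesgue. \<phi> n t * partial b \<psi> t) \<longlonglongrightarrow> (LINT t|lebesgue. u t * partial b \<psi> t)"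
    by (rule L2_integral_mult_tendsto[OF test_L2[OF \<phi>(1)] u test_L2[OF test_partial[OF \<psi> b]]])
  then show "(\<lambda>n. - (LINT t|lebesgue. \<phi> n t * partial b \<psi> t)) \<longlonglongrightarrow> - (LINT t|lebesgue. u t * partial b \<psi> t)"
    by (rule tendsto_minus)
  have y: "(\<lambda>n. to_l2 (grad (\<phi> n))) \<longlonglongrightarrow> to_l2 (rep_l2 y)" using \<phi>(2) by simp
  have "(\<lambda>n. LINT t|lebesgue. ccomp b (grad (\<phi> n) t) * \<psi> t) \<longlonglongrightarrow> (LINT t|lebesgue. ccomp b (rep_l2 y t) * \<psi> t)"
    by (rule L2_integral_mult_tendsto[OF ccomp_L2[OF grad_L2[OF \<phi>(1)] b] ccomp_L2[OF rep_l2_in b] 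
          ccomp_tendsto[OF grad_L2[OF \<phi>(1)] rep_l2_in y b] test_L2[OF \<psi>]])
  moreover have "(LINT t|lebesgue. ccomp b (grad (\<phi> n) t) * \<psi> t) = - (LINT t|lebesgue. \<phi> n t * partial b \<psi> t)" for n
    using test_integration_by_parts[OF \<psi> test_functions_smooth[OF \<phi>(1)] b] by (simp add: ccomp_grad[OF b])
  ultimately show "(\<lambda>n. - (LINT t|lebesgue. \<phi> n t * partial b \<psi> t)) \<longlonglongrightarrow> (LINT t|lebesgue. ccomp b (rep_l2 y t) * \<psi> t)"
    by simp
qed

lemma integral_on_eq_AE:
  fixes f g :: "'a \<Rightarrow> complex"
  assumes f: "f \<in> borel_measurable (lebesgue_on \<Omega>)" and g: "g \<in> borel_measurable lebesgue"
    and eq: "AE t in lebesgue. indicator \<Omega> t *\<^sub>R f t = g t"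
  shows "(LINT t|lebesgue_on \<Omega>. f t) = (LINT t|lebesgue. g t)"
  unfolding integral_lebesgue_on_open[OF open_\<Omega>]
proof (rule integral_cong_AE[OF _ g eq])
  show "(\<lambda>t. indicator \<Omega> t *\<^sub>R f t) \<in> borel_measurable lebesgue"
    using f \<Omega>_sets by (subst borel_measurable_restrict_space_iff[symmetric]) simp_all
qed

abbreviation mtimes :: "('a \<Rightarrow> complex) \<Rightarrow> 'a \<Rightarrow> complex" where
  "mtimes w \<equiv> \<lambda>x. complex_of_real (m x) * w x"

lemma mtimes_measurable:
  "w \<in> L2 (lebesgue_on \<Omega>) \<Longrightarrow> mtimes w \<in> borel_measurable (lebesgue_on \<Omega>)"
  by (intro borel_measurable_times L2_D(1) borel_measurable_continuous_on[OF _ m_measurable, of complex_of_real])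
    (auto intro!: continuous_intros)

end

lemma blend_measurable:
  assumes "f \<in> borel_measurable M" "g \<in> borel_measurable M"
  shows "(\<lambda>x. blend e (f x) (g x)) \<in> borel_measurable M"
proof -
  have c: "(\<lambda>x. cnj (h x)) \<in> borel_measurable M" if "h \<in> borel_measurable M" for h
    by (rule borel_measurable_continuous_on[OF _ that]) (intro continuous_intros)
  show ?thesis unfolding blend_def
    by (intro borel_measurable_times borel_measurable_add borel_measurable_inverse borel_measurable_const c assms)
qed

lemma trunc_measurable:
  assumes "e \<ge> 0" "f \<in> borel_measurable M"
  shows "(\<lambda>x. trunc e (f x)) \<in> borel_measurable M"
proof (rule borel_measurable_continuous_on[OF _ assms(2)])
  show "continuous_on UNIV (trunc e)" unfolding trunc_def[abs_def] by (intro continuous_intros) auto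
qed

context weighted_domain
begin

lemma mtimes_eq:
  assumes w: "w \<in> L2 (lebesgue_on \<Omega>)" and u: "AE t in lebesgue. wt u t = chi t * rep_l2 (emb w) t"
    "AE t in lebesgue. t \<notin> \<Omega> \<longrightarrow> u t = 0"
  shows "AE t in lebesgue. indicator \<Omega> t *\<^sub>R mtimes w t = u t"
  using u rep_emb[OF w]
proof eventually_elim
  case (elim t)
  show ?case
  proof (cases "t \<in> \<Omega>")
    case True
    have "w t = u t / complex_of_real (m t)" using elim(1,3) True by (simp add: wt_def \<rho>_def chi_def scaleR_conv_of_real)
    then show ?thesis using True m_pos[OF True] by simp
  qed (use elim(2) in simp)
qed

lemma measurable_on: "f \<in> borel_measurable lebesgue \<Longrightarrow> f \<in> borel_measurable (lebesgue_on \<Omega>)"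
  by (rule measurable_restrict_space1)

lemma test_measurable: "\<psi> \<in> test_functions \<Omega> \<Longrightarrow> \<psi> \<in> borel_measurable lebesgue"
  by (rule smooth_measurable(2)[OF test_functions_smooth])

text \<open>The test functions witnessing membership in \<open>G\<close> also converge in the
  \<open>H1\<close> norm: the Poincare inequality, through \<open>G_approx\<close>, controls the
  functions, and the limit of the gradients is the weak gradient.\<close>

lemma emb_G_weak_partial:
  assumes w: "w \<in> L2 (lebesgue_on \<Omega>)" and G: "(emb w, y) \<in> G"
  shows "mtimes w \<in> L2 (lebesgue_on \<Omega>)"
    and "\<And>b. b \<in> Basis \<Longrightarrow> has_weak_partial \<Omega> b (mtimes w) (\<lambda>t. ccomp b (rep_l2 y t))"
    and "mtimes w \<in> H1_0 \<Omega>"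
proof -
  obtain \<phi> u where \<phi>: "\<And>n. \<phi> n \<in> test_functions \<Omega>" "(\<lambda>n. to_l2 (grad (\<phi> n))) \<longlonglongrightarrow> y"
    and u: "u \<in> L2 lebesgue" "(\<lambda>n. to_l2 (\<phi> n)) \<longlonglongrightarrow> to_l2 u"
    and ae: "AE t in lebesgue. wt u t = chi t * rep_l2 (emb w) t" "AE t in lebesgue. t \<notin> \<Omega> \<longrightarrow> u t = 0"
    using G_approx[OF G] by blast
  note eq = mtimes_eq[OF w ae]
  have mm: "(\<lambda>t. indicator \<Omega> t *\<^sub>R mtimes w t) \<in> borel_measurable lebesgue"
    using mtimes_measurable[OF w] \<Omega>_sets by (subst borel_measurable_restrict_space_iff[symmetric]) simp_all
  have mL: "(\<lambda>t. indicator \<Omega> t *\<^sub>R mtimes w t) \<in> L2 lebesgue"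
  proof (rule L2_dominated[OF mm u(1), of 1])
    show "AE t in lebesgue. norm (indicator \<Omega> t *\<^sub>R mtimes w t) \<le> 1 * norm (u t)"
      using eq by eventually_elim (simp only: mult_1 order_refl)
  qed
  show M: "mtimes w \<in> L2 (lebesgue_on \<Omega>)" by (rule iffD2[OF L2_on_iff mL])
  have eu: "to_l2 (\<lambda>t. indicator \<Omega> t *\<^sub>R mtimes w t) = to_l2 u" by (rule iffD2[OF to_l2_eq_iff[OF mL u(1)] eq])
  have cL: "(\<lambda>t. ccomp b (rep_l2 y t)) \<in> L2 (lebesgue_on \<Omega>)" if b: "b \<in> Basis" for b
    by (rule L2_on_lebesgue[OF ccomp_L2[OF rep_l2_in b]])
  show hw: "has_weak_partial \<Omega> b (mtimes w) (\<lambda>t. ccomp b (rep_l2 y t))" if b: "b \<in> Basis" for b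
    unfolding has_weak_partial_iff[OF open_\<Omega>]
  proof (intro conjI ballI cL b)
    fix \<psi> assume \<psi>: "\<psi> \<in> test_functions \<Omega>"
    note d = test_partial[OF \<psi> b]
    have "(LINT x|lebesgue_on \<Omega>. mtimes w x * partial b \<psi> x) = (LINT x|lebesgue. u x * partial b \<psi> x)"
    proof (rule integral_on_eq_AE)
      show "(\<lambda>x. mtimes w x * partial b \<psi> x) \<in> borel_measurable (lebesgue_on \<Omega>)"
        by (intro borel_measurable_times[OF mtimes_measurable[OF w]] measurable_on test_measurable d)
      show "(\<lambda>x. u x * partial b \<psi> x) \<in> borel_measurable lebesgue"
        by (intro borel_measurable_times L2_D(1)[OF u(1)] test_measurable d)
      show "AE t in lebesgue. indicator \<Omega> t *\<^sub>R (mtimes w t * partial b \<psi> t) = u t * partial b \<psi> t"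
        using eq by eventually_elim (simp only: mult_scaleR_left[symmetric])
    qed
    moreover have "(LINT x|lebesgue_on \<Omega>. ccomp b (rep_l2 y x) * \<psi> x) = (LINT x|lebesgue. ccomp b (rep_l2 y x) * \<psi> x)"
    proof (rule integral_on_eq_AE)
      show cm: "(\<lambda>x. ccomp b (rep_l2 y x) * \<psi> x) \<in> borel_measurable lebesgue"
        by (intro borel_measurable_times L2_D(1)[OF ccomp_L2[OF rep_l2_in b]] test_measurable \<psi>)
      then show "(\<lambda>x. ccomp b (rep_l2 y x) * \<psi> x) \<in> borel_measurable (lebesgue_on \<Omega>)" by (rule measurable_on)
      show "AE t in lebesgue. indicator \<Omega> t *\<^sub>R (ccomp b (rep_l2 y t) * \<psi> t) = ccomp b (rep_l2 y t) * \<psi> t"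
        using test_nonzero_in[OF \<psi>] by (intro AE_I2) (auto split: split_indicator)
    qed
    ultimately show "- (LINT x|lebesgue_on \<Omega>. mtimes w x * partial b \<psi> x) = (LINT x|lebesgue_on \<Omega>. ccomp b (rep_l2 y x) * \<psi> x)"
      using G_weak_derivative[OF \<phi> u \<psi> b] by (simp only:)
  qed
  have H1: "mtimes w \<in> H1 \<Omega>" unfolding H1_def using M hw by blast
  have y: "(\<lambda>n. to_l2 (grad (\<phi> n))) \<longlonglongrightarrow> to_l2 (rep_l2 y)" using \<phi>(2) by simp
  let ?a = "\<lambda>n. norm (to_l2 (\<phi> n) - to_l2 u)"
  let ?b = "\<lambda>b n. norm (to_l2 (partial b (\<phi> n)) - to_l2 (\<lambda>t. ccomp b (rep_l2 y t)))"
  have \<phi>M: "\<phi> n \<in> L2 (lebesgue_on \<Omega>)" for n by (rule L2_on_lebesgue[OF test_L2[OF \<phi>(1)]])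
  have n1: "L2_norm (lebesgue_on \<Omega>) (\<lambda>x. \<phi> n x - mtimes w x) = ?a n" for n
  proof -
    have "(\<lambda>x. indicator \<Omega> x *\<^sub>R (\<phi> n x - mtimes w x)) = (\<lambda>x. \<phi> n x - indicator \<Omega> x *\<^sub>R mtimes w x)"
      using test_nonzero_in[OF \<phi>(1)] by (auto simp: fun_eq_iff split: split_indicator)
    then show ?thesis 
      by (simp only: L2_norm_lebesgue_on[OF open_\<Omega> L2_diff[OF \<phi>M M]] to_l2_diff[OF test_L2[OF \<phi>(1)] mL, symmetric] eu)
  qed
  have n2: "L2_norm (lebesgue_on \<Omega>) (weak_partial \<Omega> b (\<lambda>x. \<phi> n x - mtimes w x)) \<le> ?b b n" if b: "b \<in> Basis" for b n
  proof -
    note pL = test_L2[OF test_partial[OF \<phi>(1) b]] and cL' = ccomp_L2[OF rep_l2_in b]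
    have "has_weak_partial \<Omega> b (\<lambda>x. \<phi> n x - mtimes w x) (\<lambda>x. partial b (\<phi> n) x - ccomp b (rep_l2 y x))"
      by (rule has_weak_partial_diff[OF open_\<Omega> b \<phi>M M test_has_weak_partial[OF open_\<Omega> \<phi>(1) b] hw[OF b]])
    from weak_partial_eq(2)[OF open_\<Omega> this]
    have "L2_norm (lebesgue_on \<Omega>) (weak_partial \<Omega> b (\<lambda>x. \<phi> n x - mtimes w x)) = 
        emb_norm" if "emb_norm = norm (emb (\<lambda>x. partial b (\<phi> n) x - ccomp b (rep_l2 y x)))" for emb_norm
      unfolding that using L2_norm_lebesgue_on[OF open_\<Omega> L2_on_lebesgue[OF L2_diff[OF pL cL']]] by simp
    then have "L2_norm (lebesgue_on \<Omega>) (weak_partial \<Omega> b (\<lambda>x. \<phi> n x - mtimes w x)) = 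
        norm (emb (\<lambda>x. partial b (\<phi> n) x - ccomp b (rep_l2 y x)))" by blast
    also have "\<dots> \<le> norm (to_l2 (\<lambda>x. partial b (\<phi> n) x - ccomp b (rep_l2 y x)))"
      by (intro norm_to_l2_le L2_restrict[OF \<Omega>_sets] L2_diff pL cL' AE_I2) (simp split: split_indicator)
    finally show ?thesis by (simp only: to_l2_diff[OF pL cL'])
  qed
  have "(\<lambda>n. H1_norm \<Omega> (\<lambda>x. \<phi> n x - mtimes w x)) \<longlonglongrightarrow> 0"
  proof (rule tendsto_sandwich[where f="\<lambda>_. 0" and h="\<lambda>n. sqrt ((?a n)\<^sup>2 + (\<Sum>b\<in>Basis. (?b b n)\<^sup>2))"])
    have a: "?a \<longlonglongrightarrow> 0" using u(2) by (intro tendsto_norm_zero) (simp add: LIM_zero_iff)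
    have b: "?b b \<longlonglongrightarrow> 0" if b: "b \<in> Basis" for b
    proof -
      have "(\<lambda>n. to_l2 (\<lambda>x. ccomp b (grad (\<phi> n) x))) \<longlonglongrightarrow> to_l2 (\<lambda>t. ccomp b (rep_l2 y t))"
        by (rule ccomp_tendsto[OF grad_L2[OF \<phi>(1)] rep_l2_in y b])
      then show ?thesis by (intro tendsto_norm_zero) (simp add: LIM_zero_iff ccomp_grad[OF b])
    qed
    have "(\<lambda>n. sqrt ((?a n)\<^sup>2 + (\<Sum>b\<in>Basis. (?b b n)\<^sup>2))) \<longlonglongrightarrow> sqrt (0\<^sup>2 + (\<Sum>b\<in>(Basis::'a set). 0\<^sup>2))"
      by (intro tendsto_intros a b)
    then show "(\<lambda>n. sqrt ((?a n)\<^sup>2 + (\<Sum>b\<in>Basis. (?b b n)\<^sup>2))) \<longlonglongrightarrow> 0" by simp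
    show "\<forall>\<^sub>F n in sequentially. H1_norm \<Omega> (\<lambda>x. \<phi> n x - mtimes w x) \<le> sqrt ((?a n)\<^sup>2 + (\<Sum>b\<in>Basis. (?b b n)\<^sup>2))"
      unfolding H1_norm_def n1
      by (intro always_eventually allI real_sqrt_le_mono add_left_mono sum_mono power_mono n2) (simp_all add: L2_norm_def)
    show "\<forall>\<^sub>F n in sequentially. 0 \<le> H1_norm \<Omega> (\<lambda>x. \<phi> n x - mtimes w x)"
      by (auto simp: H1_norm_def intro!: always_eventually add_nonneg_nonneg sum_nonneg)
  qed simp
  then show "mtimes w \<in> H1_0 \<Omega>" unfolding H1_0_def using H1 \<phi>(1) by blast
qed

text \<open>The two signs of \<open>distr_partial\<close> cancel, so the Laplacian pairs
  \<open>m w\<close> with second derivatives of \<open>\<psi>\<close>. The weak derivative tested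
  with \<open>partial b \<psi>\<close> removes one of them and leaves minus the pairing of the
  gradients; moving it to the other side gives the weak form with \<open>z = f\<close>.\<close>

lemma laplacian_iff_weak_form:
  assumes w: "w \<in> L2 (lebesgue_on \<Omega>)" and f: "f \<in> L2 (lebesgue_on \<Omega>)" and G: "(emb w, y) \<in> G"
  shows "distr_eq \<Omega> (distr_laplacian (regular_distr \<Omega> (mtimes w))) (regular_distr \<Omega> (\<lambda>x. f x / complex_of_real (m x)))
    \<longleftrightarrow> (\<forall>\<psi>\<in>test_functions \<Omega>. weak_form (emb f) y \<psi> = 0)"
  unfolding distr_eq_def
proof (rule ball_cong[OF refl])
  fix \<psi> assume \<psi>: "\<psi> \<in> test_functions \<Omega>"
  have 1: "regular_distr \<Omega> (mtimes w) (partial b (partial b \<psi>)) = - (LINT t|lebesgue. ccomp b (rep_l2 y t) * partial b \<psi> t)"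
    if b: "b \<in> Basis" for b
  proof -
    note d = test_partial[OF \<psi> b]
    have "- (LINT x|lebesgue_on \<Omega>. mtimes w x * partial b (partial b \<psi>) x) = 
        (LINT x|lebesgue_on \<Omega>. ccomp b (rep_l2 y x) * partial b \<psi> x)"
      using emb_G_weak_partial(2)[OF w G b] d by (simp add: has_weak_partial_iff[OF open_\<Omega>])
    also have "\<dots> = (LINT x|lebesgue. ccomp b (rep_l2 y x) * partial b \<psi> x)"
    proof (rule integral_on_eq_AE)
      show cm: "(\<lambda>x. ccomp b (rep_l2 y x) * partial b \<psi> x) \<in> borel_measurable lebesgue"
        by (intro borel_measurable_times L2_D(1)[OF ccomp_L2[OF rep_l2_in b]] test_measurable d)
      then show "(\<lambda>x. ccomp b (rep_l2 y x) * partial b \<psi> x) \<in> borel_measurable (lebesgue_on \<Omega>)" by (rule measurable_on)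
      show "AE t in lebesgue. indicator \<Omega> t *\<^sub>R (ccomp b (rep_l2 y t) * partial b \<psi> t) = ccomp b (rep_l2 y t) * partial b \<psi> t"
        using test_nonzero_in[OF d] by (intro AE_I2) (auto split: split_indicator)
    qed
    finally show ?thesis unfolding regular_distr_def by (metis minus_minus)
  qed
  have 2: "regular_distr \<Omega> (\<lambda>x. f x / complex_of_real (m x)) \<psi> = (LINT t|lebesgue. rep_l2 (emb f) t * wt \<psi> t)"
    unfolding regular_distr_def
  proof (rule integral_on_eq_AE)
    have "(\<lambda>x. complex_of_real (m x)) \<in> borel_measurable (lebesgue_on \<Omega>)"
      by (rule borel_measurable_continuous_on[OF _ m_measurable]) (intro continuous_intros)
    then show "(\<lambda>x. f x / complex_of_real (m x) * \<psi> x) \<in> borel_measurable (lebesgue_on \<Omega>)"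
      by (rule borel_measurable_times[OF borel_measurable_divide[OF L2_D(1)[OF f]] measurable_on[OF test_measurable[OF \<psi>]]])
    show "(\<lambda>t. rep_l2 (emb f) t * wt \<psi> t) \<in> borel_measurable lebesgue"
      by (rule borel_measurable_integrable[OF wt_mult_integrable[OF \<psi>]])
    show "AE t in lebesgue. indicator \<Omega> t *\<^sub>R (f t / complex_of_real (m t) * \<psi> t) = rep_l2 (emb f) t * wt \<psi> t"
      using rep_emb[OF f]
      by eventually_elim (auto simp: wt_def \<rho>_def scaleR_conv_of_real split: split_indicator)
  qed
  have "distr_laplacian (regular_distr \<Omega> (mtimes w)) \<psi> = 
      (\<Sum>b\<in>Basis. - (LINT t|lebesgue. ccomp b (rep_l2 y t) * partial b \<psi> t))"
    unfolding distr_laplacian_def distr_partial_def by (rule sum.cong) (simp_all add: 1)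
  then show "distr_laplacian (regular_distr \<Omega> (mtimes w)) \<psi> = regular_distr \<Omega> (\<lambda>x. f x / complex_of_real (m x)) \<psi>
    \<longleftrightarrow> weak_form (emb f) y \<psi> = 0"
    unfolding weak_form_def 2 by (simp add: sum_negf neg_eq_iff_add_eq_0 add.commute)
qed

lemma norm_to_l2_grad:
  assumes \<phi>: "\<phi> \<in> test_functions \<Omega>"
  shows "(norm (to_l2 (grad \<phi>)))\<^sup>2 = (\<Sum>b\<in>Basis. (norm (to_l2 (partial b \<phi>)))\<^sup>2)"
  unfolding norm_to_l2[OF grad_L2[OF \<phi>]] norm_grad
  using norm_to_l2[OF test_L2[OF test_partial[OF \<phi>]]] test_norm_sq_integrable[OF test_partial[OF \<phi>]]
  by (subst Bochner_Integration.integral_sum) auto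

text \<open>Keeps from convergence in \<open>H1\<close> only what the blending argument uses: almost
  everywhere convergence of a subsequence and bounded gradients.\<close>

lemma H1_0_approx:
  assumes mw: "u \<in> H1_0 \<Omega>"
  obtains \<phi> c where "\<And>n. \<phi> n \<in> test_functions \<Omega>" "\<And>n. norm (to_l2 (grad (\<phi> n))) \<le> c"
    "AE t in lebesgue. (\<lambda>n. \<phi> n t) \<longlonglongrightarrow> indicator \<Omega> t *\<^sub>R u t"
proof -
  obtain \<phi> where \<phi>: "\<And>n. \<phi> n \<in> test_functions \<Omega>" "(\<lambda>n. H1_norm \<Omega> (\<lambda>x. \<phi> n x - u x)) \<longlonglongrightarrow> 0"
    and H1: "u \<in> H1 \<Omega>" using mw unfolding H1_0_def by blast
  have uM: "u \<in> L2 (lebesgue_on \<Omega>)" using H1 by (simp add: H1_def)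
  have "\<forall>b. \<exists>g. b \<in> Basis \<longrightarrow> has_weak_partial \<Omega> b u g" using H1 by (auto simp: H1_def)
  from choice[OF this] obtain g where g: "\<And>b. b \<in> Basis \<Longrightarrow> has_weak_partial \<Omega> b u (g b)" by blast
  have \<phi>M: "\<phi> n \<in> L2 (lebesgue_on \<Omega>)" for n by (rule L2_on_lebesgue[OF test_L2[OF \<phi>(1)]])
  let ?N = "\<lambda>n. H1_norm \<Omega> (\<lambda>x. \<phi> n x - u x)"
  have uL: "(\<lambda>x. indicator \<Omega> x *\<^sub>R u x) \<in> L2 lebesgue" by (rule emb_L2[OF uM])
  have "norm (to_l2 (\<phi> n) - emb u) \<le> ?N n" for n
  proof -
    have "(\<lambda>x. indicator \<Omega> x *\<^sub>R (\<phi> n x - u x)) = (\<lambda>x. \<phi> n x - indicator \<Omega> x *\<^sub>R u x)"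
      using test_nonzero_in[OF \<phi>(1)] by (auto simp: fun_eq_iff split: split_indicator)
    then have "norm (to_l2 (\<phi> n) - emb u) = L2_norm (lebesgue_on \<Omega>) (\<lambda>x. \<phi> n x - u x)"
      by (simp only: L2_norm_lebesgue_on[OF open_\<Omega> L2_diff[OF \<phi>M uM]] to_l2_diff[OF test_L2[OF \<phi>(1)] uL, symmetric])
    also have "\<dots> \<le> ?N n"
      unfolding H1_norm_def by (rule real_le_rsqrt) (simp add: sum_nonneg)
    finally show ?thesis .
  qed
  then have "(\<lambda>n. to_l2 (\<phi> n) - emb u) \<longlonglongrightarrow> 0" by (intro Lim_null_comparison[OF _ \<phi>(2)]) simp
  then have lim: "(\<lambda>n. to_l2 (\<phi> n)) \<longlonglongrightarrow> emb u" by (simp add: LIM_zero_iff)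
  obtain r where r: "strict_mono (r :: nat \<Rightarrow> nat)" "AE t in lebesgue. (\<lambda>n. \<phi> (r n) t) \<longlonglongrightarrow> indicator \<Omega> t *\<^sub>R u t"
    using to_l2_tendsto_AE_subseq[OF test_L2[OF \<phi>(1)] uL lim] by blast
  obtain C where C: "\<And>n. norm (?N n) \<le> C" 
    using BseqE[OF convergent_imp_Bseq[OF convergentI[OF \<phi>(2)]]] by metis
  have pb: "norm (to_l2 (partial b (\<phi> n))) \<le> norm (emb (g b)) + C" if b: "b \<in> Basis" for b n
  proof -
    have gM: "g b \<in> L2 (lebesgue_on \<Omega>)" using g[OF b] by (simp add: has_weak_partial_iff[OF open_\<Omega>])
    note pL = test_L2[OF test_partial[OF \<phi>(1) b]] and gL = emb_L2[OF gM]
    have "has_weak_partial \<Omega> b (\<lambda>x. \<phi> n x - u x) (\<lambda>x. partial b (\<phi> n) x - g b x)"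
      by (rule has_weak_partial_diff[OF open_\<Omega> b \<phi>M uM test_has_weak_partial[OF open_\<Omega> \<phi>(1) b] g[OF b]])
    from weak_partial_eq(2)[OF open_\<Omega> this]
    have "L2_norm (lebesgue_on \<Omega>) (weak_partial \<Omega> b (\<lambda>x. \<phi> n x - u x)) = norm (emb (\<lambda>x. partial b (\<phi> n) x - g b x))"
      using L2_norm_lebesgue_on[OF open_\<Omega> L2_diff[OF L2_on_lebesgue[OF pL] gM]] by simp
    moreover have "(\<lambda>x. indicator \<Omega> x *\<^sub>R (partial b (\<phi> n) x - g b x)) = (\<lambda>x. partial b (\<phi> n) x - indicator \<Omega> x *\<^sub>R g b x)"
      using test_nonzero_in[OF test_partial[OF \<phi>(1) b]] by (auto simp: fun_eq_iff split: split_indicator)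
    ultimately have e: "L2_norm (lebesgue_on \<Omega>) (weak_partial \<Omega> b (\<lambda>x. \<phi> n x - u x)) = norm (to_l2 (partial b (\<phi> n)) - emb (g b))"
      by (simp only: to_l2_diff[OF pL gL])
    have "(L2_norm (lebesgue_on \<Omega>) (weak_partial \<Omega> b (\<lambda>x. \<phi> n x - u x)))\<^sup>2 \<le> 
        (\<Sum>b\<in>Basis. (L2_norm (lebesgue_on \<Omega>) (weak_partial \<Omega> b (\<lambda>x. \<phi> n x - u x)))\<^sup>2)"
      by (rule member_le_sum[OF b]) simp_all
    then have "L2_norm (lebesgue_on \<Omega>) (weak_partial \<Omega> b (\<lambda>x. \<phi> n x - u x)) \<le> ?N n"
      unfolding H1_norm_def by (intro real_le_rsqrt) (simp add: add_increasing)
    also have "\<dots> \<le> C" using C[of n] by simp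
    finally show ?thesis unfolding e using norm_triangle_sub[of "to_l2 (partial b (\<phi> n))" "emb (g b)"] by linarith
  qed
  let ?c = "sqrt (\<Sum>b\<in>Basis. (norm (emb (g b)) + C)\<^sup>2)"
  have "norm (to_l2 (grad (\<phi> n))) \<le> ?c" for n
    by (rule real_le_rsqrt) (use norm_to_l2_grad[OF \<phi>(1)] pb in \<open>simp add: sum_mono power_mono\<close>)
  then show ?thesis by (intro that[of "\<lambda>n. \<phi> (r n)" ?c] \<phi>(1) r(2))
qed

text \<open>The quotients \<open>wt (\<phi> n)\<close> need not converge, since nothing bounds them
  uniformly near the boundary. Each blend is dominated in two ways, once for the limit in
  \<open>j\<close> and once for the limit in \<open>n\<close>, and each limit stays in
  \<open>G\<close> because the gradients are bounded.\<close>

lemma H1_0_imp_G: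
  assumes w: "w \<in> L2 (lebesgue_on \<Omega>)" and mw: "mtimes w \<in> H1_0 \<Omega>"
  obtains y where "(emb w, y) \<in> G"
proof -
  obtain \<phi> c where \<phi>: "\<And>n. \<phi> n \<in> test_functions \<Omega>" "\<And>n. norm (to_l2 (grad (\<phi> n))) \<le> c"
    "AE t in lebesgue. (\<lambda>n. \<phi> n t) \<longlonglongrightarrow> indicator \<Omega> t *\<^sub>R mtimes w t" using H1_0_approx[OF mw] by blast
  define u where "u t = indicator \<Omega> t *\<^sub>R mtimes w t" for t
  have lim: "AE t in lebesgue. (\<lambda>n. \<phi> n t) \<longlonglongrightarrow> u t" using \<phi>(3) by (simp only: u_def)
  have um: "u \<in> borel_measurable lebesgue" 
    unfolding u_def[abs_def] using mtimes_measurable[OF w] \<Omega>_sets by (subst borel_measurable_restrict_space_iff[symmetric]) simp_all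
  have wu: "wt u = (\<lambda>t. indicator \<Omega> t *\<^sub>R w t)"
  proof
    fix t show "wt u t = indicator \<Omega> t *\<^sub>R w t"
      using m_pos[of t] by (cases "t \<in> \<Omega>") (auto simp: wt_def u_def \<rho>_def scaleR_conv_of_real)
  qed
  define e where "e n = 1 / real (Suc n)" for n
  have e: "e n > 0" for n by (simp add: e_def)
  have e0: "e \<longlonglongrightarrow> 0" unfolding e_def using LIMSEQ_Suc[OF lim_1_over_n] by simp
  have nwt: "norm (wt f t) = \<rho> t * norm (f t)" for f t using \<rho>_nonneg[of t] by (simp add: wt_def)
  let ?v = "\<lambda>n t. blend (e n) (\<phi> n t) (u t)"
  have "\<exists>d. (to_l2 (wt (?v n)), d) \<in> G \<and> norm d \<le> 8 * c" for n
  proof -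
    define \<psi> where "\<psi> j t = blend (e n) (\<phi> n t) (\<phi> j t)" for j t
    have \<psi>: "\<psi> j \<in> test_functions \<Omega>" for j
      unfolding \<psi>_def[abs_def]
      by (rule test_functions_restrict[OF \<phi>(1)[of n] smooth_blend[OF e test_functions_smooth[OF \<phi>(1)] test_functions_smooth[OF \<phi>(1)]]])
        (simp add: blend_def)
    have gb: "norm (to_l2 (grad (\<psi> j))) \<le> 8 * c" for j
    proof -
      have c0: "c \<ge> 0" by (rule order_trans[OF norm_ge_zero \<phi>(2)])
      have "(norm (to_l2 (grad (\<psi> j))))\<^sup>2 = (LINT t|lebesgue. (norm (grad (\<psi> j) t))\<^sup>2)" by (rule norm_to_l2[OF grad_L2[OF \<psi>]])
      also have "\<dots> \<le> (LINT t|lebesgue. 32 * ((norm (grad (\<phi> n) t))\<^sup>2 + (norm (grad (\<phi> j) t))\<^sup>2))"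
      proof (rule integral_mono)
        show "(norm (grad (\<psi> j) t))\<^sup>2 \<le> 32 * ((norm (grad (\<phi> n) t))\<^sup>2 + (norm (grad (\<phi> j) t))\<^sup>2)" for t
          unfolding \<psi>_def[abs_def] by (rule norm_grad_blend_le[OF e test_functions_smooth[OF \<phi>(1)] test_functions_smooth[OF \<phi>(1)]])
        show "integrable lebesgue (\<lambda>t. (norm (grad (\<psi> j) t))\<^sup>2)" by (rule L2_D(2)[OF grad_L2[OF \<psi>]])
        show "integrable lebesgue (\<lambda>t. 32 * ((norm (grad (\<phi> n) t))\<^sup>2 + (norm (grad (\<phi> j) t))\<^sup>2))"
          by (rule integrable_mult_right[OF Bochner_Integration.integrable_add[OF L2_D(2)[OF grad_L2[OF \<phi>(1)]] L2_D(2)[OF grad_L2[OF \<phi>(1)]]]])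
      qed
      also have "\<dots> = 32 * ((norm (to_l2 (grad (\<phi> n))))\<^sup>2 + (norm (to_l2 (grad (\<phi> j))))\<^sup>2)"
        using L2_D(2)[OF grad_L2[OF \<phi>(1)]] by (simp add: norm_to_l2 grad_L2[OF \<phi>(1)])
      \<comment> \<open>The right hand side is 64 times the square of \<open>c\<close>, which
        explains the bound \<open>8 * c\<close>.\<close>
      also have "\<dots> \<le> 32 * (c\<^sup>2 + c\<^sup>2)" by (intro mult_left_mono add_mono power_mono \<phi>(2)) auto
      also have "\<dots> = (8 * c)\<^sup>2" by (simp add: power2_eq_square)
      finally show ?thesis by (rule power2_le_imp_le) (simp add: c0)
    qed
    \<comment> \<open>First limit: \<open>n\<close> is fixed, and \<open>wt (\<phi> n)\<close> is a
      square integrable majorant because \<open>\<phi> n\<close> has compact support.\<close>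
    have "(\<lambda>j. to_l2 (wt (\<psi> j))) \<longlonglongrightarrow> to_l2 (wt (?v n))"
    proof (rule to_l2_dominated_convergence(3)[OF _ _ wt_L2[OF \<phi>(1)[of n]], of _ _ 1])
      show "wt (\<psi> j) \<in> borel_measurable lebesgue" for j by (rule wt_measurable[OF test_measurable[OF \<psi>]])
      show "wt (?v n) \<in> borel_measurable lebesgue" 
        by (rule wt_measurable[OF blend_measurable[OF test_measurable[OF \<phi>(1)] um]])
      show "AE x in lebesgue. norm (wt (\<psi> j) x) \<le> 1 * norm (wt (\<phi> n) x)" for j
        unfolding nwt \<psi>_def by (intro AE_I2) (simp add: mult_left_mono \<rho>_nonneg norm_blend_le1[OF e])
      show "AE x in lebesgue. (\<lambda>j. wt (\<psi> j) x) \<longlonglongrightarrow> wt (?v n) x" using lim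
      proof eventually_elim
        case (elim x)
        show ?case unfolding wt_def \<psi>_def by (intro tendsto_scaleR tendsto_const blend_tendsto_right[OF e elim])
      qed
    qed
    from closed_subspace_bounded_limit[OF closed_G subspace_G test_in_G[OF \<psi>] this gb tendsto_const]
    show ?thesis by blast
  qed
  then have "\<forall>n. \<exists>d. (to_l2 (wt (?v n)), d) \<in> G \<and> norm d \<le> 8 * c" by blast
  from choice[OF this] obtain d where d: "\<And>n. (to_l2 (wt (?v n)), d n) \<in> G" "\<And>n. norm (d n) \<le> 8 * c" by blast
  \<comment> \<open>Second limit: now \<open>2 |w|\<close> is the majorant, as \<open>wt u\<close>
    is \<open>w\<close> on \<Omega>.\<close>
  have "(\<lambda>n. to_l2 (wt (?v n))) \<longlonglongrightarrow> emb w"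
  proof (rule to_l2_dominated_convergence(3)[OF _ _ emb_L2[OF w], of _ _ 2])
    show "wt (?v n) \<in> borel_measurable lebesgue" for n
      by (rule wt_measurable[OF blend_measurable[OF test_measurable[OF \<phi>(1)] um]])
    show "(\<lambda>x. indicator \<Omega> x *\<^sub>R w x) \<in> borel_measurable lebesgue" by (rule L2_D(1)[OF emb_L2[OF w]])
    show "AE x in lebesgue. norm (wt (?v n) x) \<le> 2 * norm (indicator \<Omega> x *\<^sub>R w x)" for n
      unfolding fun_cong[OF wu, symmetric] nwt
      by (intro AE_I2) (use mult_left_mono[OF norm_blend_le2[OF e] \<rho>_nonneg] in \<open>simp add: mult.left_commute\<close>)
    show "AE x in lebesgue. (\<lambda>n. wt (?v n) x) \<longlonglongrightarrow> indicator \<Omega> x *\<^sub>R w x" using lim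
    proof eventually_elim
      case (elim x)
      have "(\<lambda>n. wt (?v n) x) \<longlonglongrightarrow> wt u x"
        unfolding wt_def by (intro tendsto_scaleR tendsto_const blend_tendsto_diag[OF e e0 elim])
      then show ?case by (simp only: wu)
    qed
  qed
  from closed_subspace_bounded_limit[OF closed_G subspace_G d(1) this d(2) tendsto_const]
  show ?thesis using that by blast
qed

lemma m_Delta_m_iff:
  assumes w: "w \<in> L2 (lebesgue_on \<Omega>)" and f: "f \<in> L2 (lebesgue_on \<Omega>)"
  shows "(w, f) \<in> m_Delta_m \<Omega> m \<longleftrightarrow> (emb w, emb f) \<in> form_op G"
proof -
  have out: "AE x in lebesgue. x \<notin> \<Omega> \<longrightarrow> rep_l2 (emb f) x = 0"
    using rep_emb[OF f] by eventually_elim simp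
  have "(emb w, emb f) \<in> form_op G \<longleftrightarrow> (\<exists>y. (emb w, y) \<in> G \<and> (\<forall>\<psi>\<in>test_functions \<Omega>. weak_form (emb f) y \<psi> = 0))"
    unfolding form_op_def using form_iff_weak_form[of "emb f"] out by simp
  also have "\<dots> \<longleftrightarrow> (\<exists>y. (emb w, y) \<in> G \<and> distr_eq \<Omega> (distr_laplacian (regular_distr \<Omega> (mtimes w))) 
      (regular_distr \<Omega> (\<lambda>x. f x / complex_of_real (m x))))"
    using laplacian_iff_weak_form[OF w f] by blast
  also have "\<dots> \<longleftrightarrow> (w, f) \<in> m_Delta_m \<Omega> m"
    unfolding m_Delta_m_def using w f emb_G_weak_partial(3)[OF w] H1_0_imp_G[OF w] by blast
  finally show ?thesis by blast
qed

section \<open>Truncation and invariance of the convex set\<close>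

text \<open>On \<Omega> the truncation of \<open>w = u / m\<close> at \<open>1 / m\<close> is the
  truncation of \<open>u\<close> at 1 divided by \<open>m\<close>, and the latter is a limit of
  smooth contractions of test functions with no larger gradients. The gradient bound passes to the
  limit by weak closedness of \<open>G\<close>.\<close>

lemma truncation_in_G:
  assumes G: "(w, g) \<in> G"
  obtains w' g' where "(to_l2 w', g') \<in> G" "norm g' \<le> norm g" "w' \<in> L2 lebesgue"
    "AE t in lebesgue. t \<in> \<Omega> \<longrightarrow> w' t = complex_of_real (min (Re (rep_l2 w t)) (\<rho> t))"
    "AE t in lebesgue. t \<notin> \<Omega> \<longrightarrow> w' t = rep_l2 w t"
proof -
  obtain \<phi> u where \<phi>: "\<And>n. \<phi> n \<in> test_functions \<Omega>" "(\<lambda>n. to_l2 (grad (\<phi> n))) \<longlonglongrightarrow> g"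
    and lw: "(\<lambda>n. to_l2 (wt (\<phi> n))) \<longlonglongrightarrow> res w" and u: "u \<in> L2 lebesgue" 
    and "(\<lambda>n. to_l2 (\<phi> n)) \<longlonglongrightarrow> to_l2 u" "AE t in lebesgue. (\<lambda>n. \<phi> n t) \<longlonglongrightarrow> u t"
    and ae: "AE t in lebesgue. wt u t = chi t * rep_l2 w t" and "AE t in lebesgue. t \<notin> \<Omega> \<longrightarrow> u t = 0"
    by (rule G_approx[OF G]) (rule that; (assumption | (drule meta_spec, assumption)))
  define e where "e n = 1 / real (Suc n)" for n
  have e: "e n > 0" for n by (simp add: e_def)
  have e0: "e \<longlonglongrightarrow> 0" unfolding e_def using LIMSEQ_Suc[OF lim_1_over_n] by simp
  have nwt: "norm (wt f t) = \<rho> t * norm (f t)" for f t using \<rho>_nonneg[of t] by (simp add: wt_def)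
  have um: "u \<in> borel_measurable lebesgue" by (rule L2_D(1)[OF u])
  have wuL: "wt u \<in> L2 lebesgue"
    by (rule L2_dominated[OF wt_measurable[OF um] res_L2[OF rep_l2_in[of w]], of 1])
      (use ae in \<open>eventually_elim, simp\<close>)
  have wu: "to_l2 (wt u) = res w"
    unfolding mul_def by (rule iffD2[OF to_l2_eq_iff[OF wuL res_L2[OF rep_l2_in]] ae])
  define \<psi> where "\<psi> n t = trunc (e n) (\<phi> n t)" for n t
  have \<psi>: "\<psi> n \<in> test_functions \<Omega>" for n
    unfolding \<psi>_def[abs_def]
    by (rule test_functions_restrict[OF \<phi>(1)[of n] smooth_trunc[OF e test_functions_smooth[OF \<phi>(1)]]]) (simp add: trunc_zero)
  have gb: "norm (to_l2 (grad (\<psi> n))) \<le> norm (to_l2 (grad (\<phi> n)))" for n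
  proof (intro norm_to_l2_le grad_L2[OF \<psi>] grad_L2[OF \<phi>(1)] AE_I2)
    show "norm (grad (\<psi> n) x) \<le> norm (grad (\<phi> n) x)" for x
      unfolding \<psi>_def[abs_def] by (rule norm_grad_trunc_le[OF e test_functions_smooth[OF \<phi>(1)]])
  qed
  let ?v = "\<lambda>n t. trunc (e n) (u t)"
  let ?T = "\<lambda>t. trunc 0 (u t)"
  have vm: "wt (?v n) \<in> borel_measurable lebesgue" for n
    by (rule wt_measurable[OF trunc_measurable[OF less_imp_le[OF e] um]])
  have Tm: "wt ?T \<in> borel_measurable lebesgue" by (rule wt_measurable[OF trunc_measurable[OF order_refl um]])
  have vle: "AE x in lebesgue. norm (wt (?v n) x) \<le> 1 * norm (wt u x)" for n
    unfolding nwt by (intro AE_I2) (simp add: mult_left_mono \<rho>_nonneg norm_trunc_le less_imp_le[OF e])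
  have vT: "AE x in lebesgue. (\<lambda>n. wt (?v n) x) \<longlonglongrightarrow> wt ?T x"
    unfolding wt_def by (intro AE_I2 tendsto_scaleR tendsto_const trunc_tendsto[OF e0])
  note dc = to_l2_dominated_convergence[OF vm Tm wuL vle vT]
  \<comment> \<open>Function and smoothing parameter vary together. Contractivity of
    \<open>trunc (e n)\<close> first replaces \<open>\<phi> n\<close> by \<open>u\<close> at no
    extra cost; the limit \<open>e n\<close> to 0 is then dominated by \<open>wt u\<close>.\<close>
  have "(\<lambda>n. to_l2 (wt (\<psi> n)) - to_l2 (wt (?v n))) \<longlonglongrightarrow> 0"
  proof (rule Lim_null_comparison)
    show "(\<lambda>n. norm (to_l2 (wt (\<phi> n)) - to_l2 (wt u))) \<longlonglongrightarrow> 0"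
      using lw unfolding wu by (intro tendsto_norm_zero) (simp add: LIM_zero_iff)
    have "norm (to_l2 (wt (\<psi> n)) - to_l2 (wt (?v n))) \<le> norm (to_l2 (wt (\<phi> n)) - to_l2 (wt u))" for n
      unfolding to_l2_diff[OF wt_L2[OF \<psi>] dc(1)] to_l2_diff[OF wt_L2[OF \<phi>(1)] wuL]
    proof (intro norm_to_l2_le L2_diff[OF wt_L2[OF \<psi>] dc(1)] L2_diff[OF wt_L2[OF \<phi>(1)] wuL] AE_I2)
      fix x
      have "norm (\<psi> n x - ?v n x) \<le> norm (\<phi> n x - u x)"
        unfolding \<psi>_def by (rule trunc_lipschitz[OF less_imp_le[OF e]])
      then show "norm (wt (\<psi> n) x - wt (?v n) x) \<le> norm (wt (\<phi> n) x - wt u x)"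
        unfolding wt_def scaleR_diff_right[symmetric] by (simp add: mult_left_mono)
    qed
    then show "\<forall>\<^sub>F n in sequentially. norm (to_l2 (wt (\<psi> n)) - to_l2 (wt (?v n))) \<le> norm (to_l2 (wt (\<phi> n)) - to_l2 (wt u))"
      by simp
  qed
  from tendsto_add[OF this dc(3)] have lT: "(\<lambda>n. to_l2 (wt (\<psi> n))) \<longlonglongrightarrow> to_l2 (wt ?T)" by simp
  obtain g' where g': "(to_l2 (wt ?T), g') \<in> G" "norm g' \<le> norm g"
    using closed_subspace_bounded_limit[OF closed_G subspace_G test_in_G[OF \<psi>] lT gb tendsto_norm[OF \<phi>(2)]] by blast
  \<comment> \<open>Outside \<Omega> the values of \<open>w\<close> are kept, so that the truncation
    does not change the distance to \<open>f\<close> there.\<close>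
  let ?q = "\<lambda>t. (1 - chi t) * rep_l2 w t"
  have ch: "norm (1 - chi t) \<le> 1" for t by (simp add: chi_def)
  have qL: "?q \<in> L2 lebesgue"
    by (rule mul_L2[OF borel_measurable_diff[OF borel_measurable_const chi_bounded(1)] ch rep_l2_in])
  have "(to_l2 ?q, 0) \<in> G" by (rule subsetD[OF G0_subset_G G0_outside[OF qL]]) (simp add: chi_def)
  from subspace_add[OF subspace_G g'(1) this]
  have in_G: "(to_l2 (\<lambda>t. wt ?T t + ?q t), g') \<in> G" by (simp add: to_l2_add[OF dc(2) qL])
  show ?thesis
  proof (rule that[OF in_G g'(2) L2_add[OF dc(2) qL]])
    show "AE t in lebesgue. t \<notin> \<Omega> \<longrightarrow> wt ?T t + ?q t = rep_l2 w t"
      by (intro AE_I2) (simp add: wt_def \<rho>_def chi_def)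
    show "AE t in lebesgue. t \<in> \<Omega> \<longrightarrow> wt ?T t + ?q t = complex_of_real (min (Re (rep_l2 w t)) (\<rho> t))"
      using ae
    proof eventually_elim
      case (elim t)
      show ?case
      proof
        assume t: "t \<in> \<Omega>"
        then have w: "rep_l2 w t = \<rho> t *\<^sub>R u t" using elim by (simp add: wt_def chi_def)
        have "wt ?T t = complex_of_real (\<rho> t * min (Re (u t)) 1)" by (simp add: wt_def trunc_at_0 scaleR_conv_of_real)
        also have "\<rho> t * min (Re (u t)) 1 = min (Re (rep_l2 w t)) (\<rho> t)"
          using \<rho>_pos[OF t] unfolding w by (auto simp: min_def)
        finally show "wt ?T t + ?q t = complex_of_real (min (Re (rep_l2 w t)) (\<rho> t))" using t by (simp add: chi_def)
      qed
    qed
  qed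
qed

text \<open>The counterpart of \<open>C_set\<close> in the whole-space Hilbert space, with no
  condition outside \<Omega>.\<close>

definition K :: "('a, complex) l2 set" where
  "K = {x. AE t in lebesgue. t \<in> \<Omega> \<longrightarrow> Im (rep_l2 x t) = 0 \<and> Re (rep_l2 x t) \<le> \<rho> t}"

lemma closed_K: "closed K"
  unfolding closed_sequential_limits
proof (intro allI impI, elim conjE)
  fix x l assume x: "\<forall>n. x n \<in> K" "x \<longlonglongrightarrow> l"
  have "(\<lambda>n. to_l2 (rep_l2 (x n))) \<longlonglongrightarrow> to_l2 (rep_l2 l)" using x(2) by simp
  then obtain r where r: "strict_mono (r :: nat \<Rightarrow> nat)" "AE t in lebesgue. (\<lambda>n. rep_l2 (x (r n)) t) \<longlonglongrightarrow> rep_l2 l t"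
    using to_l2_tendsto_AE_subseq[OF rep_l2_in rep_l2_in] by blast
  have "AE t in lebesgue. \<forall>n. t \<in> \<Omega> \<longrightarrow> Im (rep_l2 (x n) t) = 0 \<and> Re (rep_l2 (x n) t) \<le> \<rho> t"
    unfolding AE_all_countable using x(1) by (simp add: K_def)
  with r(2) have "AE t in lebesgue. t \<in> \<Omega> \<longrightarrow> Im (rep_l2 l t) = 0 \<and> Re (rep_l2 l t) \<le> \<rho> t"
  proof eventually_elim
    case (elim t)
    show ?case
    proof (intro impI conjI)
      assume t: "t \<in> \<Omega>"
      have "(\<lambda>n. Im (rep_l2 (x (r n)) t)) \<longlonglongrightarrow> Im (rep_l2 l t)" by (intro tendsto_Im elim)
      then show "Im (rep_l2 l t) = 0" using elim(2) t by (simp add: LIMSEQ_const_iff)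
      have "(\<lambda>n. Re (rep_l2 (x (r n)) t)) \<longlonglongrightarrow> Re (rep_l2 l t)" by (intro tendsto_Re elim)
      then show "Re (rep_l2 l t) \<le> \<rho> t" by (rule LIMSEQ_le_const2) (use elim(2) t in blast)
    qed
  qed
  then show "l \<in> K" by (simp add: K_def)
qed

lemma convex_K: "convex K"
proof (rule convexI)
  fix x y and a b :: real
  assume x: "x \<in> K" and y: "y \<in> K" and ab: "0 \<le> a" "0 \<le> b" "a + b = 1"
  have "AE t in lebesgue. t \<in> \<Omega> \<longrightarrow> Im (rep_l2 x t) = 0 \<and> Re (rep_l2 x t) \<le> \<rho> t" 
    "AE t in lebesgue. t \<in> \<Omega> \<longrightarrow> Im (rep_l2 y t) = 0 \<and> Re (rep_l2 y t) \<le> \<rho> t" using x y by (simp_all add: K_def)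
  with rep_l2_add[of "a *\<^sub>R x" "b *\<^sub>R y"] rep_l2_scaleR[of a x] rep_l2_scaleR[of b y]
  have "AE t in lebesgue. t \<in> \<Omega> \<longrightarrow> Im (rep_l2 (a *\<^sub>R x + b *\<^sub>R y) t) = 0 \<and> Re (rep_l2 (a *\<^sub>R x + b *\<^sub>R y) t) \<le> \<rho> t"
  proof eventually_elim
    case (elim t)
    show ?case
    proof
      assume t: "t \<in> \<Omega>"
      have "a * Re (rep_l2 x t) + b * Re (rep_l2 y t) \<le> \<rho> t" 
        by (rule convex_bound_le) (use elim t ab in auto)
      then show "Im (rep_l2 (a *\<^sub>R x + b *\<^sub>R y) t) = 0 \<and> Re (rep_l2 (a *\<^sub>R x + b *\<^sub>R y) t) \<le> \<rho> t"
        using elim t by simp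
    qed
  qed
  then show "a *\<^sub>R x + b *\<^sub>R y \<in> K" by (simp add: K_def)
qed

text \<open>On \<Omega> the map \<open>z \<mapsto> min (Re z) \<rho>\<close> does not increase the
  distance to a real number below \<open>\<rho>\<close>. So the truncated pair competes with the
  resolvent in both terms, and uniqueness of the minimiser makes the resolvent equal to its own
  truncation.\<close>

lemma J_in_K:
  assumes h: "h > 0" and f: "f \<in> K"
  shows "J h f \<in> K"
proof -
  define w where "w = J h f"
  have wz: "(w, (w - f) /\<^sub>R h) \<in> form_op G" using J_in[OF h, of f] by (simp add: w_def)
  have wf: "w - h *\<^sub>R ((w - f) /\<^sub>R h) = f" using h by simp
  obtain g where g: "(w, g) \<in> G" 
    "\<And>w' g'. (w', g') \<in> G \<Longrightarrow> norm (w' - f) \<le> norm (w - f) \<Longrightarrow> norm g' \<le> norm g \<Longrightarrow> w' = w"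
    using form_resolvent_minimal[OF subspace_G wz h wf] by metis
  obtain w' g' where w': "(to_l2 w', g') \<in> G" "norm g' \<le> norm g" "w' \<in> L2 lebesgue"
    and ae: "AE t in lebesgue. t \<in> \<Omega> \<longrightarrow> w' t = complex_of_real (min (Re (rep_l2 w t)) (\<rho> t))"
    "AE t in lebesgue. t \<notin> \<Omega> \<longrightarrow> w' t = rep_l2 w t"
    by (rule truncation_in_G[OF g(1)])
  have fK: "AE t in lebesgue. t \<in> \<Omega> \<longrightarrow> Im (rep_l2 f t) = 0 \<and> Re (rep_l2 f t) \<le> \<rho> t" using f by (simp add: K_def)
  have "norm (to_l2 w' - to_l2 (rep_l2 f)) \<le> norm (to_l2 (rep_l2 w) - to_l2 (rep_l2 f))"
    unfolding to_l2_diff[OF w'(3) rep_l2_in] to_l2_diff[OF rep_l2_in[of w] rep_l2_in]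
  proof (intro norm_to_l2_le L2_diff w'(3) rep_l2_in)
    show "AE t in lebesgue. norm (w' t - rep_l2 f t) \<le> norm (rep_l2 w t - rep_l2 f t)"
      using ae fK
    proof eventually_elim
      case (elim t)
      show ?case
      proof (cases "t \<in> \<Omega>")
        case True
        have "w' t - rep_l2 f t = complex_of_real (min (Re (rep_l2 w t)) (\<rho> t) - Re (rep_l2 f t))"
          using elim True by (simp add: complex_eq_iff)
        then have "norm (w' t - rep_l2 f t) = \<bar>min (Re (rep_l2 w t)) (\<rho> t) - Re (rep_l2 f t)\<bar>"
          by (simp only: norm_of_real)
        also have "\<dots> \<le> \<bar>Re (rep_l2 w t - rep_l2 f t)\<bar>" using elim(3) True by (auto simp: min_def)
        also have "\<dots> \<le> norm (rep_l2 w t - rep_l2 f t)" by (rule abs_Re_le_cmod)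
        finally show ?thesis .
      qed (use elim in simp)
    qed
  qed
  then have "to_l2 w' = w" by (intro g(2)[OF w'(1) _ w'(2)]) simp
  then have "AE t in lebesgue. rep_l2 w t = w' t" using rep_to_l2[OF w'(3)] by simp
  with ae(1) have "AE t in lebesgue. t \<in> \<Omega> \<longrightarrow> Im (rep_l2 w t) = 0 \<and> Re (rep_l2 w t) \<le> \<rho> t"
  proof eventually_elim
    case (elim t)
    show ?case
    proof
      assume "t \<in> \<Omega>"
      then have "rep_l2 w t = complex_of_real (min (Re (rep_l2 w t)) (\<rho> t))" using elim by simp
      then obtain s where "rep_l2 w t = complex_of_real s" "s \<le> \<rho> t" by (metis min.cobounded2)
      then show "Im (rep_l2 w t) = 0 \<and> Re (rep_l2 w t) \<le> \<rho> t" by simp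
    qed
  qed
  then show ?thesis by (simp add: K_def w_def)
qed

lemma S_in_K: "t \<ge> 0 \<Longrightarrow> f \<in> K \<Longrightarrow> S t f \<in> K"
  by (rule S_invariant_closed_convex[OF closed_K convex_K J_in_K])

section \<open>Restriction to the open set and complex linearity\<close>

text \<open>Cutting off outside \<Omega> commutes with the operator; through
  \<open>S_commute\<close> the semigroup inherits this and restricts to functions on
  \<Omega>.\<close>

lemma res_pair_in_A:
  assumes "(w, z) \<in> form_op G"
  shows "(res w, res z) \<in> form_op G" "res z = z"
proof -
  obtain g where g: "(w, g) \<in> G" "\<And>v k. (v, k) \<in> G \<Longrightarrow> z \<bullet> v + g \<bullet> k = 0"
    using assms unfolding form_op_def by blast
  have out: "AE x in lebesgue. x \<notin> \<Omega> \<longrightarrow> rep_l2 z x = 0" using form_iff_weak_form[of z g] g(2) by blast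
  have "AE x in lebesgue. chi x * rep_l2 z x = rep_l2 z x" using out by eventually_elim (simp add: chi_def)
  then have "to_l2 (\<lambda>x. chi x * rep_l2 z x) = to_l2 (rep_l2 z)"
    using to_l2_eq_iff[OF res_L2[OF rep_l2_in] rep_l2_in] by blast
  then show z: "res z = z" by (simp add: mul_def)
  show "(res w, res z) \<in> form_op G" unfolding z form_op_def using res_in_G[OF g(1)] g(2) by blast
qed

lemma mi_pair_in_A:
  assumes "(w, z) \<in> form_op G"
  shows "(mi w, mi z) \<in> form_op G"
proof -
  obtain g where g: "(w, g) \<in> G" "\<And>v k. (v, k) \<in> G \<Longrightarrow> z \<bullet> v + g \<bullet> k = 0"
    using assms unfolding form_op_def by blast
  \<comment> \<open>Multiplication by \<i> is skew for both real inner products, so it is moved onto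
    the test pair, which stays in \<open>G\<close>.\<close>
  have "mi z \<bullet> v + rot g \<bullet> k = 0" if "(v, k) \<in> G" for v k
    using g(2)[OF mi_in_G[OF that]] by (simp add: inner_mul_i inner_rot)
  then show ?thesis unfolding form_op_def using mi_in_G[OF g(1)] by blast
qed

lemma cmul_eq: "mul (\<lambda>t. c) x = Re c *\<^sub>R x + Im c *\<^sub>R mi x"
proof -
  obtain f where x: "f \<in> L2 lebesgue" "x = to_l2 f" by (rule to_l2_cases)
  have c: "(\<lambda>t::'a. c) \<in> borel_measurable lebesgue" "\<And>t::'a. norm c \<le> norm c" by auto
  show ?thesis
    unfolding x(2) mul_to_l2[OF c x(1)] mul_to_l2[OF const_i x(1)] to_l2_scaleR[OF x(1)] to_l2_scaleR[OF mul_L2[OF const_i x(1)]]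
      to_l2_add[OF L2_scaleR[OF x(1)] L2_scaleR[OF mul_L2[OF const_i x(1)]]]
    by (rule arg_cong[of _ _ to_l2]) (auto simp: fun_eq_iff complex_eq_iff)
qed

lemma cmul_pair_in_A: "(w, z) \<in> form_op G \<Longrightarrow> (mul (\<lambda>t. c) w, mul (\<lambda>t. c) z) \<in> form_op G"
  unfolding cmul_eq[of c w] cmul_eq[of c z] by (intro A_add A_scale mi_pair_in_A)

lemma emb_add: "u \<in> L2 (lebesgue_on \<Omega>) \<Longrightarrow> v \<in> L2 (lebesgue_on \<Omega>) \<Longrightarrow> emb (\<lambda>x. u x + v x) = emb u + emb v"
  unfolding to_l2_add[OF emb_L2 emb_L2] by (simp add: scaleR_add_right)

lemma emb_diff: "u \<in> L2 (lebesgue_on \<Omega>) \<Longrightarrow> v \<in> L2 (lebesgue_on \<Omega>) \<Longrightarrow> emb (\<lambda>x. u x - v x) = emb u - emb v"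
  unfolding to_l2_diff[OF emb_L2 emb_L2] by (simp add: scaleR_diff_right)

lemma emb_cmult: 
  assumes "u \<in> L2 (lebesgue_on \<Omega>)"
  shows "emb (\<lambda>x. c * u x) = mul (\<lambda>t. c) (emb u)"
proof -
  have c: "(\<lambda>t::'a. c) \<in> borel_measurable lebesgue" "\<And>t::'a. norm c \<le> norm c" by auto
  show ?thesis unfolding mul_to_l2[OF c emb_L2[OF assms]] by simp
qed

lemma emb_eq_iff:
  assumes "u \<in> L2 (lebesgue_on \<Omega>)" "v \<in> L2 (lebesgue_on \<Omega>)"
  shows "emb u = emb v \<longleftrightarrow> L2_eq (lebesgue_on \<Omega>) u v"
  unfolding to_l2_eq_iff[OF emb_L2[OF assms(1)] emb_L2[OF assms(2)]] L2_eq_def AE_on_iff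
  by (rule arg_cong[of _ _ "\<lambda>P. almost_everywhere lebesgue P"]) (auto simp: fun_eq_iff split: split_indicator)

lemma norm_emb: "u \<in> L2 (lebesgue_on \<Omega>) \<Longrightarrow> L2_norm (lebesgue_on \<Omega>) u = norm (emb u)"
  by (rule L2_norm_lebesgue_on[OF open_\<Omega>])

lemma rep_on: "rep_l2 (x :: ('a, complex) l2) \<in> L2 (lebesgue_on \<Omega>)"
  by (rule L2_on_lebesgue[OF rep_l2_in])

lemma inner_emb:
  assumes f: "f \<in> L2 (lebesgue_on \<Omega>)" and g: "g \<in> L2 (lebesgue_on \<Omega>)"
  shows "Re (L2_inner (lebesgue_on \<Omega>) f g) = emb f \<bullet> emb g"
proof -
  have gc: "(\<lambda>x. cnj (indicator \<Omega> x *\<^sub>R g x)) \<in> L2 lebesgue"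
    by (rule L2_dominated[OF borel_measurable_continuous_on[OF _ L2_D(1)[OF emb_L2[OF g]]] emb_L2[OF g], of _ 1])
      (auto intro!: continuous_intros)
  have int: "integrable lebesgue (\<lambda>x. (indicator \<Omega> x *\<^sub>R f x) * cnj (indicator \<Omega> x *\<^sub>R g x))"
    by (rule L2_integral_mult_le(1)[OF emb_L2[OF f] gc])
  have "L2_inner (lebesgue_on \<Omega>) f g = (LINT x|lebesgue. (indicator \<Omega> x *\<^sub>R f x) * cnj (indicator \<Omega> x *\<^sub>R g x))"
    unfolding L2_inner_def integral_lebesgue_on_open[OF open_\<Omega>]
    by (rule Bochner_Integration.integral_cong) (auto split: split_indicator)
  then have "Re (L2_inner (lebesgue_on \<Omega>) f g) = (LINT x|lebesgue. Re ((indicator \<Omega> x *\<^sub>R f x) * cnj (indicator \<Omega> x *\<^sub>R g x)))"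
    using integral_bounded_linear[OF bounded_linear_Re int] by simp
  also have "\<dots> = emb f \<bullet> emb g"
    unfolding to_l2_inner[OF emb_L2[OF f] emb_L2[OF g]] inner_complex_eq ..
  finally show ?thesis .
qed

lemma L2_inner_cmult: "L2_inner (lebesgue_on \<Omega>) (\<lambda>x. c * f x) g = c * L2_inner (lebesgue_on \<Omega>) f g"
  unfolding L2_inner_def by (simp add: mult.assoc)

lemma D_subset: "(w, f) \<in> m_Delta_m \<Omega> m \<Longrightarrow> w \<in> L2 (lebesgue_on \<Omega>) \<and> f \<in> L2 (lebesgue_on \<Omega>)"
  by (simp add: m_Delta_m_def)

lemma D_iff: "(w, f) \<in> m_Delta_m \<Omega> m \<longleftrightarrow> 
    w \<in> L2 (lebesgue_on \<Omega>) \<and> f \<in> L2 (lebesgue_on \<Omega>) \<and> (emb w, emb f) \<in> form_op G"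
  using D_subset m_Delta_m_iff by blast

lemma rep_pair_in_D: "(w, z) \<in> form_op G \<Longrightarrow> (rep_l2 w, rep_l2 z) \<in> m_Delta_m \<Omega> m"
  unfolding D_iff emb_rep using rep_on res_pair_in_A(1) by blast

text \<open>Both values are the derivative at 0 of the same orbit of the semigroup.\<close>

lemma A_single_valued: "(w, z) \<in> form_op G \<Longrightarrow> (w, z') \<in> form_op G \<Longrightarrow> z = z'"
  unfolding generator_eq[symmetric] by (rule tendsto_unique[OF trivial_limit_at_right_real])

section \<open>Self-adjointness of the operator on the open set\<close>

lemma D_linear_operator: "linear_operator (lebesgue_on \<Omega>) (m_Delta_m \<Omega> m)"
  unfolding linear_operator_def
proof (intro conjI)
  show "m_Delta_m \<Omega> m \<subseteq> L2 (lebesgue_on \<Omega>) \<times> L2 (lebesgue_on \<Omega>)" using D_subset by auto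
  have "(0, 0) \<in> form_op G" using subspace_0[OF sub] by (simp add: zero_prod_def)
  then show "(\<lambda>x. 0, \<lambda>x. 0) \<in> m_Delta_m \<Omega> m" by (simp add: D_iff L2_zero zero_l2_def)
  show "\<forall>(u, f)\<in>m_Delta_m \<Omega> m. \<forall>(v, g)\<in>m_Delta_m \<Omega> m. (\<lambda>x. u x + v x, \<lambda>x. f x + g x) \<in> m_Delta_m \<Omega> m"
  proof (clarify)
    fix u f v g assume "(u, f) \<in> m_Delta_m \<Omega> m" "(v, g) \<in> m_Delta_m \<Omega> m"
    then have uf: "u \<in> L2 (lebesgue_on \<Omega>)" "f \<in> L2 (lebesgue_on \<Omega>)" "(emb u, emb f) \<in> form_op G"
      and vg: "v \<in> L2 (lebesgue_on \<Omega>)" "g \<in> L2 (lebesgue_on \<Omega>)" "(emb v, emb g) \<in> form_op G" by (simp_all add: D_iff)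
    show "(\<lambda>x. u x + v x, \<lambda>x. f x + g x) \<in> m_Delta_m \<Omega> m"
      unfolding D_iff using L2_add[OF uf(1) vg(1)] L2_add[OF uf(2) vg(2)] A_add[OF uf(3) vg(3)]
      by (simp only: emb_add[OF uf(1) vg(1)] emb_add[OF uf(2) vg(2)] simp_thms)
  qed
  show "\<forall>c. \<forall>(u, f)\<in>m_Delta_m \<Omega> m. (\<lambda>x. c * u x, \<lambda>x. c * f x) \<in> m_Delta_m \<Omega> m"
  proof (intro allI ballI, clarify)
    fix c u f assume "(u, f) \<in> m_Delta_m \<Omega> m"
    then have u: "u \<in> L2 (lebesgue_on \<Omega>)" and f: "f \<in> L2 (lebesgue_on \<Omega>)" and A: "(emb u, emb f) \<in> form_op G"
      by (simp_all add: D_iff)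
    show "(\<lambda>x. c * u x, \<lambda>x. c * f x) \<in> m_Delta_m \<Omega> m"
      unfolding D_iff using L2_cmult[OF u] L2_cmult[OF f] cmul_pair_in_A[OF A, of c]
      by (simp only: emb_cmult[OF u] emb_cmult[OF f] simp_thms)
  qed
  show "\<forall>(u, f)\<in>m_Delta_m \<Omega> m. \<forall>v\<in>L2 (lebesgue_on \<Omega>). \<forall>g\<in>L2 (lebesgue_on \<Omega>).
     L2_eq (lebesgue_on \<Omega>) u v \<and> L2_eq (lebesgue_on \<Omega>) f g \<longrightarrow> (v, g) \<in> m_Delta_m \<Omega> m"
  proof (clarify)
    fix u f v g
    assume "(u, f) \<in> m_Delta_m \<Omega> m" and vg: "v \<in> L2 (lebesgue_on \<Omega>)" "g \<in> L2 (lebesgue_on \<Omega>)"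
      and eq: "L2_eq (lebesgue_on \<Omega>) u v" "L2_eq (lebesgue_on \<Omega>) f g"
    then have uf: "u \<in> L2 (lebesgue_on \<Omega>)" "f \<in> L2 (lebesgue_on \<Omega>)" "(emb u, emb f) \<in> form_op G" by (simp_all add: D_iff)
    have "emb u = emb v" "emb f = emb g" 
      using iffD2[OF emb_eq_iff[OF uf(1) vg(1)] eq(1)] iffD2[OF emb_eq_iff[OF uf(2) vg(2)] eq(2)] .
    then show "(v, g) \<in> m_Delta_m \<Omega> m" using uf(3) vg by (simp add: D_iff)
  qed
  show "\<forall>(u, f)\<in>m_Delta_m \<Omega> m. \<forall>(v, g)\<in>m_Delta_m \<Omega> m. L2_eq (lebesgue_on \<Omega>) u v \<longrightarrow> L2_eq (lebesgue_on \<Omega>) f g"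
  proof (clarify)
    fix u f v g
    assume "(u, f) \<in> m_Delta_m \<Omega> m" "(v, g) \<in> m_Delta_m \<Omega> m" and eq: "L2_eq (lebesgue_on \<Omega>) u v"
    then have uf: "u \<in> L2 (lebesgue_on \<Omega>)" "f \<in> L2 (lebesgue_on \<Omega>)" "(emb u, emb f) \<in> form_op G"
      and vg: "v \<in> L2 (lebesgue_on \<Omega>)" "g \<in> L2 (lebesgue_on \<Omega>)" "(emb v, emb g) \<in> form_op G" by (simp_all add: D_iff)
    have "emb u = emb v" by (rule iffD2[OF emb_eq_iff[OF uf(1) vg(1)] eq])
    then have "emb f = emb g" using A_single_valued[OF uf(3)] vg(3) by simp
    then show "L2_eq (lebesgue_on \<Omega>) f g" by (rule iffD1[OF emb_eq_iff[OF uf(2) vg(2)]])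
  qed
qed

lemma D_densely_defined: "densely_defined (lebesgue_on \<Omega>) (m_Delta_m \<Omega> m)"
  unfolding densely_defined_def
proof (intro ballI allI impI)
  fix u :: "'a \<Rightarrow> complex" and e :: real assume u: "u \<in> L2 (lebesgue_on \<Omega>)" and e: "e > 0"
  have "emb u \<in> closure (Domain (form_op G))" using dense by simp
  then obtain w where "w \<in> Domain (form_op G)" "dist w (emb u) < e" using e closure_approachable by blast
  then obtain z where wz: "(w, z) \<in> form_op G" and d: "norm (w - emb u) < e" by (auto simp: dist_norm)
  have "L2_norm (lebesgue_on \<Omega>) (\<lambda>x. rep_l2 w x - u x) = norm (res w - emb u)"
    by (simp only: norm_emb[OF L2_diff[OF rep_on u]] emb_diff[OF rep_on u] emb_rep)
  \<comment> \<open>Cutting off fixes \<open>emb u\<close> and is a contraction, so the approximant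
    may be restricted to \<Omega> without losing accuracy.\<close>
  also have "\<dots> = norm (res (w - emb u))" 
    using linear_diff[OF bounded_linear.linear[OF res_linear], of w "emb u"] res_emb[OF u] by simp
  also have "\<dots> \<le> norm (w - emb u)"
  proof -
    obtain f where x: "f \<in> L2 lebesgue" "w - emb u = to_l2 f" by (rule to_l2_cases)
    show ?thesis unfolding x(2) res_to_l2[OF x(1)]
      by (intro norm_to_l2_le res_L2 x(1) AE_I2) (simp add: chi_def)
  qed
  finally have "L2_norm (lebesgue_on \<Omega>) (\<lambda>x. rep_l2 w x - u x) < e" using d by simp
  then show "\<exists>w\<in>Domain (m_Delta_m \<Omega> m). L2_norm (lebesgue_on \<Omega>) (\<lambda>x. w x - u x) < e"
    using rep_pair_in_D[OF wz] by blast
qed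

lemma D_self_adjoint: "self_adjoint (lebesgue_on \<Omega>) (m_Delta_m \<Omega> m)"
  unfolding self_adjoint_def
proof (intro conjI D_linear_operator D_densely_defined)
  show "adjoint_graph (lebesgue_on \<Omega>) (m_Delta_m \<Omega> m) = m_Delta_m \<Omega> m"
  proof (intro set_eqI iffI; clarify)
    fix v g assume "(v, g) \<in> adjoint_graph (lebesgue_on \<Omega>) (m_Delta_m \<Omega> m)"
    then have vg: "v \<in> L2 (lebesgue_on \<Omega>)" "g \<in> L2 (lebesgue_on \<Omega>)"
      and adj: "\<And>u f. (u, f) \<in> m_Delta_m \<Omega> m \<Longrightarrow> L2_inner (lebesgue_on \<Omega>) f v = L2_inner (lebesgue_on \<Omega>) u g"
      unfolding adjoint_graph_def by auto
    have "(emb v, emb g) \<in> form_op G"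
    proof (rule adjoint_in[OF form_op_symmetric])
      fix w z assume wz: "(w, z) \<in> form_op G"
      \<comment> \<open>Cutting off is symmetric, so pairings with functions supported in \<Omega>
        do not see the part of \<open>w\<close> and \<open>z\<close> outside.\<close>
      have rs: "res x \<bullet> y = x \<bullet> res y" for x y
      proof -
        obtain f where x: "f \<in> L2 lebesgue" "x = to_l2 f" by (rule to_l2_cases)
        obtain h where y: "h \<in> L2 lebesgue" "y = to_l2 h" by (rule to_l2_cases)
        show ?thesis unfolding x(2) y(2) res_to_l2[OF x(1)] res_to_l2[OF y(1)]
            to_l2_inner[OF res_L2[OF x(1)] y(1)] to_l2_inner[OF x(1) res_L2[OF y(1)]]
          by (rule Bochner_Integration.integral_cong) (auto simp: chi_def)
      qed
      have "emb (rep_l2 z) \<bullet> emb v = emb (rep_l2 w) \<bullet> emb g"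
        using adj[OF rep_pair_in_D[OF wz]] inner_emb[OF rep_on vg(1)] inner_emb[OF rep_on vg(2)] by metis
      then show "z \<bullet> emb v = w \<bullet> emb g" by (simp only: emb_rep rs res_emb[OF vg(1)] res_emb[OF vg(2)])
    qed
    then show "(v, g) \<in> m_Delta_m \<Omega> m" using vg by (simp add: D_iff)
  next
    fix v g assume vg: "(v, g) \<in> m_Delta_m \<Omega> m"
    have re: "Re (L2_inner (lebesgue_on \<Omega>) f v) = Re (L2_inner (lebesgue_on \<Omega>) u g)" if "(u, f) \<in> m_Delta_m \<Omega> m" for u f
    proof -
      have "emb f \<bullet> emb v = emb u \<bullet> emb g" by (rule form_op_symmetric) (use that vg in \<open>auto simp: D_iff\<close>)
      then show ?thesis using that vg by (simp add: D_iff inner_emb)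
    qed
    \<comment> \<open>Symmetry of the form only yields real parts; the imaginary part comes from the
      pair multiplied by \<i>.\<close>
    have "L2_inner (lebesgue_on \<Omega>) f v = L2_inner (lebesgue_on \<Omega>) u g" if uf: "(u, f) \<in> m_Delta_m \<Omega> m" for u f
    proof (rule complex_eqI[OF re[OF uf]])
      have "(\<lambda>x. \<i> * u x, \<lambda>x. \<i> * f x) \<in> m_Delta_m \<Omega> m"
        using D_linear_operator uf unfolding linear_operator_def by fast
      from re[OF this] show "Im (L2_inner (lebesgue_on \<Omega>) f v) = Im (L2_inner (lebesgue_on \<Omega>) u g)"
        by (simp add: L2_inner_cmult)
    qed
    then show "(v, g) \<in> adjoint_graph (lebesgue_on \<Omega>) (m_Delta_m \<Omega> m)"
      using vg unfolding adjoint_graph_def by (auto simp: D_iff)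
  qed
qed

section \<open>The semigroup on the open set\<close>

text \<open>The chosen representative has irrelevant values outside \<Omega>; since
  \<open>S t\<close> commutes with cutting off, embedding \<open>T t f\<close> gives back
  \<open>S t (emb f)\<close> for \<open>t \<ge> 0\<close>.\<close>

definition T :: "real \<Rightarrow> ('a \<Rightarrow> complex) \<Rightarrow> 'a \<Rightarrow> complex" where "T t f = rep_l2 (S t (emb f))"

lemma T_on: "T t f \<in> L2 (lebesgue_on \<Omega>)"
  unfolding T_def by (rule rep_on)

lemma S_res: "t \<ge> 0 \<Longrightarrow> res (S t x) = S t (res x)"
  by (rule S_commute[symmetric, OF res_linear res_pair_in_A(1)])

lemma emb_T: "t \<ge> 0 \<Longrightarrow> f \<in> L2 (lebesgue_on \<Omega>) \<Longrightarrow> emb (T t f) = S t (emb f)"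
  unfolding T_def emb_rep by (simp add: S_res res_emb)

lemma T_C0_semigroup: "C0_semigroup (lebesgue_on \<Omega>) T"
  unfolding C0_semigroup_def
proof (intro conjI allI impI ballI)
  fix t :: real assume t: "t \<ge> 0"
  interpret St: bounded_linear "S t" by (rule S_linear[OF t])
  show "bounded_operator (lebesgue_on \<Omega>) (T t)"
    unfolding bounded_operator_def
  proof (intro conjI allI ballI impI T_on)
    fix u v :: "'a \<Rightarrow> complex" assume u: "u \<in> L2 (lebesgue_on \<Omega>)" and v: "v \<in> L2 (lebesgue_on \<Omega>)"
    show "L2_eq (lebesgue_on \<Omega>) (T t u) (T t v)" if "L2_eq (lebesgue_on \<Omega>) u v"
      using iffD2[OF emb_eq_iff[OF u v] that] by (simp add: T_def L2_eq_def)
    show "L2_eq (lebesgue_on \<Omega>) (T t (\<lambda>x. u x + v x)) (\<lambda>x. T t u x + T t v x)"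
      unfolding emb_eq_iff[OF T_on L2_add[OF T_on T_on], symmetric]
      by (simp only: emb_add[OF T_on T_on] emb_T[OF t] L2_add u v emb_add[OF u v] St.add)
  next
    fix c :: complex and u :: "'a \<Rightarrow> complex" assume u: "u \<in> L2 (lebesgue_on \<Omega>)"
    have c: "(\<lambda>t::'a. c) \<in> borel_measurable lebesgue" "\<And>t::'a. norm c \<le> norm c" by auto
    show "L2_eq (lebesgue_on \<Omega>) (T t (\<lambda>x. c * u x)) (\<lambda>x. c * T t u x)"
      unfolding emb_eq_iff[OF T_on L2_cmult[OF T_on], symmetric]
      by (simp only: emb_cmult[OF T_on] emb_T[OF t] L2_cmult u emb_cmult[OF u] 
          S_commute[OF bounded_linear_mul[OF c] cmul_pair_in_A t])
  next
    show "\<exists>K. \<forall>u\<in>L2 (lebesgue_on \<Omega>). L2_norm (lebesgue_on \<Omega>) (T t u) \<le> K * L2_norm (lebesgue_on \<Omega>) u"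
      by (intro exI[of _ 1] ballI) (simp add: norm_emb T_on emb_T t norm_S_le)
  qed
next
  fix u :: "'a \<Rightarrow> complex" assume u: "u \<in> L2 (lebesgue_on \<Omega>)"
  show "L2_eq (lebesgue_on \<Omega>) (T 0 u) u"
    unfolding emb_eq_iff[OF T_on u, symmetric] by (simp only: emb_T[OF order_refl u] S_zero)
  show "((\<lambda>t. L2_norm (lebesgue_on \<Omega>) (\<lambda>x. T t u x - u x)) \<longlongrightarrow> 0) (at_right 0)"
  proof (rule Lim_transform_eventually)
    show "((\<lambda>t. norm (S t (emb u) - emb u)) \<longlongrightarrow> 0) (at_right 0)" by (rule tendsto_norm_zero[OF S_continuous])
    show "\<forall>\<^sub>F t in at_right 0. norm (S t (emb u) - emb u) = L2_norm (lebesgue_on \<Omega>) (\<lambda>x. T t u x - u x)"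
      using eventually_at_right_less[of 0]
      by eventually_elim (simp only: norm_emb[OF L2_diff[OF T_on u]] emb_diff[OF T_on u] emb_T[OF less_imp_le u])
  qed
next
  fix s t :: real and u :: "'a \<Rightarrow> complex" assume s: "s \<ge> 0" and t: "t \<ge> 0" and u: "u \<in> L2 (lebesgue_on \<Omega>)"
  show "L2_eq (lebesgue_on \<Omega>) (T (s + t) u) (T s (T t u))"
    unfolding emb_eq_iff[OF T_on T_on, symmetric]
    by (simp only: emb_T[OF s T_on] emb_T[OF t u] emb_T[OF add_nonneg_nonneg[OF s t] u] S_add[OF s t])
qed

lemma T_generates: "generates (lebesgue_on \<Omega>) (m_Delta_m \<Omega> m) T"
  unfolding generates_def
proof (intro conjI T_C0_semigroup)
  have "((\<lambda>t. L2_norm (lebesgue_on \<Omega>) (\<lambda>x. (T t u x - u x) / complex_of_real t - f x)) \<longlongrightarrow> 0) (at_right 0)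
    \<longleftrightarrow> (emb u, emb f) \<in> form_op G" if u: "u \<in> L2 (lebesgue_on \<Omega>)" and f: "f \<in> L2 (lebesgue_on \<Omega>)" for u f
  proof -
    have "((\<lambda>t. L2_norm (lebesgue_on \<Omega>) (\<lambda>x. (T t u x - u x) / complex_of_real t - f x)) \<longlongrightarrow> 0) (at_right 0)
      \<longleftrightarrow> ((\<lambda>t. norm ((S t (emb u) - emb u) /\<^sub>R t - emb f)) \<longlongrightarrow> 0) (at_right 0)"
    proof (rule tendsto_cong)
      show "\<forall>\<^sub>F t in at_right 0. L2_norm (lebesgue_on \<Omega>) (\<lambda>x. (T t u x - u x) / complex_of_real t - f x) = 
          norm ((S t (emb u) - emb u) /\<^sub>R t - emb f)"
        using eventually_at_right_less[of 0]
      proof eventually_elim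
        case (elim t)
        have q: "(\<lambda>x. (T t u x - u x) / complex_of_real t) = (\<lambda>x. complex_of_real (inverse t) * (T t u x - u x))"
          by (simp add: divide_inverse mult.commute)
        have d: "(\<lambda>x. T t u x - u x) \<in> L2 (lebesgue_on \<Omega>)" by (rule L2_diff[OF T_on u])
        have qL: "(\<lambda>x. (T t u x - u x) / complex_of_real t) \<in> L2 (lebesgue_on \<Omega>)" 
          unfolding q by (rule L2_cmult[OF d])
        have "emb (\<lambda>x. (T t u x - u x) / complex_of_real t) = emb (\<lambda>x. complex_of_real (inverse t) * (T t u x - u x))"
          by (simp add: divide_inverse mult.commute)
        also have "\<dots> = mul (\<lambda>_. complex_of_real (inverse t)) (emb (\<lambda>x. T t u x - u x))" by (rule emb_cmult[OF d])
        also have "\<dots> = emb (\<lambda>x. T t u x - u x) /\<^sub>R t" by (subst cmul_eq) (simp only: Re_complex_of_real Im_complex_of_real, simp)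
        also have "emb (\<lambda>x. T t u x - u x) = S t (emb u) - emb u"
          by (rule trans[OF emb_diff[OF T_on u]]) (simp only: emb_T[OF less_imp_le[OF elim] u])
        finally have "emb (\<lambda>x. (T t u x - u x) / complex_of_real t) = (S t (emb u) - emb u) /\<^sub>R t" .
        then show ?case by (simp only: norm_emb[OF L2_diff[OF qL f]] emb_diff[OF qL f])
      qed
    qed
    also have "\<dots> \<longleftrightarrow> (emb u, emb f) \<in> form_op G"
      unfolding generator_eq[symmetric] tendsto_norm_zero_iff LIM_zero_iff ..
    finally show ?thesis .
  qed
  then show "semigroup_generator (lebesgue_on \<Omega>) T = m_Delta_m \<Omega> m"
    unfolding semigroup_generator_def by (auto simp: D_iff)
qed

lemma C_set_imp_K: "f \<in> C_set \<Omega> m \<Longrightarrow> emb f \<in> K"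
proof -
  assume "f \<in> C_set \<Omega> m"
  then have f: "f \<in> L2 (lebesgue_on \<Omega>)" and le: "AE x in lebesgue. x \<in> \<Omega> \<longrightarrow> f x \<in> \<real> \<and> Re (f x) \<le> 1 / m x"
    by (auto simp: C_set_def AE_on_iff)
  have "AE t in lebesgue. t \<in> \<Omega> \<longrightarrow> Im (rep_l2 (emb f) t) = 0 \<and> Re (rep_l2 (emb f) t) \<le> \<rho> t"
    using le rep_emb[OF f] by eventually_elim (auto simp: \<rho>_def complex_is_Real_iff)
  then show ?thesis by (simp add: K_def)
qed

lemma T_in_C_set:
  assumes t: "t \<ge> 0" and f: "f \<in> C_set \<Omega> m"
  shows "T t f \<in> C_set \<Omega> m"
proof -
  have "S t (emb f) \<in> K" by (rule S_in_K[OF t C_set_imp_K[OF f]])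
  then have "AE x in lebesgue. x \<in> \<Omega> \<longrightarrow> Im (T t f x) = 0 \<and> Re (T t f x) \<le> \<rho> x" by (simp add: K_def T_def)
  then have "AE x in lebesgue. x \<in> \<Omega> \<longrightarrow> T t f x \<in> \<real> \<and> Re (T t f x) \<le> 1 / m x"
    by eventually_elim (auto simp: \<rho>_def complex_is_Real_iff)
  then show ?thesis using T_on[of t f] unfolding C_set_def AE_on_iff by blast
qed

text \<open>If \<open>u \<ge> 0\<close> then every multiple \<open>- n u\<close> lies in the invariant set, so \<open>- n T u \<le> 1 / m\<close> for all \<open>n\<close>.\<close>

lemma T_positive: "positive_semigroup (lebesgue_on \<Omega>) T"
  unfolding positive_semigroup_def
proof (intro allI impI ballI)
  fix t :: real and u :: "'a \<Rightarrow> complex"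
  assume t: "t > 0" and u: "u \<in> L2 (lebesgue_on \<Omega>)" and pos: "L2_nonneg (lebesgue_on \<Omega>) u"
  have t0: "t \<ge> 0" using t by simp
  \<comment> \<open>Each multiple \<open>- (n + 1) u\<close> is nonpositive, hence below the
    positive function \<open>1 / m\<close>; linearity moves the factor through
    \<open>T t\<close>.\<close>
  have "AE x in lebesgue_on \<Omega>. - of_nat (Suc n) * T t u x \<in> \<real> \<and> Re (- of_nat (Suc n) * T t u x) \<le> 1 / m x" for n
  proof -
    let ?c = "- of_nat (Suc n) :: complex"
    have "AE x in lebesgue. x \<in> \<Omega> \<longrightarrow> u x \<in> \<real> \<and> 0 \<le> Re (u x)" using pos unfolding L2_nonneg_def AE_on_iff .
    then have "AE x in lebesgue. x \<in> \<Omega> \<longrightarrow> ?c * u x \<in> \<real> \<and> Re (?c * u x) \<le> 1 / m x"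
    proof eventually_elim
      case (elim x)
      show ?case
      proof (intro impI conjI)
        assume x: "x \<in> \<Omega>"
        then show "?c * u x \<in> \<real>" using elim by (intro Reals_mult) auto
        have "Re (?c * u x) = - (real (Suc n) * Re (u x))" by (simp add: algebra_simps)
        also have "\<dots> \<le> 0" using elim x by (simp del: of_nat_Suc)
        also have "0 \<le> 1 / m x" using m_pos[OF x] by simp
        finally show "Re (?c * u x) \<le> 1 / m x" .
      qed
    qed
    then have "(\<lambda>x. ?c * u x) \<in> C_set \<Omega> m" using L2_cmult[OF u] unfolding C_set_def AE_on_iff by blast
    from T_in_C_set[OF t0 this]
    have 1: "AE x in lebesgue_on \<Omega>. T t (\<lambda>x. ?c * u x) x \<in> \<real> \<and> Re (T t (\<lambda>x. ?c * u x) x) \<le> 1 / m x"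
      by (simp add: C_set_def)
    have 2: "AE x in lebesgue_on \<Omega>. T t (\<lambda>x. ?c * u x) x = ?c * T t u x"
      using T_C0_semigroup t0 u unfolding C0_semigroup_def bounded_operator_def L2_eq_def by blast
    show ?thesis using 1 2 by eventually_elim simp
  qed
  then have "AE x in lebesgue_on \<Omega>. \<forall>n. - of_nat (Suc n) * T t u x \<in> \<real> \<and> Re (- of_nat (Suc n) * T t u x) \<le> 1 / m x"
    unfolding AE_all_countable by blast
  then show "L2_nonneg (lebesgue_on \<Omega>) (T t u)"
    unfolding L2_nonneg_def
  proof eventually_elim
    case (elim x)
    have le: "- Re (T t u x) * real (Suc n) \<le> 1 / m x" for n
      using conjunct2[OF spec[OF elim, of n]] by (simp add: algebra_simps)
    have "0 \<le> Re (T t u x)"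
    proof (rule ccontr)
      assume "\<not> 0 \<le> Re (T t u x)"
      then have "- Re (T t u x) > 0" by simp
      then obtain k where "1 / m x < real k * (- Re (T t u x))" using reals_Archimedean3 by blast
      also have "\<dots> \<le> real (Suc k) * (- Re (T t u x))" 
        using \<open>- Re (T t u x) > 0\<close> by (intro mult_right_mono) auto
      finally show False using le[of k] by (simp add: mult.commute)
    qed
    \<comment> \<open>The index 0 stands for the factor -1, so the image itself is real.\<close>
    moreover have "T t u x \<in> \<real>" using conjunct1[OF spec[OF elim, of 0]] by (simp add: complex_is_Real_iff)
    ultimately show ?case by blast
  qed
qed

lemma T_invariant: "invariant_under T (C_set \<Omega> m)"
  unfolding invariant_under_def using T_in_C_set by auto

end

theorem proposition4p10:
  fixes \<Omega> :: "'a::euclidean_space set" and m :: "'a \<Rightarrow> real"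
  assumes "open \<Omega>" and "bounded \<Omega>"
    and "m \<in> borel_measurable (lebesgue_on \<Omega>)"
    and "\<And>x. x \<in> \<Omega> \<Longrightarrow> 0 < m x"
    and "(\<lambda>x. 1 / m x) \<in> L2_loc \<Omega>"
  shows "self_adjoint (lebesgue_on \<Omega>) (m_Delta_m \<Omega> m) \<and>
         (\<exists>S. generates (lebesgue_on \<Omega>) (m_Delta_m \<Omega> m) S \<and>
              positive_semigroup (lebesgue_on \<Omega>) S \<and>
              invariant_under S (C_set \<Omega> m))"
proof -
  interpret weighted_domain \<Omega> m by unfold_locales (fact assms)+
  show ?thesis using D_self_adjoint T_generates T_positive T_invariant by blast
qed

end
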